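(* Let $\mathcal C$ be the category of all $R$-algebras with one product satisfying given relations $\mathcal R_1=0,\dots,\mathcal R_k=0$, and suppose that these relations are multilinear. Let $(A=\bigcup_iA_i,\prec,\succ)$ be an almost commutative filtered $\mathcal C$-dendriform algebra. On $\mathrm{gr}(A)$, consider the product $\times$, defined for $a,b\in\mathrm{gr}(A)$ by $a\times b:=a\succ b$, as well as the product $\bullet$, defined for $a\in A_i$ and $b\in A_j$ with $i,j\geq0$ by $$(a+A_{i-1})\bullet(b+A_{j-1}):=(a\succ b-b\prec a)+A_{i+j-2}\in\frac{A_{i+j-1}}{A_{i+j-2}} .$$ Then $(\mathrm{gr}(A),\times,\bullet)\in\underline{\mathcal C}^{\mathrm{dend}}_{\mathrm{pol}}=\bigl(\underline{\mathcal C}_{\mathrm{pol}}\bigr)^{\mathrm{dend}}$.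
   Context: $R$ is a commutative ring in which $2$ is invertible. An algebra is an $R$-module with one or more bilinear products, with no further property assumed. A relation is an expression $\mathcal R(x_1,\dots,x_n)$, an $R$-linear combination of parenthesized monomials in the products at hand; an algebra satisfies $\mathcal R=0$ if $\mathcal R$ vanishes for all values of the variables. It is multilinear ($n$-linear) if every monomial contains each $x_1,\dots,x_n$ exactly once. **Dendriform algebras.** $(A,\prec,\succ)$ is a $\mathcal C$-dendriform algebra if $(A\times A,\boxtimes)\in\mathcal C$, where $(a,x)\boxtimes(b,y):=(a\prec b+a\succ b,\ a\succ y+x\prec b)$. **Filtrations.** A filtered algebra $(A,\prec,\succ)$ is an algebra with an increasing sequence of submodules $A_0\subseteq A_1\subseteq A_2\subseteq\cdots$ such that $A=\bigcup_{i\ge0}A_i$ and $A_i\prec A_j+A_i\succ A_j\subseteq A_{i+j}$ for all $i,j\ge0$; put $A_i:=\{0\}$ for $i<0$. The associated graded algebra is $\mathrm{gr}(A):=\bigoplus_{i\ge0}A_i/A_{i-1}$ with products $(a+A_{i-1})\prec(b+A_{j-1}):=a\prec b+A_{i+j-1}\in A_{i+j}/A_{i+j-1}$ for $a\in A_i$, $b\in A_j$, and similarly for $\succ$. $A$ is almost commutative if $\mathrm{gr}(A)$ is commutative, i.e. $a\prec b=b\succ a$ for all $a,b\in\mathrm{gr}(A)$. **Polarized categories.** A polarized algebra $(A,\cdot,[\,,])$ has $\cdot$ commutative and $[\,,]$ anticommutative. $\mathcal C_{\mathrm{pol}}$ is the category of polarized algebras $(A,\cdot,[\,,])$ such that $(A,\mu)\in\mathcal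 C$ for $\mu(a,b):=a\cdot b+[a,b]$; its relations are those obtained from $\mathcal R_1,\dots,\mathcal R_k$ by replacing every product $ab$ by $a\cdot b+[a,b]$ (considered modulo commutativity of $\cdot$ and anticommutativity of $[\,,]$). For a category $\mathcal D$ of polarized algebras defined by relations, the corresponding category of polarized dendriform algebras consists of all algebras $(A,*,\circ)$ with two products such that $(A\times A,\odot,[\![\,,]\!])\in\mathcal D$, where $$(a,x)\odot(b,y):=(a*b+b*a,\ a*y+b*x),\qquad [\![(a,x),(b,y)]\!]:=(a\circ b-b\circ a,\ a\circ y-b\circ x).$$ For $\mathcal D=\mathcal C_{\mathrm{pol}}$ it is denoted $\mathcal C^{\mathrm{dend}}_{\mathrm{pol}}$; for $\mathcal D=\underline{\mathcal C}_{\mathrm{pol}}$ (below) it is denoted $(\underline{\mathcal C}_{\mathrm{pol}})^{\mathrm{dend}}$. The relations of $\mathcal C^{\mathrm{dend}}_{\mathrm{pol}}$ are those obtained from each $n$-linear relation of $\mathcal C_{\mathrm{pol}}$, evaluated in $(A\times A,\odot,[\![\,,]\!])$, by substituting $(0,x_p)$ for the $p$-th variable and $(x_q,0)$ for the $q$-th variable for all $q\neq p$ ($p=1,\dots,n$) (the relation obtained by substituting $(x_q,0)$ for all variables follows from these). **Weight.** The weight of a monomial in $\cdot,[\,,]$ is the number of brackets $[\,,]$ in it; the weight of a monomial in $*,\circ$ is the number of operations $\circ$ in it. The lowest weight part of $\mathcal R$ is denoted $\underline{\mathcal R}$. $\underline{\mathcal C}_{\mathrm{pol}}$ (resp. $\underline{\mathcal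 C}^{\mathrm{dend}}_{\mathrm{pol}}$) is the category of all polarized algebras (resp. of all algebras $(A,*,\circ)$) satisfying $\underline{\mathcal R}=0$ for every $\mathcal R$ in the linear space of relations of $\mathcal C_{\mathrm{pol}}$ (resp. of $\mathcal C^{\mathrm{dend}}_{\mathrm{pol}}$), i.e. the $R$-module spanned by the relations just described, together with those obtained from them by permuting (renaming) the variables. Membership of $(\mathrm{gr}(A),\times,\bullet)$ in a category of algebras $(A,*,\circ)$ means with $*=\times$ and $\circ=\bullet$. *)

theory Defs
  imports "HOL.Hull" "HOL-Combinatorics.Permutations" "HOL-Algebra.AbelCoset" "HOL-Algebra.Module"
begin

section \<open>Nonassociative algebras\<close>

text \<open>An algebra is an \<open>R\<close>-module with a family of bilinear products indexed by a type of
  operation names. The fields \<open>mult\<close> and \<open>one\<close> that the record \<open>module\<close> inherits from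
  \<open>ring\<close> play no role in \<open>module R M\<close>, nor anywhere below.\<close>

record ('r, 'a, 'p) op_algebra = "('r, 'a) module" +
  prd :: "'p \<Rightarrow> 'a \<Rightarrow> 'a \<Rightarrow> 'a"

locale nonassoc_algebra = module R A
  for R :: "('r, 'm) ring_scheme" (structure) and A :: "('r, 'a, 'p) op_algebra" (structure) +
  assumes prd_closed:
      "\<lbrakk>a \<in> carrier A; b \<in> carrier A\<rbrakk> \<Longrightarrow> prd A p a b \<in> carrier A"
    and prd_add_left:
      "\<lbrakk>a \<in> carrier A; b \<in> carrier A; c \<in> carrier A\<rbrakk>
        \<Longrightarrow> prd A p (a \<oplus>\<^bsub>A\<^esub> b) c = prd A p a c \<oplus>\<^bsub>A\<^esub> prd A p b c"
    and prd_add_right: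
      "\<lbrakk>a \<in> carrier A; b \<in> carrier A; c \<in> carrier A\<rbrakk>
        \<Longrightarrow> prd A p a (b \<oplus>\<^bsub>A\<^esub> c) = prd A p a b \<oplus>\<^bsub>A\<^esub> prd A p a c"
    and prd_smult_left:
      "\<lbrakk>r \<in> carrier R; a \<in> carrier A; b \<in> carrier A\<rbrakk>
        \<Longrightarrow> prd A p (r \<odot>\<^bsub>A\<^esub> a) b = r \<odot>\<^bsub>A\<^esub> prd A p a b"
    and prd_smult_right:
      "\<lbrakk>r \<in> carrier R; a \<in> carrier A; b \<in> carrier A\<rbrakk>
        \<Longrightarrow> prd A p a (r \<odot>\<^bsub>A\<^esub> b) = r \<odot>\<^bsub>A\<^esub> prd A p a b"

datatype one_op = Mul
datatype dend_op = Prec | Succ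
datatype pol_op = Dot | Bracket
datatype pdend_op = Star | Circ

definition with_products ::
    "('r, 'a, 'z) module_scheme \<Rightarrow> ('p \<Rightarrow> 'a \<Rightarrow> 'a \<Rightarrow> 'a) \<Rightarrow> ('r, 'a, 'p) op_algebra" where
  "with_products M f =
     \<lparr>carrier = carrier M, mult = mult M, one = one M, zero = zero M, add = add M,
      smult = smult M, prd = f\<rparr>"

definition square_module :: "('r, 'a, 'z) module_scheme \<Rightarrow> ('r, 'a \<times> 'a) module" where
  "square_module M =
     \<lparr>carrier = carrier M \<times> carrier M, mult = undefined, one = undefined,
      zero = (\<zero>\<^bsub>M\<^esub>, \<zero>\<^bsub>M\<^esub>),
      add = (\<lambda>(a, x) (b, y). (a \<oplus>\<^bsub>M\<^esub> b, x \<oplus>\<^bsub>M\<^esub> y)),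
      smult = (\<lambda>r (a, x). (r \<odot>\<^bsub>M\<^esub> a, r \<odot>\<^bsub>M\<^esub> x))\<rparr>"


section \<open>Relations\<close>

datatype 'p monomial = Var nat | Op 'p "'p monomial" "'p monomial"

type_synonym ('r, 'p) relation = "'p monomial \<Rightarrow> 'r"

primrec leaves :: "'p monomial \<Rightarrow> nat list" where
  "leaves (Var i) = [i]"
| "leaves (Op p s t) = leaves s @ leaves t"

primrec op_count :: "'p \<Rightarrow> 'p monomial \<Rightarrow> nat" where
  "op_count q (Var i) = 0"
| "op_count q (Op p s t) = (if p = q then 1 else 0) + op_count q s + op_count q t"

text \<open>The relations are the elements of the free algebra on \<open>x\<^sub>0, x\<^sub>1, \<dots>\<close>, i.e. the finitely
  supported coefficient functions on monomials.\<close>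

definition free_algebra ::
    "('r, 'm) ring_scheme \<Rightarrow> ('r, ('r, 'p) relation, 'p) op_algebra" where
  "free_algebra R =
     \<lparr>carrier = {f. (\<forall>m. f m \<in> carrier R) \<and> finite {m. f m \<noteq> \<zero>\<^bsub>R\<^esub>}},
      mult = undefined, one = undefined,
      zero = (\<lambda>m. \<zero>\<^bsub>R\<^esub>),
      add = (\<lambda>f g m. f m \<oplus>\<^bsub>R\<^esub> g m),
      smult = (\<lambda>c f m. c \<otimes>\<^bsub>R\<^esub> f m),
      prd = (\<lambda>p f g m. case m of
               Var i \<Rightarrow> \<zero>\<^bsub>R\<^esub>
             | Op q s t \<Rightarrow> if q = p then f s \<otimes>\<^bsub>R\<^esub> g t else \<zero>\<^bsub>R\<^esub>)\<rparr>"

definition gen :: "('r, 'm) ring_scheme \<Rightarrow> nat \<Rightarrow> ('r, 'p) relation" where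
  "gen R i = (\<lambda>m. if m = Var i then \<one>\<^bsub>R\<^esub> else \<zero>\<^bsub>R\<^esub>)"

primrec eval_monomial :: "('r, 'a, 'p) op_algebra \<Rightarrow> (nat \<Rightarrow> 'a) \<Rightarrow> 'p monomial \<Rightarrow> 'a" where
  "eval_monomial A v (Var i) = v i"
| "eval_monomial A v (Op p s t) = prd A p (eval_monomial A v s) (eval_monomial A v t)"

definition eval_relation ::
    "('r, 'm) ring_scheme \<Rightarrow> ('r, 'a, 'p) op_algebra \<Rightarrow> (nat \<Rightarrow> 'a) \<Rightarrow> ('r, 'p) relation \<Rightarrow> 'a" where
  "eval_relation R A v r =
     (\<Oplus>\<^bsub>A\<^esub>m\<in>{m. r m \<noteq> \<zero>\<^bsub>R\<^esub>}. r m \<odot>\<^bsub>A\<^esub> eval_monomial A v m)"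

definition satisfies ::
    "('r, 'm) ring_scheme \<Rightarrow> ('r, 'a, 'p) op_algebra \<Rightarrow> ('r, 'p) relation \<Rightarrow> bool" where
  "satisfies R A r \<longleftrightarrow> (\<forall>v\<in>UNIV \<rightarrow> carrier A. eval_relation R A v r = \<zero>\<^bsub>A\<^esub>)"

definition multilinear :: "('r, 'm) ring_scheme \<Rightarrow> nat \<Rightarrow> ('r, 'p) relation \<Rightarrow> bool" where
  "multilinear R n r \<longleftrightarrow>
     (\<forall>m. r m \<noteq> \<zero>\<^bsub>R\<^esub> \<longrightarrow> distinct (leaves m) \<and> set (leaves m) = {1..n})"

text \<open>A category of algebras is represented by its class of objects.\<close>

definition algebra_category ::
    "('r, 'm) ring_scheme \<Rightarrow> ('r, 'p) relation set \<Rightarrow> ('r, 'a, 'p) op_algebra set" where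
  "algebra_category R S = {A. nonassoc_algebra R A \<and> (\<forall>r\<in>S. satisfies R A r)}"

definition rename_vars ::
    "('r, 'm) ring_scheme \<Rightarrow> (nat \<Rightarrow> nat) \<Rightarrow> ('r, 'p) relation \<Rightarrow> ('r, 'p) relation" where
  "rename_vars R \<pi> r = eval_relation R (free_algebra R) (\<lambda>i. gen R (\<pi> i)) r"

definition relation_space ::
    "('r, 'm) ring_scheme \<Rightarrow> ('r, 'p) relation set \<Rightarrow> ('r, 'p) relation set" where
  "relation_space R S =
     (\<lambda>N. submodule N R (free_algebra R)) hull
       {rename_vars R \<pi> r | \<pi> r n. r \<in> S \<and> multilinear R n r \<and> \<pi> permutes {1..n}}"


section \<open>Lowest weight parts\<close>

definition weight_part ::
    "('r, 'm) ring_scheme \<Rightarrow> 'p \<Rightarrow> nat \<Rightarrow> ('r, 'p) relation \<Rightarrow> ('r, 'p) relation" where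
  "weight_part R q w r = (\<lambda>m. if op_count q m = w then r m else \<zero>\<^bsub>R\<^esub>)"

text \<open>Lowest weight part of the class of \<open>r\<close> modulo a submodule \<open>I\<close> spanned by elements that
  are homogeneous for the weight \<open>op_count q\<close>: the weight is the least one in which \<open>r\<close> is
  nonzero modulo \<open>I\<close>, and the result is a representative of the class of that component. The
  lowest weight part of the zero class is zero.\<close>

definition lowest_part ::
    "('r, 'm) ring_scheme \<Rightarrow> 'p \<Rightarrow> ('r, 'p) relation set \<Rightarrow> ('r, 'p) relation \<Rightarrow> ('r, 'p) relation" where
  "lowest_part R q I r =
     (if \<exists>w. weight_part R q w r \<notin> I
      then weight_part R q (LEAST w. weight_part R q w r \<notin> I) r
      else \<zero>\<^bsub>free_algebra R\<^esub>)"


section \<open>Polarized algebras\<close>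

definition polarized_algebra ::
    "('r, 'm) ring_scheme \<Rightarrow> ('r, 'a, pol_op) op_algebra \<Rightarrow> bool" where
  "polarized_algebra R A \<longleftrightarrow> nonassoc_algebra R A \<and>
     (\<forall>a\<in>carrier A. \<forall>b\<in>carrier A.
        prd A Dot a b = prd A Dot b a \<and> prd A Bracket a b = \<ominus>\<^bsub>A\<^esub> prd A Bracket b a)"

definition depolarize :: "('r, 'a, pol_op) op_algebra \<Rightarrow> ('r, 'a, one_op) op_algebra" where
  "depolarize A = with_products A (\<lambda>Mul \<Rightarrow> \<lambda>a b. prd A Dot a b \<oplus>\<^bsub>A\<^esub> prd A Bracket a b)"

definition polarize ::
    "('r, 'm) ring_scheme \<Rightarrow> ('r, one_op) relation \<Rightarrow> ('r, pol_op) relation" where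
  "polarize R r = eval_relation R (depolarize (free_algebra R)) (gen R) r"

definition two_sided_ideal ::
    "('r, 'm) ring_scheme \<Rightarrow> ('r, 'a, 'p) op_algebra \<Rightarrow> 'a set \<Rightarrow> bool" where
  "two_sided_ideal R A I \<longleftrightarrow> submodule I R A \<and>
     (\<forall>p. \<forall>a\<in>carrier A. \<forall>x\<in>I. prd A p a x \<in> I \<and> prd A p x a \<in> I)"

text \<open>Polarized relations are considered modulo the ideal of consequences of commutativity of
  \<open>Dot\<close> and anticommutativity of \<open>Bracket\<close>.\<close>

definition symmetry_ideal :: "('r, 'm) ring_scheme \<Rightarrow> ('r, pol_op) relation set" where
  "symmetry_ideal R =
     (let F = free_algebra R in
      two_sided_ideal R F hull
        ({prd F Dot f g \<ominus>\<^bsub>F\<^esub> prd F Dot g f | f g. f \<in> carrier F \<and> g \<in> carrier F} \<union>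
         {prd F Bracket f g \<oplus>\<^bsub>F\<^esub> prd F Bracket g f | f g. f \<in> carrier F \<and> g \<in> carrier F}))"

definition pol_relations ::
    "('r, 'm) ring_scheme \<Rightarrow> ('r, one_op) relation set \<Rightarrow> ('r, pol_op) relation set" where
  "pol_relations R S = polarize R ` S"

definition lowest_pol_category ::
    "('r, 'm) ring_scheme \<Rightarrow> ('r, one_op) relation set \<Rightarrow> ('r, 'a, pol_op) op_algebra set" where
  "lowest_pol_category R S =
     {A. polarized_algebra R A \<and>
         (\<forall>r\<in>relation_space R (pol_relations R S).
            satisfies R A (lowest_part R Bracket (symmetry_ideal R) r))}"


section \<open>Dendriform and polarized dendriform algebras\<close>

definition dendriform_square :: "('r, 'a, dend_op) op_algebra \<Rightarrow> ('r, 'a \<times> 'a, one_op) op_algebra" where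
  "dendriform_square A = with_products (square_module A)
     (\<lambda>Mul \<Rightarrow> \<lambda>(a, x) (b, y).
        (prd A Prec a b \<oplus>\<^bsub>A\<^esub> prd A Succ a b, prd A Succ a y \<oplus>\<^bsub>A\<^esub> prd A Prec x b))"

definition dendriform ::
    "('r, 'm) ring_scheme \<Rightarrow> ('r, 'a \<times> 'a, one_op) op_algebra set \<Rightarrow> ('r, 'a, dend_op) op_algebra set" where
  "dendriform R C = {A. nonassoc_algebra R A \<and> dendriform_square A \<in> C}"

definition polarized_square :: "('r, 'a, pdend_op) op_algebra \<Rightarrow> ('r, 'a \<times> 'a, pol_op) op_algebra" where
  "polarized_square A = with_products (square_module A)
     (\<lambda>p (a, x) (b, y). case p of
        Dot \<Rightarrow>
          (prd A Star a b \<oplus>\<^bsub>A\<^esub> prd A Star b a, prd A Star a y \<oplus>\<^bsub>A\<^esub> prd A Star b x)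
      | Bracket \<Rightarrow>
          (prd A Circ a b \<ominus>\<^bsub>A\<^esub> prd A Circ b a, prd A Circ a y \<ominus>\<^bsub>A\<^esub> prd A Circ b x))"

definition polarized_dendriform ::
    "('r, 'm) ring_scheme \<Rightarrow> ('r, 'a \<times> 'a, pol_op) op_algebra set \<Rightarrow> ('r, 'a, pdend_op) op_algebra set" where
  "polarized_dendriform R D = {A. nonassoc_algebra R A \<and> polarized_square A \<in> D}"

text \<open>The evaluation below is of the form \<open>(0, r')\<close>, where \<open>r'\<close> is the relation obtained from
  \<open>r\<close> for the distinguished variable \<open>x\<^sub>p\<close>.\<close>

definition dend_relation ::
    "('r, 'm) ring_scheme \<Rightarrow> nat \<Rightarrow> ('r, pol_op) relation \<Rightarrow> ('r, pdend_op) relation" where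
  "dend_relation R p r =
     snd (eval_relation R (polarized_square (free_algebra R))
            (\<lambda>q. if q = p then (\<zero>\<^bsub>free_algebra R\<^esub>, gen R q) else (gen R q, \<zero>\<^bsub>free_algebra R\<^esub>)) r)"

definition pol_dend_relations ::
    "('r, 'm) ring_scheme \<Rightarrow> ('r, one_op) relation set \<Rightarrow> ('r, pdend_op) relation set" where
  "pol_dend_relations R S =
     {dend_relation R p r | p r n. r \<in> pol_relations R S \<and> multilinear R n r \<and> p \<in> {1..n}}"

text \<open>No symmetries are imposed on the two products here, so lowest weight parts are taken
  modulo the zero submodule.\<close>

definition lowest_pol_dend_category ::
    "('r, 'm) ring_scheme \<Rightarrow> ('r, one_op) relation set \<Rightarrow> ('r, 'a, pdend_op) op_algebra set" where
  "lowest_pol_dend_category R S =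
     {A. nonassoc_algebra R A \<and>
         (\<forall>r\<in>relation_space R (pol_dend_relations R S).
            satisfies R A (lowest_part R Circ {\<zero>\<^bsub>free_algebra R\<^esub>} r))}"


section \<open>Filtered algebras and their associated graded algebras\<close>

definition filt :: "('r, 'a, 'p) op_algebra \<Rightarrow> (nat \<Rightarrow> 'a set) \<Rightarrow> int \<Rightarrow> 'a set" where
  "filt A F k = (if k < 0 then {\<zero>\<^bsub>A\<^esub>} else F (nat k))"

locale filtered_algebra = nonassoc_algebra R A
  for R :: "('r, 'm) ring_scheme" (structure) and A :: "('r, 'a, 'p) op_algebra" (structure) +
  fixes F :: "nat \<Rightarrow> 'a set"
  assumes filt_submodule: "submodule (F i) R A"
    and filt_increasing: "F i \<subseteq> F (Suc i)"
    and filt_exhaustive: "carrier A = (\<Union>i. F i)"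
    and filt_prd: "\<lbrakk>a \<in> F i; b \<in> F j\<rbrakk> \<Longrightarrow> prd A p a b \<in> F (i + j)"

text \<open>The module \<open>F i / F (i - 1)\<close>, with cosets as elements.\<close>

definition gr_piece ::
    "('r, 'a, 'p) op_algebra \<Rightarrow> (nat \<Rightarrow> 'a set) \<Rightarrow> nat \<Rightarrow> ('r, 'a set) module" where
  "gr_piece A F i =
     (let N = filt A F (int i - 1) in
      \<lparr>carrier = (\<lambda>a. N +>\<^bsub>A\<^esub> a) ` F i, mult = undefined, one = undefined,
       zero = N,
       add = (<+>\<^bsub>A\<^esub>),
       smult = (\<lambda>r X. \<Union>x\<in>X. N +>\<^bsub>A\<^esub> (r \<odot>\<^bsub>A\<^esub> x))\<rparr>)"

definition direct_sum :: "(nat \<Rightarrow> ('r, 'b) module) \<Rightarrow> ('r, nat \<Rightarrow> 'b) module" where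
  "direct_sum Q =
     \<lparr>carrier = {f. (\<forall>i. f i \<in> carrier (Q i)) \<and> finite {i. f i \<noteq> \<zero>\<^bsub>Q i\<^esub>}},
      mult = undefined, one = undefined,
      zero = (\<lambda>i. \<zero>\<^bsub>Q i\<^esub>),
      add = (\<lambda>f g i. f i \<oplus>\<^bsub>Q i\<^esub> g i),
      smult = (\<lambda>r f i. r \<odot>\<^bsub>Q i\<^esub> f i)\<rparr>"

text \<open>Extends maps \<open>h i j\<close> from \<open>Q i \<times> Q j\<close> to \<open>Q (i + j - d)\<close> to the direct sum; degrees
  \<open>i + j - d < 0\<close> contribute nothing.\<close>

definition graded_product ::
    "(nat \<Rightarrow> ('r, 'b) module) \<Rightarrow> nat \<Rightarrow> (nat \<Rightarrow> nat \<Rightarrow> 'b \<Rightarrow> 'b \<Rightarrow> 'b)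
      \<Rightarrow> (nat \<Rightarrow> 'b) \<Rightarrow> (nat \<Rightarrow> 'b) \<Rightarrow> (nat \<Rightarrow> 'b)" where
  "graded_product Q d h f g =
     (\<lambda>k. \<Oplus>\<^bsub>Q k\<^esub>i\<in>{..k + d}. h i (k + d - i) (f i) (g (k + d - i)))"

text \<open>For cosets \<open>X\<close> and \<open>Y\<close>, a product determined by representatives is written as the
  union, over all \<open>a \<in> X\<close> and \<open>b \<in> Y\<close>, of the coset of the product of \<open>a\<close> and \<open>b\<close>; this is a
  single coset precisely when the product is well defined.\<close>

definition gr_algebra ::
    "('r, 'a, 'p) op_algebra \<Rightarrow> (nat \<Rightarrow> 'a set) \<Rightarrow> ('r, nat \<Rightarrow> 'a set, 'p) op_algebra" where
  "gr_algebra A F = with_products (direct_sum (gr_piece A F))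
     (\<lambda>p. graded_product (gr_piece A F) 0
        (\<lambda>i j X Y. \<Union>a\<in>X. \<Union>b\<in>Y. filt A F (int i + int j - 1) +>\<^bsub>A\<^esub> prd A p a b))"

definition almost_commutative :: "('r, 'a, dend_op) op_algebra \<Rightarrow> (nat \<Rightarrow> 'a set) \<Rightarrow> bool" where
  "almost_commutative A F \<longleftrightarrow>
     (\<forall>a\<in>carrier (gr_algebra A F). \<forall>b\<in>carrier (gr_algebra A F).
        prd (gr_algebra A F) Prec a b = prd (gr_algebra A F) Succ b a)"

definition gr_bullet ::
    "('r, 'a, dend_op) op_algebra \<Rightarrow> (nat \<Rightarrow> 'a set)
      \<Rightarrow> (nat \<Rightarrow> 'a set) \<Rightarrow> (nat \<Rightarrow> 'a set) \<Rightarrow> (nat \<Rightarrow> 'a set)" where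
  "gr_bullet A F = graded_product (gr_piece A F) 1
     (\<lambda>i j X Y. \<Union>a\<in>X. \<Union>b\<in>Y.
        filt A F (int i + int j - 2) +>\<^bsub>A\<^esub> (prd A Succ a b \<ominus>\<^bsub>A\<^esub> prd A Prec b a))"

definition gr_pol_dend ::
    "('r, 'a, dend_op) op_algebra \<Rightarrow> (nat \<Rightarrow> 'a set) \<Rightarrow> ('r, nat \<Rightarrow> 'a set, pdend_op) op_algebra" where
  "gr_pol_dend A F = with_products (gr_algebra A F)
     (\<lambda>Star \<Rightarrow> prd (gr_algebra A F) Succ | Circ \<Rightarrow> gr_bullet A F)"

end

theory Submission
  imports Defs
begin

text \<open>With \<open>h = 1/2\<close>, a \<open>\<C>\<close>-dendriform algebra \<open>A\<close> carries the products
  \<open>a * b = h (a \<succ> b + b \<prec> a)\<close> and \<open>a \<circ> b = h (a \<succ> b - b \<prec> a)\<close>, which satisfy the relations of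
  \<open>\<C>\<^sub>p\<^sub>o\<^sub>l\<^sup>d\<^sup>e\<^sup>n\<^sup>d\<close>. If \<open>A\<close> is almost commutative, then \<open>\<circ>\<close> lowers the filtration degree by one, so a monomial of
  weight \<open>w\<close> in homogeneous arguments lands in degree \<open>\<Sum>d\<^sub>i - w\<close>. In the top degree only the lowest
  weight part of a relation survives, and there the products of \<open>gr A\<close> are \<open>*\<close> and \<open>2 \<circ>\<close>; by
  multilinearity homogeneous arguments suffice.

  For the equality of the two categories, the passage from an \<open>n\<close>-linear polarized relation to its
  dendriform relation at the variable \<open>p\<close> preserves the weight, and it is injective modulo
  (anti)commutativity because \<open>2\<close> is invertible. Hence it commutes with taking lowest weight parts. The
  components of a dendriform relation for different \<open>n\<close> and \<open>p\<close> are told apart by the length and the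
  last variable of their monomials.\<close>

section \<open>Linear maps and free algebras\<close>

text \<open>Lowest weight parts are not linear: the space of relations contains sums of relations of
  different arities, and on the dendriform side also of different distinguished variables, whose
  lowest weights differ. Satisfying the lowest weight part is therefore rephrased as a condition on
  all weights: whenever every part of weight below \<open>w\<close> is trivial, the part of weight
  \<open>w\<close> holds. The premise passes to the components of a relation, and the conclusion can
  be reassembled from them. The two sides take lowest parts modulo different submodules, the
  symmetry ideal and zero. They match since the symmetry ideal evaluates to zero in the square
  algebra, which is polarized, while conversely an explicit map undoes the dendriform substitution
  modulo symmetry: every product of first components has two terms that become congruent, which
  costs a factor 1/2. The bullet product of \<open>gr A\<close> is defined without the factor 1/2 of
  \<open>\<circ>\<close>. The discrepancy is a factor 2 for each bracket, so it only scales a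
  relation that is homogeneous for the weight.\<close>

definition linear_map ::
    "('r, 'm) ring_scheme \<Rightarrow> ('r, 'a, 'y) module_scheme \<Rightarrow> ('r, 'b, 'z) module_scheme
      \<Rightarrow> ('a \<Rightarrow> 'b) \<Rightarrow> bool" where
  "linear_map R M N \<phi> \<longleftrightarrow> \<phi> \<in> carrier M \<rightarrow> carrier N \<and>
     (\<forall>x\<in>carrier M. \<forall>y\<in>carrier M. \<phi> (x \<oplus>\<^bsub>M\<^esub> y) = \<phi> x \<oplus>\<^bsub>N\<^esub> \<phi> y) \<and>
     (\<forall>c\<in>carrier R. \<forall>x\<in>carrier M. \<phi> (c \<odot>\<^bsub>M\<^esub> x) = c \<odot>\<^bsub>N\<^esub> \<phi> x)"

lemma linear_mapI:
  assumes "\<And>x. x \<in> carrier M \<Longrightarrow> \<phi> x \<in> carrier N"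
    and "\<And>x y. \<lbrakk>x \<in> carrier M; y \<in> carrier M\<rbrakk> \<Longrightarrow> \<phi> (x \<oplus>\<^bsub>M\<^esub> y) = \<phi> x \<oplus>\<^bsub>N\<^esub> \<phi> y"
    and "\<And>c x. \<lbrakk>c \<in> carrier R; x \<in> carrier M\<rbrakk> \<Longrightarrow> \<phi> (c \<odot>\<^bsub>M\<^esub> x) = c \<odot>\<^bsub>N\<^esub> \<phi> x"
  shows "linear_map R M N \<phi>"
  using assms unfolding linear_map_def by blast

lemma
  assumes "linear_map R M N \<phi>"
  shows linear_map_closed: "x \<in> carrier M \<Longrightarrow> \<phi> x \<in> carrier N"
    and linear_map_add:
      "\<lbrakk>x \<in> carrier M; y \<in> carrier M\<rbrakk> \<Longrightarrow> \<phi> (x \<oplus>\<^bsub>M\<^esub> y) = \<phi> x \<oplus>\<^bsub>N\<^esub> \<phi> y"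
    and linear_map_smult:
      "\<lbrakk>c \<in> carrier R; x \<in> carrier M\<rbrakk> \<Longrightarrow> \<phi> (c \<odot>\<^bsub>M\<^esub> x) = c \<odot>\<^bsub>N\<^esub> \<phi> x"
  using assms unfolding linear_map_def by blast+

lemma linear_map_zero:
  assumes "module R M" "module R N" "linear_map R M N \<phi>"
  shows "\<phi> \<zero>\<^bsub>M\<^esub> = \<zero>\<^bsub>N\<^esub>"
proof -
  interpret M: module R M by fact
  interpret N: module R N by fact
  have "\<phi> (\<zero>\<^bsub>R\<^esub> \<odot>\<^bsub>M\<^esub> \<zero>\<^bsub>M\<^esub>) = \<zero>\<^bsub>R\<^esub> \<odot>\<^bsub>N\<^esub> \<phi> \<zero>\<^bsub>M\<^esub>"
    by (rule linear_map_smult[OF assms(3)]) simp_all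
  then show ?thesis
    using linear_map_closed[OF assms(3), of "\<zero>\<^bsub>M\<^esub>"] by simp
qed

lemma linear_map_neg:
  assumes "module R M" "module R N" "linear_map R M N \<phi>" "x \<in> carrier M"
  shows "\<phi> (\<ominus>\<^bsub>M\<^esub> x) = \<ominus>\<^bsub>N\<^esub> \<phi> x"
proof -
  interpret M: module R M by fact
  interpret N: module R N by fact
  have "\<phi> (\<ominus>\<^bsub>M\<^esub> x) \<oplus>\<^bsub>N\<^esub> \<phi> x = \<phi> (\<ominus>\<^bsub>M\<^esub> x \<oplus>\<^bsub>M\<^esub> x)"
    using assms(4) by (simp add: linear_map_add[OF assms(3)])
  also have "\<dots> = \<zero>\<^bsub>N\<^esub>"
    using assms(4) by (simp add: M.M.l_neg linear_map_zero[OF assms(1-3)])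
  finally show ?thesis
    using assms(4) by (simp add: N.M.minus_equality linear_map_closed[OF assms(3)])
qed

lemma linear_map_minus:
  assumes "module R M" "module R N" "linear_map R M N \<phi>" "x \<in> carrier M" "y \<in> carrier M"
  shows "\<phi> (x \<ominus>\<^bsub>M\<^esub> y) = \<phi> x \<ominus>\<^bsub>N\<^esub> \<phi> y"
proof -
  interpret M: module R M by fact
  show ?thesis
    using assms(4,5)
    by (simp add: a_minus_def linear_map_add[OF assms(3)] linear_map_neg[OF assms(1-3)])
qed

lemma linear_map_comp:
  assumes "linear_map R L M \<psi>" "linear_map R M N \<phi>"
  shows "linear_map R L N (\<lambda>x. \<phi> (\<psi> x))"
  using assms unfolding linear_map_def by (auto simp: Pi_iff)

lemma linear_map_finsum:
  assumes "module R N" "finite I" and lin: "\<And>i. i \<in> I \<Longrightarrow> linear_map R M N (\<phi> i)"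
  shows "linear_map R M N (\<lambda>x. \<Oplus>\<^bsub>N\<^esub>i\<in>I. \<phi> i x)"
proof -
  interpret N: module R N by fact
  note closed = linear_map_closed[OF lin]
  show ?thesis
  proof (rule linear_mapI)
    fix x y assume xy: "x \<in> carrier M" "y \<in> carrier M"
    have "(\<Oplus>\<^bsub>N\<^esub>i\<in>I. \<phi> i (x \<oplus>\<^bsub>M\<^esub> y)) = (\<Oplus>\<^bsub>N\<^esub>i\<in>I. \<phi> i x \<oplus>\<^bsub>N\<^esub> \<phi> i y)"
      using xy closed by (intro N.M.finsum_cong') (auto simp: linear_map_add[OF lin])
    also have "\<dots> = (\<Oplus>\<^bsub>N\<^esub>i\<in>I. \<phi> i x) \<oplus>\<^bsub>N\<^esub> (\<Oplus>\<^bsub>N\<^esub>i\<in>I. \<phi> i y)"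
      using xy closed by (intro N.M.finsum_addf) auto
    finally show "(\<Oplus>\<^bsub>N\<^esub>i\<in>I. \<phi> i (x \<oplus>\<^bsub>M\<^esub> y)) = (\<Oplus>\<^bsub>N\<^esub>i\<in>I. \<phi> i x) \<oplus>\<^bsub>N\<^esub> (\<Oplus>\<^bsub>N\<^esub>i\<in>I. \<phi> i y)" .
  next
    fix c x assume cx: "c \<in> carrier R" "x \<in> carrier M"
    have "(\<Oplus>\<^bsub>N\<^esub>i\<in>I. \<phi> i (c \<odot>\<^bsub>M\<^esub> x)) = (\<Oplus>\<^bsub>N\<^esub>i\<in>I. c \<odot>\<^bsub>N\<^esub> \<phi> i x)"
      using cx closed by (intro N.M.finsum_cong') (auto simp: linear_map_smult[OF lin])
    also have "\<dots> = c \<odot>\<^bsub>N\<^esub> (\<Oplus>\<^bsub>N\<^esub>i\<in>I. \<phi> i x)"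
      using cx closed assms(2) by (intro N.finsum_smult_ldistr[symmetric]) auto
    finally show "(\<Oplus>\<^bsub>N\<^esub>i\<in>I. \<phi> i (c \<odot>\<^bsub>M\<^esub> x)) = c \<odot>\<^bsub>N\<^esub> (\<Oplus>\<^bsub>N\<^esub>i\<in>I. \<phi> i x)" .
  qed (use closed in auto)
qed

section \<open>Bilinearity as linearity in each argument\<close>

lemma (in nonassoc_algebra) linear_map_prd_left:
  "b \<in> carrier A \<Longrightarrow> linear_map R A A (\<lambda>a. prd A p a b)"
  by (intro linear_mapI) (simp_all add: prd_closed prd_add_left prd_smult_left)

lemma (in nonassoc_algebra) linear_map_prd_right:
  "a \<in> carrier A \<Longrightarrow> linear_map R A A (\<lambda>b. prd A p a b)"
  by (intro linear_mapI) (simp_all add: prd_closed prd_add_right prd_smult_right)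

lemma nonassoc_algebraI:
  assumes "module R A"
    and "\<And>p b. b \<in> carrier A \<Longrightarrow> linear_map R A A (\<lambda>a. prd A p a b)"
    and "\<And>p a. a \<in> carrier A \<Longrightarrow> linear_map R A A (prd A p a)"
  shows "nonassoc_algebra R A"
  using assms by (simp add: nonassoc_algebra_def nonassoc_algebra_axioms_def linear_map_def Pi_iff)

lemma (in nonassoc_algebra) prd_zero_left: "b \<in> carrier A \<Longrightarrow> prd A p \<zero>\<^bsub>A\<^esub> b = \<zero>\<^bsub>A\<^esub>"
  using linear_map_zero[OF module_axioms module_axioms linear_map_prd_left] .

lemma (in nonassoc_algebra) prd_zero_right: "a \<in> carrier A \<Longrightarrow> prd A p a \<zero>\<^bsub>A\<^esub> = \<zero>\<^bsub>A\<^esub>"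
  using linear_map_zero[OF module_axioms module_axioms linear_map_prd_right] .

lemma (in nonassoc_algebra) prd_minus_left:
  "\<lbrakk>a \<in> carrier A; c \<in> carrier A; b \<in> carrier A\<rbrakk>
    \<Longrightarrow> prd A p (a \<ominus>\<^bsub>A\<^esub> c) b = prd A p a b \<ominus>\<^bsub>A\<^esub> prd A p c b"
  using linear_map_minus[OF module_axioms module_axioms linear_map_prd_left] .

lemma (in nonassoc_algebra) prd_minus_right:
  "\<lbrakk>a \<in> carrier A; c \<in> carrier A; b \<in> carrier A\<rbrakk>
    \<Longrightarrow> prd A p b (a \<ominus>\<^bsub>A\<^esub> c) = prd A p b a \<ominus>\<^bsub>A\<^esub> prd A p b c"
  using linear_map_minus[OF module_axioms module_axioms linear_map_prd_right] .

section \<open>The free algebra and its basis of monomials\<close>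

lemma free_algebra_simps [simp]:
  "carrier (free_algebra R) =
    {f. (\<forall>m. f m \<in> carrier R) \<and> finite {m. f m \<noteq> \<zero>\<^bsub>R\<^esub>}}"
  "\<zero>\<^bsub>free_algebra R\<^esub> = (\<lambda>m. \<zero>\<^bsub>R\<^esub>)"
  "f \<oplus>\<^bsub>free_algebra R\<^esub> g = (\<lambda>m. f m \<oplus>\<^bsub>R\<^esub> g m)"
  "c \<odot>\<^bsub>free_algebra R\<^esub> f = (\<lambda>m. c \<otimes>\<^bsub>R\<^esub> f m)"
  "prd (free_algebra R) p f g = (\<lambda>m. case m of Var i \<Rightarrow> \<zero>\<^bsub>R\<^esub>
     | Op q s t \<Rightarrow> if q = p then f s \<otimes>\<^bsub>R\<^esub> g t else \<zero>\<^bsub>R\<^esub>)"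
  by (simp_all add: free_algebra_def)

lemma free_algebra_module:
  assumes "cring R"
  shows "module R (free_algebra R :: ('r, ('r, 'p) relation, 'p) op_algebra)"
proof -
  interpret R: cring R by fact
  show ?thesis
  proof (intro moduleI abelian_groupI)
    fix f g :: "('r, 'p) relation"
    assume f: "f \<in> carrier (free_algebra R)" and g: "g \<in> carrier (free_algebra R)"
    have "finite {m. f m \<oplus>\<^bsub>R\<^esub> g m \<noteq> \<zero>\<^bsub>R\<^esub>}"
      by (rule finite_subset[of _ "{m. f m \<noteq> \<zero>\<^bsub>R\<^esub>} \<union> {m. g m \<noteq> \<zero>\<^bsub>R\<^esub>}"]) (use f g in auto)
    then show "f \<oplus>\<^bsub>free_algebra R\<^esub> g \<in> carrier (free_algebra R)"
      using f g by simp
  next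
    fix f :: "('r, 'p) relation"
    assume f: "f \<in> carrier (free_algebra R)"
    have "{m. \<ominus>\<^bsub>R\<^esub> f m \<noteq> \<zero>\<^bsub>R\<^esub>} \<subseteq> {m. f m \<noteq> \<zero>\<^bsub>R\<^esub>}"
      by auto
    then have "finite {m. \<ominus>\<^bsub>R\<^esub> f m \<noteq> \<zero>\<^bsub>R\<^esub>}"
      using f finite_subset by fastforce
    then show "\<exists>g\<in>carrier (free_algebra R). g \<oplus>\<^bsub>free_algebra R\<^esub> f = \<zero>\<^bsub>free_algebra R\<^esub>"
      using f by (intro bexI[of _ "\<lambda>m. \<ominus>\<^bsub>R\<^esub> f m"]) (auto simp: R.l_neg)
  next
    fix c and f :: "('r, 'p) relation"
    assume c: "c \<in> carrier R" and f: "f \<in> carrier (free_algebra R)"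
    have "{m. c \<otimes>\<^bsub>R\<^esub> f m \<noteq> \<zero>\<^bsub>R\<^esub>} \<subseteq> {m. f m \<noteq> \<zero>\<^bsub>R\<^esub>}"
      using c by auto
    then have "finite {m. c \<otimes>\<^bsub>R\<^esub> f m \<noteq> \<zero>\<^bsub>R\<^esub>}"
      using f finite_subset by fastforce
    then show "c \<odot>\<^bsub>free_algebra R\<^esub> f \<in> carrier (free_algebra R)"
      using c f by simp
  qed (auto simp: assms R.a_ac R.m_assoc R.l_distr R.r_distr)
qed

lemma free_algebra_nonassoc:
  assumes "cring R"
  shows "nonassoc_algebra R (free_algebra R :: ('r, ('r, 'p) relation, 'p) op_algebra)"
proof -
  interpret R: cring R by fact
  interpret module R "free_algebra R :: ('r, ('r, 'p) relation, 'p) op_algebra"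
    by (rule free_algebra_module) fact
  show ?thesis
  proof
    fix f g :: "('r, 'p) relation" and p
    assume f: "f \<in> carrier (free_algebra R)" and g: "g \<in> carrier (free_algebra R)"
    have "finite {m. prd (free_algebra R) p f g m \<noteq> \<zero>\<^bsub>R\<^esub>}"
    proof (rule finite_subset)
      show "{m. prd (free_algebra R) p f g m \<noteq> \<zero>\<^bsub>R\<^esub>}
          \<subseteq> (\<lambda>(s, t). Op p s t) ` ({m. f m \<noteq> \<zero>\<^bsub>R\<^esub>} \<times> {m. g m \<noteq> \<zero>\<^bsub>R\<^esub>})"
      proof
        fix m assume "m \<in> {m. prd (free_algebra R) p f g m \<noteq> \<zero>\<^bsub>R\<^esub>}"
        then show "m \<in> (\<lambda>(s, t). Op p s t) ` ({m. f m \<noteq> \<zero>\<^bsub>R\<^esub>} \<times> {m. g m \<noteq> \<zero>\<^bsub>R\<^esub>})"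
          using f g by (cases m) (auto split: if_splits)
      qed
      show "finite ((\<lambda>(s, t). Op p s t) ` ({m. f m \<noteq> \<zero>\<^bsub>R\<^esub>} \<times> {m. g m \<noteq> \<zero>\<^bsub>R\<^esub>}))"
        using f g by simp
    qed
    then show "prd (free_algebra R) p f g \<in> carrier (free_algebra R)"
      using f g by (auto split: monomial.splits)
  qed (auto simp: fun_eq_iff R.l_distr R.r_distr R.m_assoc R.m_lcomm split: monomial.splits)
qed

definition monom :: "('r, 'm) ring_scheme \<Rightarrow> 'p monomial \<Rightarrow> ('r, 'p) relation" where
  "monom R m = (\<lambda>m'. if m' = m then \<one>\<^bsub>R\<^esub> else \<zero>\<^bsub>R\<^esub>)"

lemma gen_eq_mono: "gen R i = monom R (Var i)"
  by (simp add: gen_def monom_def)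

lemma mono_closed [intro]:
  assumes "cring R"
  shows "monom R m \<in> carrier (free_algebra R)"
proof -
  interpret R: cring R by fact
  show ?thesis
    by (auto simp: monom_def intro: finite_subset[of _ "{m}"])
qed

lemma prd_mono:
  assumes "cring R"
  shows "prd (free_algebra R) p (monom R s) (monom R t) = monom R (Op p s t)"
proof -
  interpret R: cring R by fact
  show ?thesis
    by (auto simp: monom_def fun_eq_iff split: monomial.splits)
qed

text \<open>A finitely supported function is reached from zero by adding one scalar multiple of a
  monomial at a time. This gives induction along the module structure, the form in which linear maps
  can be compared.\<close>

lemma free_algebra_induct [consumes 2, case_names zero mono add smult]:
  assumes "cring R" and "f \<in> carrier (free_algebra R)"
    and zero: "P \<zero>\<^bsub>free_algebra R\<^esub>"
    and mono: "\<And>m. P (monom R m)"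
    and add: "\<And>f g. \<lbrakk>f \<in> carrier (free_algebra R); g \<in> carrier (free_algebra R); P f; P g\<rbrakk>
        \<Longrightarrow> P (f \<oplus>\<^bsub>free_algebra R\<^esub> g)"
    and smult: "\<And>c f. \<lbrakk>c \<in> carrier R; f \<in> carrier (free_algebra R); P f\<rbrakk>
        \<Longrightarrow> P (c \<odot>\<^bsub>free_algebra R\<^esub> f)"
  shows "P (f :: ('r, 'p) relation)"
proof -
  interpret R: cring R by fact
  interpret F: module R "free_algebra R :: ('r, ('r, 'p) relation, 'p) op_algebra"
    by (rule free_algebra_module) fact
  \<comment> \<open>Any finite \<open>K\<close> containing the support is allowed, so that erasing
    the coefficient at \<open>k\<close> stays inside the induction even if it was zero
    already.\<close>
  have "P f" if "finite K" "f \<in> carrier (free_algebra R)" "{m. f m \<noteq> \<zero>\<^bsub>R\<^esub>} \<subseteq> K" for K and f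
    using that
  proof (induction K arbitrary: f rule: finite_induct)
    case empty
    then have "f = \<zero>\<^bsub>free_algebra R\<^esub>" by auto
    then show ?case using zero by simp
  next
    case (insert k K)
    let ?g = "\<lambda>m. if m = k then \<zero>\<^bsub>R\<^esub> else f m"
    have sub: "{m. ?g m \<noteq> \<zero>\<^bsub>R\<^esub>} \<subseteq> {m. f m \<noteq> \<zero>\<^bsub>R\<^esub>}" by auto
    have g: "?g \<in> carrier (free_algebra R)"
      using insert.prems(1) finite_subset[OF sub] by auto
    have fk: "f k \<in> carrier R" using insert.prems(1) by auto
    have "P ?g"
      using insert.prems by (intro insert.IH g) auto
    moreover have "P (f k \<odot>\<^bsub>free_algebra R\<^esub> monom R k)"
      using fk by (intro smult mono mono_closed \<open>cring R\<close>)
    moreover have "f k \<odot>\<^bsub>free_algebra R\<^esub> monom R k \<in> carrier (free_algebra R)"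
      using fk mono_closed[OF \<open>cring R\<close>] by (rule F.smult_closed)
    ultimately have "P (?g \<oplus>\<^bsub>free_algebra R\<^esub> (f k \<odot>\<^bsub>free_algebra R\<^esub> monom R k))"
      using g by (intro add)
    also have "?g \<oplus>\<^bsub>free_algebra R\<^esub> (f k \<odot>\<^bsub>free_algebra R\<^esub> monom R k) = f"
      using insert.prems(1) by (auto simp: fun_eq_iff monom_def)
    finally show ?case .
  qed
  from this[of "{m. f m \<noteq> \<zero>\<^bsub>R\<^esub>}" f] show ?thesis
    using assms(2) by simp
qed

text \<open>Monomials span the free algebra. Identities between maps on relations are reduced by
  this to a computation on a single monomial throughout the proof.\<close>

lemma linear_map_eqI:
  assumes "cring R" "module R M"
    and "linear_map R (free_algebra R) M \<phi>" "linear_map R (free_algebra R) M \<psi>"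
    and "\<And>m. \<phi> (monom R m) = \<psi> (monom R m)"
    and "f \<in> carrier (free_algebra R)"
  shows "\<phi> f = \<psi> (f :: ('r, 'p) relation)"
  using assms(1,6)
proof (induction rule: free_algebra_induct)
  case zero
  then show ?case
    using linear_map_zero[OF free_algebra_module[OF assms(1)] assms(2)] assms(3,4) by metis
next
  case (add f g)
  then show ?case
    using linear_map_add[OF assms(3)] linear_map_add[OF assms(4)] by metis
next
  case (smult c f)
  then show ?case
    using linear_map_smult[OF assms(3)] linear_map_smult[OF assms(4)] by metis
qed (use assms(5) in auto)

section \<open>Linear extension of a map on monomials\<close>

definition lin_ext ::
    "('r, 'm) ring_scheme \<Rightarrow> ('r, 'a, 'z) module_scheme \<Rightarrow> ('p monomial \<Rightarrow> 'a)
      \<Rightarrow> ('r, 'p) relation \<Rightarrow> 'a" where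
  "lin_ext R M h f = (\<Oplus>\<^bsub>M\<^esub>m\<in>{m. f m \<noteq> \<zero>\<^bsub>R\<^esub>}. f m \<odot>\<^bsub>M\<^esub> h m)"

text \<open>The support of a sum can be smaller than the union of the supports, by cancellation.
  Additivity of \<open>lin_ext\<close> is therefore checked over a common finite index set, on which
  the extra terms are zero.\<close>

lemma lin_ext_superset:
  assumes "module R M" "\<And>m. h m \<in> carrier M"
    and "\<And>m. f m \<in> carrier R" "finite K" "{m. f m \<noteq> \<zero>\<^bsub>R\<^esub>} \<subseteq> K"
  shows "lin_ext R M h f = (\<Oplus>\<^bsub>M\<^esub>m\<in>K. f m \<odot>\<^bsub>M\<^esub> h m)"
proof -
  interpret M: module R M by fact
  show ?thesis
    unfolding lin_ext_def
    using assms(2-) by (intro M.M.add.finprod_mono_neutral_cong_left) auto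
qed

lemma linear_map_lin_ext:
  fixes R :: "('r, 'm) ring_scheme" and h :: "'p monomial \<Rightarrow> 'a"
  assumes "module R M" and h: "\<And>m. h m \<in> carrier M"
  shows "linear_map R (free_algebra R) M (lin_ext R M h)"
proof -
  interpret M: module R M by fact
  note sup = lin_ext_superset[OF assms]
  show ?thesis
  proof (intro linear_mapI)
    fix f :: "('r, 'p) relation" assume "f \<in> carrier (free_algebra R)"
    then show "lin_ext R M h f \<in> carrier M"
      using h by (auto simp: lin_ext_def intro!: M.M.finsum_closed)
  next
    fix f g :: "('r, 'p) relation"
    assume f: "f \<in> carrier (free_algebra R)" and g: "g \<in> carrier (free_algebra R)"
    let ?K = "{m. f m \<noteq> \<zero>\<^bsub>R\<^esub>} \<union> {m. g m \<noteq> \<zero>\<^bsub>R\<^esub>}"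
    have K: "finite ?K" using f g by simp
    have "lin_ext R M h (f \<oplus>\<^bsub>free_algebra R\<^esub> g) = (\<Oplus>\<^bsub>M\<^esub>m\<in>?K. (f m \<oplus>\<^bsub>R\<^esub> g m) \<odot>\<^bsub>M\<^esub> h m)"
      using f g by (subst sup[of _ ?K]) auto
    also have "\<dots> = (\<Oplus>\<^bsub>M\<^esub>m\<in>?K. f m \<odot>\<^bsub>M\<^esub> h m \<oplus>\<^bsub>M\<^esub> g m \<odot>\<^bsub>M\<^esub> h m)"
      using f g h by (intro M.M.finsum_cong') (auto simp: M.smult_l_distr)
    also have "\<dots> = (\<Oplus>\<^bsub>M\<^esub>m\<in>?K. f m \<odot>\<^bsub>M\<^esub> h m) \<oplus>\<^bsub>M\<^esub> (\<Oplus>\<^bsub>M\<^esub>m\<in>?K. g m \<odot>\<^bsub>M\<^esub> h m)"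
      using f g h by (intro M.M.finsum_addf) auto
    also have "\<dots> = lin_ext R M h f \<oplus>\<^bsub>M\<^esub> lin_ext R M h g"
      using f g K by (subst (1 2) sup[of _ ?K]) auto
    finally show "lin_ext R M h (f \<oplus>\<^bsub>free_algebra R\<^esub> g) = lin_ext R M h f \<oplus>\<^bsub>M\<^esub> lin_ext R M h g" .
  next
    fix c and f :: "('r, 'p) relation"
    assume c: "c \<in> carrier R" and f: "f \<in> carrier (free_algebra R)"
    let ?K = "{m. f m \<noteq> \<zero>\<^bsub>R\<^esub>}"
    have K: "finite ?K" using f by simp
    have "lin_ext R M h (c \<odot>\<^bsub>free_algebra R\<^esub> f) = (\<Oplus>\<^bsub>M\<^esub>m\<in>?K. (c \<otimes>\<^bsub>R\<^esub> f m) \<odot>\<^bsub>M\<^esub> h m)"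
      using c f K by (subst sup[of _ ?K]) auto
    also have "\<dots> = (\<Oplus>\<^bsub>M\<^esub>m\<in>?K. c \<odot>\<^bsub>M\<^esub> (f m \<odot>\<^bsub>M\<^esub> h m))"
      using c f h by (intro M.M.finsum_cong') (auto simp: M.smult_assoc1)
    also have "\<dots> = c \<odot>\<^bsub>M\<^esub> (\<Oplus>\<^bsub>M\<^esub>m\<in>?K. f m \<odot>\<^bsub>M\<^esub> h m)"
      using c f h K by (intro M.finsum_smult_ldistr[symmetric]) auto
    also have "\<dots> = c \<odot>\<^bsub>M\<^esub> lin_ext R M h f"
      by (simp add: lin_ext_def)
    finally show "lin_ext R M h (c \<odot>\<^bsub>free_algebra R\<^esub> f) = c \<odot>\<^bsub>M\<^esub> lin_ext R M h f" .
  qed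
qed

lemma lin_ext_mono:
  assumes "module R M" and h: "\<And>m. h m \<in> carrier M"
  shows "lin_ext R M h (monom R m) = h m"
proof -
  interpret M: module R M by fact
  have "lin_ext R M h (monom R m) = (\<Oplus>\<^bsub>M\<^esub>m'\<in>{m}. monom R m m' \<odot>\<^bsub>M\<^esub> h m')"
    by (rule lin_ext_superset[OF assms]) (auto simp: monom_def)
  also have "\<dots> = h m"
    using h by (simp add: monom_def)
  finally show ?thesis .
qed

text \<open>Expanding first \<open>f\<close> and then \<open>g\<close> into monomials proves the
  identity. The three maps may differ, and so may the types of operation names, because besides
  multiplicative maps this has to cover a mixed rule: further below, \<open>\<tau>\<close> of a
  product is \<open>\<sigma>\<close> of the left factor times \<open>\<tau>\<close> of the right
  one.\<close>

lemma bilinear_free_eqI: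
  assumes "cring R" "nonassoc_algebra R A"
    and "linear_map R (free_algebra R) A \<phi>"
      "linear_map R (free_algebra R) A \<alpha>" "linear_map R (free_algebra R) A \<beta>"
    and mono: "\<And>s t. \<phi> (monom R (Op p s t)) = prd A q (\<alpha> (monom R s)) (\<beta> (monom R t))"
    and "f \<in> carrier (free_algebra R)" "g \<in> carrier (free_algebra R)"
  shows "\<phi> (prd (free_algebra R) p f g) = prd A q (\<alpha> f) (\<beta> g)"
proof -
  interpret A: nonassoc_algebra R A by fact
  note FA = free_algebra_nonassoc[OF assms(1)]
  have *: "\<phi> (prd (free_algebra R) p f (monom R t)) = prd A q (\<alpha> f) (\<beta> (monom R t))" for t
  proof (rule linear_map_eqI[OF assms(1) A.module_axioms _ _ _ assms(7)])
    show "linear_map R (free_algebra R) A (\<lambda>f. \<phi> (prd (free_algebra R) p f (monom R t)))"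
      by (rule linear_map_comp[OF nonassoc_algebra.linear_map_prd_left[OF FA] assms(3)])
        (rule mono_closed[OF assms(1)])
    show "linear_map R (free_algebra R) A (\<lambda>f. prd A q (\<alpha> f) (\<beta> (monom R t)))"
      by (rule linear_map_comp[OF assms(4) A.linear_map_prd_left])
        (rule linear_map_closed[OF assms(5) mono_closed[OF assms(1)]])
  qed (simp only: prd_mono[OF assms(1)] mono)
  show ?thesis
  proof (rule linear_map_eqI[OF assms(1) A.module_axioms _ _ _ assms(8)])
    show "linear_map R (free_algebra R) A (\<lambda>g. \<phi> (prd (free_algebra R) p f g))"
      by (rule linear_map_comp[OF nonassoc_algebra.linear_map_prd_right[OF FA assms(7)] assms(3)])
    show "linear_map R (free_algebra R) A (\<lambda>g. prd A q (\<alpha> f) (\<beta> g))"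
      by (rule linear_map_comp[OF assms(5) A.linear_map_prd_right])
        (rule linear_map_closed[OF assms(4,7)])
  qed (rule *)
qed


section \<open>Evaluation of relations\<close>

lemma eval_relation_eq_lin_ext: "eval_relation R A v = lin_ext R A (eval_monomial A v)"
  by (simp add: fun_eq_iff eval_relation_def lin_ext_def)

lemma (in nonassoc_algebra) eval_monomial_closed:
  "(\<And>i. v i \<in> carrier A) \<Longrightarrow> eval_monomial A v m \<in> carrier A"
  by (induction m) (auto simp: prd_closed)

lemma (in nonassoc_algebra) linear_map_eval:
  "(\<And>i. v i \<in> carrier A) \<Longrightarrow> linear_map R (free_algebra R) A (eval_relation R A v)"
  by (simp only: eval_relation_eq_lin_ext)
    (rule linear_map_lin_ext[OF module_axioms eval_monomial_closed])

lemma (in nonassoc_algebra) eval_relation_mono: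
  "(\<And>i. v i \<in> carrier A) \<Longrightarrow> eval_relation R A v (monom R m) = eval_monomial A v m"
  by (simp only: eval_relation_eq_lin_ext)
    (rule lin_ext_mono[OF module_axioms eval_monomial_closed])

lemma (in nonassoc_algebra) eval_relation_gen:
  "(\<And>i. v i \<in> carrier A) \<Longrightarrow> eval_relation R A v (gen R i) = v i"
  by (simp add: gen_eq_mono eval_relation_mono)

definition algebra_hom ::
    "('r, 'm) ring_scheme \<Rightarrow> ('r, 'a, 'p) op_algebra \<Rightarrow> ('r, 'b, 'p) op_algebra \<Rightarrow> ('a \<Rightarrow> 'b) \<Rightarrow> bool"
  where "algebra_hom R A B \<phi> \<longleftrightarrow> linear_map R A B \<phi> \<and>
    (\<forall>p. \<forall>x\<in>carrier A. \<forall>y\<in>carrier A. \<phi> (prd A p x y) = prd B p (\<phi> x) (\<phi> y))"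

lemma (in nonassoc_algebra) algebra_hom_eval:
  assumes "\<And>i. v i \<in> carrier A"
  shows "algebra_hom R (free_algebra R) A (eval_relation R A v)"
  unfolding algebra_hom_def
proof (intro conjI allI ballI)
  show "linear_map R (free_algebra R) A (eval_relation R A v)"
    using assms by (rule linear_map_eval)
  note lin = this
  show "eval_relation R A v (prd (free_algebra R) p f g) =
      prd A p (eval_relation R A v f) (eval_relation R A v g)"
    if "f \<in> carrier (free_algebra R)" "g \<in> carrier (free_algebra R)" for p f g
    by (rule bilinear_free_eqI[OF R.is_cring nonassoc_algebra_axioms lin lin lin _ that])
      (simp only: eval_relation_mono[OF assms] eval_monomial.simps)
qed

text \<open>Homomorphisms commute with the evaluation of monomials, hence of relations. Renaming,
  polarization and dendriform relations are all evaluations in algebras built on a free algebra, so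
  their compatibilities become instances of this.\<close>

lemma algebra_hom_eval_relation:
  assumes "nonassoc_algebra R A" "nonassoc_algebra R B" "algebra_hom R A B \<phi>"
    and v: "\<And>i. v i \<in> carrier A" and f: "f \<in> carrier (free_algebra R)"
  shows "\<phi> (eval_relation R A v f) = eval_relation R B (\<lambda>i. \<phi> (v i)) f"
proof -
  interpret A: nonassoc_algebra R A by fact
  interpret B: nonassoc_algebra R B by fact
  have lin: "linear_map R A B \<phi>" using assms(3) by (simp add: algebra_hom_def)
  have w: "\<phi> (v i) \<in> carrier B" for i
    using linear_map_closed[OF lin v] .
  have mono: "\<phi> (eval_monomial A v m) = eval_monomial B (\<lambda>i. \<phi> (v i)) m" for m
    using assms(3) A.eval_monomial_closed[OF v] by (induction m) (simp_all add: algebra_hom_def)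
  show ?thesis
    by (rule linear_map_eqI[OF A.R.is_cring B.module_axioms
          linear_map_comp[OF A.linear_map_eval[OF v] lin] B.linear_map_eval[OF w] _ f])
      (simp only: A.eval_relation_mono[OF v] B.eval_relation_mono[OF w] mono)
qed

declare free_algebra_simps [simp del]

section \<open>Change of products and square algebras\<close>

lemma with_products_simps [simp]:
  "carrier (with_products M f) = carrier M"
  "\<zero>\<^bsub>with_products M f\<^esub> = \<zero>\<^bsub>M\<^esub>"
  "x \<oplus>\<^bsub>with_products M f\<^esub> y = x \<oplus>\<^bsub>M\<^esub> y"
  "c \<odot>\<^bsub>with_products M f\<^esub> x = c \<odot>\<^bsub>M\<^esub> x"
  "prd (with_products M f) p = f p"
  by (simp_all add: with_products_def)

lemma with_products_minus [simp]:
  "\<ominus>\<^bsub>with_products M f\<^esub> x = \<ominus>\<^bsub>M\<^esub> x"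
  "x \<ominus>\<^bsub>with_products M f\<^esub> y = x \<ominus>\<^bsub>M\<^esub> y"
  by (simp_all add: a_minus_def a_inv_def m_inv_def)

lemma with_products_module:
  assumes "module R M"
  shows "module R (with_products M f)"
proof -
  interpret M: module R M by fact
  show ?thesis
    by (intro moduleI abelian_groupI)
      (auto simp: M.R.is_cring M.M.a_ac M.smult_l_distr M.smult_r_distr M.smult_assoc1
        intro: bexI[of _ "\<ominus>\<^bsub>M\<^esub> _"] M.M.l_neg)
qed

section \<open>The square algebra with its polarized products\<close>

lemma polarized_square_simps [simp]:
  "carrier (polarized_square B) = carrier B \<times> carrier B"
  "\<zero>\<^bsub>polarized_square B\<^esub> = (\<zero>\<^bsub>B\<^esub>, \<zero>\<^bsub>B\<^esub>)"
  "x \<oplus>\<^bsub>polarized_square B\<^esub> y = (fst x \<oplus>\<^bsub>B\<^esub> fst y, snd x \<oplus>\<^bsub>B\<^esub> snd y)"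
  "c \<odot>\<^bsub>polarized_square B\<^esub> x = (c \<odot>\<^bsub>B\<^esub> fst x, c \<odot>\<^bsub>B\<^esub> snd x)"
  "prd (polarized_square B) Dot x y =
    (prd B Star (fst x) (fst y) \<oplus>\<^bsub>B\<^esub> prd B Star (fst y) (fst x),
     prd B Star (fst x) (snd y) \<oplus>\<^bsub>B\<^esub> prd B Star (fst y) (snd x))"
  "prd (polarized_square B) Bracket x y =
    (prd B Circ (fst x) (fst y) \<ominus>\<^bsub>B\<^esub> prd B Circ (fst y) (fst x),
     prd B Circ (fst x) (snd y) \<ominus>\<^bsub>B\<^esub> prd B Circ (fst y) (snd x))"
  by (simp_all add: polarized_square_def square_module_def split_beta)

lemma polarized_square_module:
  assumes "module R B"
  shows "module R (polarized_square B)"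
proof -
  interpret M: module R B by fact
  show ?thesis
  proof (intro moduleI abelian_groupI)
    fix x assume "x \<in> carrier (polarized_square B)"
    then show "\<exists>y\<in>carrier (polarized_square B). y \<oplus>\<^bsub>polarized_square B\<^esub> x = \<zero>\<^bsub>polarized_square B\<^esub>"
      by (intro bexI[of _ "(\<ominus>\<^bsub>B\<^esub> fst x, \<ominus>\<^bsub>B\<^esub> snd x)"]) (auto simp: M.M.l_neg)
  qed (auto simp: M.R.is_cring M.M.a_ac M.smult_l_distr M.smult_r_distr M.smult_assoc1)
qed

lemma (in abelian_group) add_add_swap:
  "\<lbrakk>a \<in> carrier G; b \<in> carrier G; c \<in> carrier G; d \<in> carrier G\<rbrakk>
    \<Longrightarrow> (a \<oplus> b) \<oplus> (c \<oplus> d) = (a \<oplus> c) \<oplus> (b \<oplus> d)"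
  by (simp add: a_ac)

lemma (in abelian_group) add_diff_swap:
  "\<lbrakk>a \<in> carrier G; b \<in> carrier G; c \<in> carrier G; d \<in> carrier G\<rbrakk>
    \<Longrightarrow> (a \<oplus> b) \<ominus> (c \<oplus> d) = (a \<ominus> c) \<oplus> (b \<ominus> d)"
  by (simp add: a_minus_def minus_add a_ac)

lemma (in module) smult_diff:
  "\<lbrakk>c \<in> carrier R; a \<in> carrier M; b \<in> carrier M\<rbrakk>
    \<Longrightarrow> c \<odot>\<^bsub>M\<^esub> (a \<ominus>\<^bsub>M\<^esub> b) = c \<odot>\<^bsub>M\<^esub> a \<ominus>\<^bsub>M\<^esub> c \<odot>\<^bsub>M\<^esub> b"
  by (simp add: a_minus_def smult_r_distr smult_r_minus)

lemma polarized_square_nonassoc: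
  assumes "nonassoc_algebra R B"
  shows "nonassoc_algebra R (polarized_square B)"
proof -
  interpret B: nonassoc_algebra R B by fact
  interpret S: module R "polarized_square B"
    by (rule polarized_square_module) (rule B.module_axioms)
  note [simp] = B.prd_closed B.prd_add_left B.prd_add_right B.prd_smult_left B.prd_smult_right
    B.smult_r_distr B.M.add_add_swap B.M.add_diff_swap B.smult_diff
  show ?thesis
  proof (rule nonassoc_algebraI[OF S.module_axioms])
    fix p x assume "x \<in> carrier (polarized_square B)"
    then show "linear_map R (polarized_square B) (polarized_square B)
        (\<lambda>y. prd (polarized_square B) p y x)"
      "linear_map R (polarized_square B) (polarized_square B) (prd (polarized_square B) p x)"
      by (intro linear_mapI; cases p; auto)+
  qed
qed

lemma (in abelian_group) minus_zero: "\<ominus> \<zero> = \<zero>"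
  by (intro minus_equality) simp_all

lemma (in abelian_group) minus_diff:
  "\<lbrakk>a \<in> carrier G; b \<in> carrier G\<rbrakk> \<Longrightarrow> \<ominus> (a \<ominus> b) = b \<ominus> a"
  by (simp add: a_minus_def minus_add a_ac)

lemma polarized_square_minus:
  assumes "module R B" "x \<in> carrier (polarized_square B)"
  shows "\<ominus>\<^bsub>polarized_square B\<^esub> x = (\<ominus>\<^bsub>B\<^esub> fst x, \<ominus>\<^bsub>B\<^esub> snd x)"
proof -
  interpret M: module R B by fact
  interpret S: module R "polarized_square B"
    by (rule polarized_square_module) fact
  show ?thesis
    using assms(2) by (intro S.M.minus_equality) (auto simp: M.M.l_neg)
qed

lemma polarized_square_polarized:
  assumes "nonassoc_algebra R B"
  shows "polarized_algebra R (polarized_square B)"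
proof -
  interpret B: nonassoc_algebra R B by fact
  show ?thesis
    unfolding polarized_algebra_def
  proof (intro conjI ballI)
    fix x y assume x: "x \<in> carrier (polarized_square B)" and y: "y \<in> carrier (polarized_square B)"
    show "prd (polarized_square B) Dot x y = prd (polarized_square B) Dot y x"
      using x y by (auto simp: B.prd_closed B.M.a_comm)
    show "prd (polarized_square B) Bracket x y =
        \<ominus>\<^bsub>polarized_square B\<^esub> prd (polarized_square B) Bracket y x"
      using x y
      by (subst polarized_square_minus[OF B.module_axioms])
        (auto simp: B.prd_closed B.M.minus_diff)
  qed (rule polarized_square_nonassoc[OF assms])
qed

text \<open>The products of the square are built from those of \<open>B\<close> by sums and
  differences in each component, so squaring is functorial.\<close>

lemma algebra_hom_polarized_square:
  assumes "nonassoc_algebra R B" "nonassoc_algebra R C" "algebra_hom R B C \<phi>"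
  shows "algebra_hom R (polarized_square B) (polarized_square C) (map_prod \<phi> \<phi>)"
proof -
  interpret B: nonassoc_algebra R B by fact
  have lin: "linear_map R B C \<phi>"
    and hom: "\<And>p x y. \<lbrakk>x \<in> carrier B; y \<in> carrier B\<rbrakk> \<Longrightarrow> \<phi> (prd B p x y) = prd C p (\<phi> x) (\<phi> y)"
    using assms(3) by (auto simp: algebra_hom_def)
  note lm = linear_map_closed[OF lin] linear_map_add[OF lin] linear_map_smult[OF lin]
    linear_map_minus[OF B.module_axioms nonassoc_algebra.axioms(1)[OF assms(2)] lin]
  show ?thesis
    unfolding algebra_hom_def
  proof (intro conjI allI ballI)
    show "linear_map R (polarized_square B) (polarized_square C) (map_prod \<phi> \<phi>)"
      by (rule linear_mapI) (auto simp: lm)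
    fix p x y assume "x \<in> carrier (polarized_square B)" "y \<in> carrier (polarized_square B)"
    then show "map_prod \<phi> \<phi> (prd (polarized_square B) p x y) =
        prd (polarized_square C) p (map_prod \<phi> \<phi> x) (map_prod \<phi> \<phi> y)"
      by (cases p) (auto simp: lm hom B.prd_closed)
  qed
qed

lemma linear_map_fst: "linear_map R (polarized_square B) B fst"
  and linear_map_snd: "linear_map R (polarized_square B) B snd"
  by (rule linear_mapI; auto)+

section \<open>The single product recovered from a polarized algebra\<close>

lemma linear_map_depolarize [simp]:
  "linear_map R M (depolarize A) \<phi> \<longleftrightarrow> linear_map R M A \<phi>"
  by (simp add: linear_map_def depolarize_def)

lemma depolarize_nonassoc:
  assumes "nonassoc_algebra R A"
  shows "nonassoc_algebra R (depolarize A)"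
proof -
  interpret A: nonassoc_algebra R A by fact
  interpret S: module R "depolarize A"
    unfolding depolarize_def by (rule with_products_module) (rule A.module_axioms)
  note [simp] = A.prd_closed A.prd_add_left A.prd_add_right A.prd_smult_left A.prd_smult_right
    A.smult_r_distr A.M.add_add_swap
  show ?thesis
    by unfold_locales (auto simp: depolarize_def split: one_op.splits)
qed


section \<open>Restricting the support of a relation\<close>

text \<open>Weight parts, multilinear parts, and the components for a given number of leaves or a
  given last leaf are all restrictions of the support, so one operation and its commutation rule
  serve for all of them.\<close>

definition restr ::
    "('r, 'm) ring_scheme \<Rightarrow> ('p monomial \<Rightarrow> bool) \<Rightarrow> ('r, 'p) relation \<Rightarrow> ('r, 'p) relation" where
  "restr R P f = (\<lambda>m. if P m then f m else \<zero>\<^bsub>R\<^esub>)"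

lemma weight_part_eq_restr: "weight_part R q w = restr R (\<lambda>m. op_count q m = w)"
  by (simp add: fun_eq_iff weight_part_def restr_def)

lemma restr_restr: "restr R P (restr R Q f) = restr R (\<lambda>m. P m \<and> Q m) f"
  by (auto simp: restr_def)

lemma linear_map_restr:
  fixes R :: "('r, 'm) ring_scheme"
  assumes "cring R"
  shows "linear_map R (free_algebra R) (free_algebra R) (restr R (P :: 'p monomial \<Rightarrow> bool))"
proof -
  interpret R: cring R by fact
  show ?thesis
  proof (rule linear_mapI)
    fix f :: "('r, 'p) relation" assume f: "f \<in> carrier (free_algebra R)"
    have "finite {m. restr R P f m \<noteq> \<zero>\<^bsub>R\<^esub>}"
      by (rule finite_subset[of _ "{m. f m \<noteq> \<zero>\<^bsub>R\<^esub>}"])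
        (use f in \<open>auto simp: restr_def free_algebra_simps\<close>)
    then show "restr R P f \<in> carrier (free_algebra R)"
      using f by (auto simp: restr_def free_algebra_simps)
  qed (auto simp: restr_def free_algebra_simps)
qed

lemmas restr_closed = linear_map_closed[OF linear_map_restr]

lemma restr_zero: "restr R P \<zero>\<^bsub>free_algebra R\<^esub> = \<zero>\<^bsub>free_algebra R\<^esub>"
  by (simp add: restr_def free_algebra_simps fun_eq_iff)

lemma restr_monom: "restr R P (monom R m) = (if P m then monom R m else \<zero>\<^bsub>free_algebra R\<^esub>)"
  by (auto simp: restr_def monom_def free_algebra_simps fun_eq_iff)

text \<open>The support hypothesis makes \<open>\<phi>\<close> respect two splittings of the basis:
  monomials with \<open>P\<close> yield only monomials with \<open>Q\<close>, the others only
  monomials without it. This is how weights, lengths and last leaves are transported.\<close>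

lemma linear_map_restr_commute:
  assumes "cring R" and lin: "linear_map R (free_algebra R) (free_algebra R) \<phi>"
    and supp: "\<And>m m'. \<phi> (monom R m) m' \<noteq> \<zero>\<^bsub>R\<^esub> \<Longrightarrow> P m = Q m'"
    and "f \<in> carrier (free_algebra R)"
  shows "\<phi> (restr R P f) = restr R Q (\<phi> f)"
proof (rule linear_map_eqI[OF assms(1) free_algebra_module[OF assms(1)] _ _ _ assms(4)])
  note F = free_algebra_module[OF assms(1)]
  show "linear_map R (free_algebra R) (free_algebra R) (\<lambda>f. \<phi> (restr R P f))"
    by (rule linear_map_comp[OF linear_map_restr[OF assms(1)] lin])
  show "linear_map R (free_algebra R) (free_algebra R) (\<lambda>f. restr R Q (\<phi> f))"
    by (rule linear_map_comp[OF lin linear_map_restr[OF assms(1)]])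
  fix m
  have "restr R Q (\<phi> (monom R m)) = (if P m then \<phi> (monom R m) else \<zero>\<^bsub>free_algebra R\<^esub>)"
    using supp unfolding restr_def free_algebra_simps fun_eq_iff by metis
  then show "\<phi> (restr R P (monom R m)) = restr R Q (\<phi> (monom R m))"
    by (simp add: restr_monom linear_map_zero[OF F F lin])
qed

lemma free_algebra_supp_induct [consumes 3, case_names zero mono add smult]:
  fixes R :: "('r, 'm) ring_scheme" and Q :: "('r, 'p) relation \<Rightarrow> bool"
  assumes "cring R" "f \<in> carrier (free_algebra R)" "\<forall>m. f m \<noteq> \<zero>\<^bsub>R\<^esub> \<longrightarrow> \<kappa> m"
    and zero: "Q \<zero>\<^bsub>free_algebra R\<^esub>"
    and mono: "\<And>m. \<kappa> m \<Longrightarrow> Q (monom R m)"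
    and add: "\<And>f g. \<lbrakk>f \<in> carrier (free_algebra R); g \<in> carrier (free_algebra R); Q f; Q g\<rbrakk>
        \<Longrightarrow> Q (f \<oplus>\<^bsub>free_algebra R\<^esub> g)"
    and smult: "\<And>c f. \<lbrakk>c \<in> carrier R; f \<in> carrier (free_algebra R); Q f\<rbrakk>
        \<Longrightarrow> Q (c \<odot>\<^bsub>free_algebra R\<^esub> f)"
  shows "Q f"
proof -
  note lin = linear_map_restr[OF assms(1), of \<kappa>]
  \<comment> \<open>The support condition is not inherited by the summands of \<open>f\<close>,
    where terms may cancel. Restricting inside the statement makes plain induction
    applicable.\<close>
  have "Q (restr R \<kappa> f)"
    using assms(1,2)
  proof (induction rule: free_algebra_induct)
    case (mono m)
    then show ?case using zero assms(5) by (simp add: restr_monom)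
  next
    case (add f g)
    then show ?case
      using assms(6)[OF restr_closed[OF assms(1) add(1)] restr_closed[OF assms(1) add(2)]]
      by (simp add: linear_map_add[OF lin])
  next
    case (smult c f)
    then show ?case
      using assms(7)[OF smult(1) restr_closed[OF assms(1) smult(2)]]
      by (simp add: linear_map_smult[OF lin])
  qed (simp add: restr_zero zero)
  moreover have "restr R \<kappa> f = f"
    unfolding restr_def by (rule ext) (metis assms(3))
  ultimately show ?thesis by simp
qed

abbreviation multilinear_monomial :: "nat \<Rightarrow> 'p monomial \<Rightarrow> bool" where
  "multilinear_monomial n m \<equiv> distinct (leaves m) \<and> set (leaves m) = {1..n}"

lemma multilinear_iff_restr: "multilinear R n f \<longleftrightarrow> restr R (multilinear_monomial n) f = f"
  unfolding multilinear_def restr_def fun_eq_iff by metis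

lemma multilinear_length:
  "\<lbrakk>multilinear R n f; f m \<noteq> \<zero>\<^bsub>R\<^esub>\<rbrakk> \<Longrightarrow> length (leaves m) = n"
  unfolding multilinear_def using distinct_card by fastforce

lemma prd_free_supportE:
  assumes "cring R" "f \<in> carrier (free_algebra R)" "g \<in> carrier (free_algebra R)"
    and "prd (free_algebra R) p f g m \<noteq> \<zero>\<^bsub>R\<^esub>"
  obtains s t where "m = Op p s t" "f s \<noteq> \<zero>\<^bsub>R\<^esub>" "g t \<noteq> \<zero>\<^bsub>R\<^esub>"
proof -
  interpret R: cring R by fact
  show ?thesis
    using assms(2-) that
    by (cases m) (auto simp: free_algebra_simps split: if_splits, metis R.l_null R.r_null)
qed

lemma add_free_supportE:
  assumes "cring R" "(f \<oplus>\<^bsub>free_algebra R\<^esub> g) m \<noteq> \<zero>\<^bsub>R\<^esub>"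
  obtains "f m \<noteq> \<zero>\<^bsub>R\<^esub>" | "g m \<noteq> \<zero>\<^bsub>R\<^esub>"
proof -
  interpret R: cring R by fact
  show ?thesis
    using assms(2) that by (cases "f m = \<zero>\<^bsub>R\<^esub>"; cases "g m = \<zero>\<^bsub>R\<^esub>") (auto simp: free_algebra_simps)
qed

lemma free_algebra_neg:
  assumes "cring R" "f \<in> carrier (free_algebra R)"
  shows "\<ominus>\<^bsub>free_algebra R\<^esub> f = (\<lambda>m. \<ominus>\<^bsub>R\<^esub> f m)"
proof -
  interpret R: cring R by fact
  interpret F: module R "free_algebra R :: ('a, ('a, 'c) relation, 'c) op_algebra"
    by (rule free_algebra_module) fact
  have "\<ominus>\<^bsub>free_algebra R\<^esub> f = (\<ominus>\<^bsub>R\<^esub> \<one>\<^bsub>R\<^esub>) \<odot>\<^bsub>free_algebra R\<^esub> f"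
    using assms(2) by (simp add: F.smult_l_minus)
  then show ?thesis
    using assms(2) by (simp add: free_algebra_simps R.l_minus)
qed

lemma minus_free_supportE:
  assumes "cring R" "g \<in> carrier (free_algebra R)" "(f \<ominus>\<^bsub>free_algebra R\<^esub> g) m \<noteq> \<zero>\<^bsub>R\<^esub>"
  obtains "f m \<noteq> \<zero>\<^bsub>R\<^esub>" | "g m \<noteq> \<zero>\<^bsub>R\<^esub>"
proof -
  interpret R: cring R by fact
  show ?thesis
    using assms(3) that
    by (cases "g m = \<zero>\<^bsub>R\<^esub>")
      (auto simp: a_minus_def free_algebra_neg[OF assms(1,2)] elim!: add_free_supportE[OF assms(1)])
qed


section \<open>The dendriform relations of a polarized relation\<close>

definition dend_vars ::
    "('r, 'm) ring_scheme \<Rightarrow> nat \<Rightarrow> nat \<Rightarrow> ('r, 'p) relation \<times> ('r, 'p) relation" where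
  "dend_vars R p q =
     (if q = p then (\<zero>\<^bsub>free_algebra R\<^esub>, gen R q) else (gen R q, \<zero>\<^bsub>free_algebra R\<^esub>))"

lemma dend_relation_eq:
  "dend_relation R p f = snd (eval_relation R (polarized_square (free_algebra R)) (dend_vars R p) f)"
  by (simp add: dend_relation_def dend_vars_def[abs_def])

lemma zero_closed_free: "cring R \<Longrightarrow> \<zero>\<^bsub>free_algebra R\<^esub> \<in> carrier (free_algebra R)"
  by (simp add: free_algebra_simps cring.cring_simprules)

lemma gen_closed: "cring R \<Longrightarrow> gen R i \<in> carrier (free_algebra R)"
  by (simp add: gen_eq_mono mono_closed)

lemma dend_vars_closed:
  "cring R \<Longrightarrow> dend_vars R p q \<in> carrier (polarized_square (free_algebra R))"
  by (auto simp: dend_vars_def zero_closed_free gen_closed)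

lemma square_free_nonassoc:
  "cring R \<Longrightarrow> nonassoc_algebra R (polarized_square (free_algebra R))"
  by (intro polarized_square_nonassoc free_algebra_nonassoc)

lemma linear_map_dend_relation:
  assumes "cring R"
  shows "linear_map R (free_algebra R) (free_algebra R) (dend_relation R p)"
  unfolding dend_relation_eq[abs_def]
  by (rule linear_map_comp[OF nonassoc_algebra.linear_map_eval[OF square_free_nonassoc[OF assms]]
        linear_map_snd])
    (rule dend_vars_closed[OF assms])

lemma dend_relation_mono:
  assumes "cring R"
  shows "dend_relation R p (monom R m) =
    snd (eval_monomial (polarized_square (free_algebra R)) (dend_vars R p) m)"
  using nonassoc_algebra.eval_relation_mono[OF square_free_nonassoc[OF assms] dend_vars_closed[OF assms]]
  by (simp add: dend_relation_eq)

text \<open>Evaluation is a homomorphism from the free algebra to \<open>B\<close>, hence acts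
  componentwise on the squares. The relation computed formally therefore takes the same values as
  the substitution of \<open>(\<zero>, v p)\<close> and \<open>(v q, \<zero>)\<close> made directly
  in the square of \<open>B\<close>.\<close>

lemma eval_dend_relation:
  assumes "nonassoc_algebra R B" "\<And>i. v i \<in> carrier B" "f \<in> carrier (free_algebra R)"
  shows "eval_relation R B v (dend_relation R p f) =
    snd (eval_relation R (polarized_square B)
          (\<lambda>q. if q = p then (\<zero>\<^bsub>B\<^esub>, v q) else (v q, \<zero>\<^bsub>B\<^esub>)) f)"
proof -
  interpret B: nonassoc_algebra R B by fact
  note R = B.R.is_cring
  let ?\<phi> = "eval_relation R B v"
  have hom: "algebra_hom R (free_algebra R) B ?\<phi>"
    by (rule B.algebra_hom_eval) fact
  have zero: "?\<phi> \<zero>\<^bsub>free_algebra R\<^esub> = \<zero>\<^bsub>B\<^esub>"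
    using linear_map_zero[OF free_algebra_module[OF R] B.module_axioms] hom
    by (auto simp: algebra_hom_def)
  have "map_prod ?\<phi> ?\<phi> (eval_relation R (polarized_square (free_algebra R)) (dend_vars R p) f) =
      eval_relation R (polarized_square B) (\<lambda>i. map_prod ?\<phi> ?\<phi> (dend_vars R p i)) f"
    by (rule algebra_hom_eval_relation[OF square_free_nonassoc[OF R]
          polarized_square_nonassoc[OF assms(1)]
          algebra_hom_polarized_square[OF free_algebra_nonassoc[OF R] assms(1) hom]
          dend_vars_closed[OF R] assms(3)])
  also have "(\<lambda>i. map_prod ?\<phi> ?\<phi> (dend_vars R p i)) =
      (\<lambda>q. if q = p then (\<zero>\<^bsub>B\<^esub>, v q) else (v q, \<zero>\<^bsub>B\<^esub>))"
    by (auto simp: fun_eq_iff dend_vars_def zero B.eval_relation_gen[OF assms(2)])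
  finally show ?thesis
    unfolding dend_relation_eq by (metis snd_map_prod)
qed

text \<open>First components multiply only with first components, so a single variable with
  vanishing first component annihilates that of the whole monomial.\<close>

lemma eval_square_fst_zero:
  assumes "nonassoc_algebra R B" "\<And>i. w i \<in> carrier (polarized_square B)"
    and "q \<in> set (leaves m)" "fst (w q) = \<zero>\<^bsub>B\<^esub>"
  shows "fst (eval_monomial (polarized_square B) w m) = \<zero>\<^bsub>B\<^esub>"
  using assms(3)
proof (induction m)
  case (Op p s t)
  interpret B: nonassoc_algebra R B by fact
  have cl: "eval_monomial (polarized_square B) w m \<in> carrier (polarized_square B)" for m
    by (rule nonassoc_algebra.eval_monomial_closed[OF polarized_square_nonassoc[OF assms(1)] assms(2)])
  then have cl: "fst (eval_monomial (polarized_square B) w m) \<in> carrier B" for m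
    by (metis mem_Times_iff polarized_square_simps(1))
  show ?case
    using Op by (cases p) (auto simp: cl B.prd_zero_left B.prd_zero_right a_minus_def)
qed (use assms(4) in auto)

text \<open>Each term of the second component of a product contains exactly one second component of
  a factor, so pairs \<open>(a, \<zero>)\<close> remain of this form.\<close>

lemma eval_square_snd_zero:
  assumes "nonassoc_algebra R B" "\<And>i. w i \<in> carrier (polarized_square B)"
    and "\<And>q. q \<in> set (leaves m) \<Longrightarrow> snd (w q) = \<zero>\<^bsub>B\<^esub>"
  shows "snd (eval_monomial (polarized_square B) w m) = \<zero>\<^bsub>B\<^esub>"
  using assms(3)
proof (induction m)
  case (Op p s t)
  interpret B: nonassoc_algebra R B by fact
  have cl: "eval_monomial (polarized_square B) w m \<in> carrier (polarized_square B)" for m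
    by (rule nonassoc_algebra.eval_monomial_closed[OF polarized_square_nonassoc[OF assms(1)] assms(2)])
  then have cl: "fst (eval_monomial (polarized_square B) w m) \<in> carrier B" for m
    by (metis mem_Times_iff polarized_square_simps(1))
  show ?case
    using Op by (cases p) (auto simp: cl B.prd_zero_left B.prd_zero_right a_minus_def)
qed (use assms(3) in auto)

lemma leaves_nonempty: "leaves m \<noteq> []"
  by (induction m) auto

text \<open>In the square algebra the factor contributing its second component always stands on the
  right. Hence the distinguished variable ends up last, the leaves are only permuted, and every
  \<open>Bracket\<close> turns into exactly one \<open>Circ\<close>.\<close>

lemma eval_dend_vars_support:
  fixes R :: "('r, 'm) ring_scheme" and p :: nat
  assumes "cring R"
  defines "e \<equiv> eval_monomial (polarized_square (free_algebra R)) (dend_vars R p)"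
  shows "(\<forall>m'. fst (e m) m' \<noteq> \<zero>\<^bsub>R\<^esub> \<longrightarrow>
            mset (leaves m') = mset (leaves m) \<and> op_count Circ m' = op_count Bracket m) \<and>
         (\<forall>m'. snd (e m) m' \<noteq> \<zero>\<^bsub>R\<^esub> \<longrightarrow>
            mset (leaves m') = mset (leaves m) \<and> op_count Circ m' = op_count Bracket m \<and>
            last (leaves m') = p)"
proof (induction m)
  case (Var i)
  then show ?case
    by (auto simp: e_def dend_vars_def free_algebra_simps gen_def split: if_splits)
next
  case (Op q s t)
  have cl: "e m \<in> carrier (polarized_square (free_algebra R))" for m
    unfolding e_def
    by (rule nonassoc_algebra.eval_monomial_closed[OF square_free_nonassoc[OF assms(1)]
          dend_vars_closed[OF assms(1)]])
  then have cl: "fst (e m) \<in> carrier (free_algebra R)" "snd (e m) \<in> carrier (free_algebra R)" for m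
    by (metis mem_Times_iff polarized_square_simps(1))+
  have prd: "prd (free_algebra R) q f g \<in> carrier (free_algebra R)"
    if "f \<in> carrier (free_algebra R)" "g \<in> carrier (free_algebra R)"
    for f g :: "('r, pdend_op) relation" and q
    using nonassoc_algebra.prd_closed[OF free_algebra_nonassoc[OF assms(1)] that] .
  have e: "e (Op q s t) = prd (polarized_square (free_algebra R)) q (e s) (e t)" for q
    by (simp add: e_def)
  \<comment> \<open>The flag \<open>a\<close> switches on the condition on the last leaf, which
    concerns second components only.\<close>
  define S where "S a M c f \<longleftrightarrow> (\<forall>m'. f m' \<noteq> \<zero>\<^bsub>R\<^esub> \<longrightarrow>
      mset (leaves m') = M \<and> op_count Circ m' = c \<and> (a \<longrightarrow> last (leaves m') = p))"
    for a M c and f :: "('r, pdend_op) relation"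
  have S_add: "S a M c (f \<oplus>\<^bsub>free_algebra R\<^esub> g)" if "S a M c f" "S a M c g" for a M c f g
    using that unfolding S_def by (metis add_free_supportE[OF assms(1)])
  have S_minus: "S a M c (f \<ominus>\<^bsub>free_algebra R\<^esub> g)"
    if "S a M c f" "S a M c g" "g \<in> carrier (free_algebra R)" for a M c f g
    using that unfolding S_def by (metis minus_free_supportE[OF assms(1)])
  \<comment> \<open>The last leaf of a product is that of its right factor, so the left factor
    enters with the flag off.\<close>
  have S_prd: "S a M c (prd (free_algebra R) o' f g)"
    if "S False M1 c1 f" "S a M2 c2 g" "f \<in> carrier (free_algebra R)" "g \<in> carrier (free_algebra R)"
      "M = M1 + M2" "c = (if o' = Circ then 1 else 0) + c1 + c2" for a M c M1 c1 M2 c2 f g o'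
    unfolding S_def
  proof (intro allI impI)
    note fg = that(3,4)
    fix m assume "prd (free_algebra R) o' f g m \<noteq> \<zero>\<^bsub>R\<^esub>"
    then obtain u v where "m = Op o' u v" "f u \<noteq> \<zero>\<^bsub>R\<^esub>" "g v \<noteq> \<zero>\<^bsub>R\<^esub>"
      using prd_free_supportE[OF assms(1) fg] by metis
    then show "mset (leaves m) = M \<and> op_count Circ m = c \<and> (a \<longrightarrow> last (leaves m) = p)"
      using that by (auto simp: S_def leaves_nonempty)
  qed
  have IH: "S False (mset (leaves s)) (op_count Bracket s) (fst (e s))"
    "S True (mset (leaves s)) (op_count Bracket s) (snd (e s))"
    "S False (mset (leaves t)) (op_count Bracket t) (fst (e t))"
    "S True (mset (leaves t)) (op_count Bracket t) (snd (e t))"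
    using Op by (auto simp: S_def)
  have "S False (mset (leaves (Op q s t))) (op_count Bracket (Op q s t)) (fst (e (Op q s t)))"
    using IH by (cases q) (auto simp: e intro!: S_add S_minus cl prd intro: S_prd cl)
  moreover have "S True (mset (leaves (Op q s t))) (op_count Bracket (Op q s t)) (snd (e (Op q s t)))"
    using IH by (cases q) (auto simp: e intro!: S_add S_minus cl prd intro: S_prd cl)
  ultimately show ?case
    by (simp add: S_def)
qed

text \<open>\<open>P\<close> and \<open>Q\<close> have to agree only on pairs of monomials that the
  substitution can link: same leaves up to order, same weight, last leaf \<open>p\<close>.\<close>

lemma dend_relation_restr:
  assumes "cring R" "f \<in> carrier (free_algebra R)"
    and "\<And>m m'. \<lbrakk>mset (leaves m') = mset (leaves m); op_count Circ m' = op_count Bracket m;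
        last (leaves m') = p\<rbrakk> \<Longrightarrow> P m = Q m'"
  shows "dend_relation R p (restr R P f) = restr R Q (dend_relation R p f)"
proof (rule linear_map_restr_commute[OF assms(1) linear_map_dend_relation[OF assms(1)] _ assms(2)])
  fix m m' assume "dend_relation R p (monom R m) m' \<noteq> \<zero>\<^bsub>R\<^esub>"
  then show "P m = Q m'"
    using eval_dend_vars_support[OF assms(1), of p m] assms(3)
    by (auto simp: dend_relation_mono[OF assms(1)])
qed

section \<open>Submodules and ideals generated by a set\<close>

lemma (in module) submodule_iff:
  "submodule H R M \<longleftrightarrow> H \<subseteq> carrier M \<and> \<zero>\<^bsub>M\<^esub> \<in> H \<and>
    (\<forall>x\<in>H. \<forall>y\<in>H. x \<oplus>\<^bsub>M\<^esub> y \<in> H) \<and> (\<forall>c\<in>carrier R. \<forall>x\<in>H. c \<odot>\<^bsub>M\<^esub> x \<in> H)"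
    (is "?L \<longleftrightarrow> ?R")
proof
  assume H: ?L
  from submoduleE(2)[OF H] obtain x where "x \<in> H" by blast
  then have "\<zero>\<^bsub>M\<^esub> \<in> H"
    using submoduleE(1)[OF H] submoduleE(4)[OF H, of "\<zero>\<^bsub>R\<^esub>" x] by auto
  then show ?R
    using submoduleE[OF H] by blast
next
  assume H: ?R
  show ?L
  proof (rule submoduleI)
    fix a assume a: "a \<in> H"
    then have "(\<ominus> \<one>) \<odot>\<^bsub>M\<^esub> a \<in> H" using H by simp
    moreover have "a \<in> carrier M" using a H by blast
    ultimately show "\<ominus>\<^bsub>M\<^esub> a \<in> H" by (simp add: smult_l_minus)
  qed (use H in auto)
qed

lemma (in module) submodule_zero: "submodule {\<zero>\<^bsub>M\<^esub>} R M"
  by (simp add: submodule_iff)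

lemma (in module) submodule_Inter:
  assumes "K \<noteq> {}" "\<And>H. H \<in> K \<Longrightarrow> submodule H R M"
  shows "submodule (\<Inter>K) R M"
proof -
  have K: "H \<subseteq> carrier M" "\<zero>\<^bsub>M\<^esub> \<in> H" "\<lbrakk>x \<in> H; y \<in> H\<rbrakk> \<Longrightarrow> x \<oplus>\<^bsub>M\<^esub> y \<in> H"
    "\<lbrakk>c \<in> carrier R; x \<in> H\<rbrakk> \<Longrightarrow> c \<odot>\<^bsub>M\<^esub> x \<in> H" if "H \<in> K" for H x y c
    using assms(2)[OF that] by (simp_all add: submodule_iff)
  show ?thesis
    unfolding submodule_iff
  proof (intro conjI ballI)
    show "\<Inter>K \<subseteq> carrier M" using assms(1) K(1) by blast
  qed (auto intro: K)
qed

lemma (in module) hull_submodule: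
  assumes "X \<subseteq> carrier M"
  shows "submodule ((\<lambda>N. submodule N R M) hull X) R M"
  unfolding hull_def using assms carrier_is_submodule by (intro submodule_Inter) auto

lemma submodule_vimage:
  assumes "module R M" "module R N" "linear_map R M N \<phi>" "submodule H R N"
  shows "submodule {x \<in> carrier M. \<phi> x \<in> H} R M"
proof -
  interpret M: module R M by fact
  interpret N: module R N by fact
  show ?thesis
    using assms(4) linear_map_add[OF assms(3)] linear_map_smult[OF assms(3)]
      linear_map_zero[OF assms(1-3)]
    unfolding M.submodule_iff N.submodule_iff by auto
qed

lemma (in nonassoc_algebra) hull_two_sided_ideal:
  assumes "X \<subseteq> carrier A"
  shows "two_sided_ideal R A (two_sided_ideal R A hull X)"
proof -
  have "two_sided_ideal R A (carrier A)"
    by (simp add: two_sided_ideal_def carrier_is_submodule prd_closed)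
  then have "submodule (two_sided_ideal R A hull X) R A"
    unfolding hull_def using assms by (intro submodule_Inter) (auto simp: two_sided_ideal_def)
  then show ?thesis
    by (simp add: two_sided_ideal_def hull_def)
qed

lemma symmetry_ideal_two_sided:
  fixes R :: "('r, 'm) ring_scheme"
  assumes "cring R"
  shows "two_sided_ideal R (free_algebra R) (symmetry_ideal R)"
proof -
  interpret F: nonassoc_algebra R "free_algebra R :: ('r, ('r, pol_op) relation, pol_op) op_algebra"
    by (rule free_algebra_nonassoc) fact
  show ?thesis
    unfolding symmetry_ideal_def Let_def
    by (rule F.hull_two_sided_ideal) (blast intro: F.prd_closed F.M.minus_closed F.M.a_closed)
qed

text \<open>The kernel of the evaluation is a two-sided ideal, and the identities of a polarized
  algebra put the generators of the symmetry ideal into it.\<close>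

lemma eval_symmetry_ideal:
  fixes R :: "('r, 'm) ring_scheme"
  assumes "polarized_algebra R A" "\<And>i. v i \<in> carrier A" "f \<in> symmetry_ideal R"
  shows "eval_relation R A v f = \<zero>\<^bsub>A\<^esub>"
proof -
  interpret A: nonassoc_algebra R A using assms(1) by (simp add: polarized_algebra_def)
  interpret F: nonassoc_algebra R "free_algebra R :: ('r, ('r, pol_op) relation, pol_op) op_algebra"
    by (rule free_algebra_nonassoc) (rule A.R.is_cring)
  let ?F = "free_algebra R :: ('r, ('r, pol_op) relation, pol_op) op_algebra"
  let ?e = "eval_relation R A v"
  have lin: "linear_map R ?F A ?e"
    by (rule A.linear_map_eval) fact
  have hom: "?e (prd ?F p f g) = prd A p (?e f) (?e g)"
    if "f \<in> carrier ?F" "g \<in> carrier ?F" for p f g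
    using A.algebra_hom_eval[OF assms(2)] that by (simp add: algebra_hom_def)
  have cl: "?e f \<in> carrier A" if "f \<in> carrier ?F" for f
    using linear_map_closed[OF lin that] .
  let ?K = "{f \<in> carrier ?F. ?e f \<in> {\<zero>\<^bsub>A\<^esub>}}"
  have "two_sided_ideal R ?F ?K"
    unfolding two_sided_ideal_def
  proof (intro conjI allI ballI)
    show "submodule ?K R ?F"
      by (rule submodule_vimage[OF F.module_axioms A.module_axioms lin A.submodule_zero])
  qed (simp_all add: hom cl F.prd_closed A.prd_zero_left A.prd_zero_right)
  moreover have "prd ?F Dot f g \<ominus>\<^bsub>?F\<^esub> prd ?F Dot g f \<in> ?K"
    if "f \<in> carrier ?F" "g \<in> carrier ?F" for f g
  proof -
    have "prd A Dot (?e f) (?e g) = prd A Dot (?e g) (?e f)"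
      using assms(1) cl[OF that(1)] cl[OF that(2)] unfolding polarized_algebra_def by blast
    then have "?e (prd ?F Dot f g \<ominus>\<^bsub>?F\<^esub> prd ?F Dot g f) =
        prd A Dot (?e g) (?e f) \<ominus>\<^bsub>A\<^esub> prd A Dot (?e g) (?e f)"
      using that
      by (simp add: F.prd_closed linear_map_minus[OF F.module_axioms A.module_axioms lin] hom)
    also have "\<dots> = \<zero>\<^bsub>A\<^esub>"
      unfolding a_minus_def using that by (intro A.M.r_neg A.prd_closed cl)
    finally show ?thesis
      using that by (simp add: F.prd_closed)
  qed
  moreover have "prd ?F Bracket f g \<oplus>\<^bsub>?F\<^esub> prd ?F Bracket g f \<in> ?K"
    if "f \<in> carrier ?F" "g \<in> carrier ?F" for f g
  proof -
    have "prd A Bracket (?e f) (?e g) = \<ominus>\<^bsub>A\<^esub> prd A Bracket (?e g) (?e f)"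
      using assms(1) cl[OF that(1)] cl[OF that(2)] unfolding polarized_algebra_def by blast
    then show ?thesis
      using that by (simp add: F.prd_closed linear_map_add[OF lin] hom cl A.prd_closed A.M.l_neg)
  qed
  moreover define K where "K = ?K"
  ultimately have "symmetry_ideal R \<subseteq> K"
    unfolding symmetry_ideal_def Let_def K_def[symmetric] by (intro hull_minimal) blast+
  then have "f \<in> ?K" using assms(3) by (auto simp: K_def)
  then show ?thesis by simp
qed

section \<open>Congruence of polarized relations modulo the symmetry ideal\<close>

definition sym_eq :: "('r, 'm) ring_scheme \<Rightarrow> ('r, pol_op) relation \<Rightarrow> ('r, pol_op) relation \<Rightarrow> bool"
  where "sym_eq R f g \<longleftrightarrow> f \<in> carrier (free_algebra R) \<and> g \<in> carrier (free_algebra R) \<and>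
    f \<ominus>\<^bsub>free_algebra R\<^esub> g \<in> symmetry_ideal R"

context
  fixes R :: "('r, 'm) ring_scheme" and F :: "('r, ('r, pol_op) relation, pol_op) op_algebra"
  assumes cring: "cring R"
  defines "F \<equiv> free_algebra R"
begin

interpretation F: nonassoc_algebra R F
  unfolding F_def by (rule free_algebra_nonassoc) (rule cring)

private lemma ideal:
  shows "submodule (symmetry_ideal R) R F"
    and "\<lbrakk>a \<in> carrier F; x \<in> symmetry_ideal R\<rbrakk> \<Longrightarrow> prd F p a x \<in> symmetry_ideal R"
    and "\<lbrakk>a \<in> carrier F; x \<in> symmetry_ideal R\<rbrakk> \<Longrightarrow> prd F p x a \<in> symmetry_ideal R"
  using symmetry_ideal_two_sided[OF cring]
  unfolding two_sided_ideal_def F_def[symmetric] by simp_all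

private lemma ideal_add: "\<lbrakk>x \<in> symmetry_ideal R; y \<in> symmetry_ideal R\<rbrakk> \<Longrightarrow> x \<oplus>\<^bsub>F\<^esub> y \<in> symmetry_ideal R"
  and ideal_smult: "\<lbrakk>c \<in> carrier R; x \<in> symmetry_ideal R\<rbrakk> \<Longrightarrow> c \<odot>\<^bsub>F\<^esub> x \<in> symmetry_ideal R"
  and ideal_zero: "\<zero>\<^bsub>F\<^esub> \<in> symmetry_ideal R"
  using ideal(1) unfolding F.submodule_iff by auto

private lemma sym_eq_F: "sym_eq R f g \<longleftrightarrow>
    f \<in> carrier F \<and> g \<in> carrier F \<and> f \<ominus>\<^bsub>F\<^esub> g \<in> symmetry_ideal R"
  by (simp add: sym_eq_def F_def)

lemma sym_eq_refl: "f \<in> carrier F \<Longrightarrow> sym_eq R f f"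
  by (simp add: sym_eq_F ideal_zero a_minus_def F.M.r_neg)

lemma sym_eq_trans:
  assumes "sym_eq R f g" "sym_eq R g h"
  shows "sym_eq R f h"
proof -
  have c: "f \<in> carrier F" "g \<in> carrier F" "h \<in> carrier F"
    using assms by (simp_all add: sym_eq_F)
  have "f \<ominus>\<^bsub>F\<^esub> h = f \<oplus>\<^bsub>F\<^esub> (\<ominus>\<^bsub>F\<^esub> g \<oplus>\<^bsub>F\<^esub> (g \<oplus>\<^bsub>F\<^esub> \<ominus>\<^bsub>F\<^esub> h))"
    using c by (simp add: a_minus_def F.M.r_neg1)
  also have "\<dots> = (f \<ominus>\<^bsub>F\<^esub> g) \<oplus>\<^bsub>F\<^esub> (g \<ominus>\<^bsub>F\<^esub> h)"
    using c by (simp add: a_minus_def F.M.a_assoc)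
  finally show ?thesis
    using assms c ideal_add by (simp add: sym_eq_F)
qed

lemma sym_eq_add:
  assumes "sym_eq R f f'" "sym_eq R g g'"
  shows "sym_eq R (f \<oplus>\<^bsub>F\<^esub> g) (f' \<oplus>\<^bsub>F\<^esub> g')"
  using assms ideal_add by (simp add: sym_eq_F F.M.add_diff_swap)

lemma sym_eq_smult:
  assumes "sym_eq R f f'" "c \<in> carrier R"
  shows "sym_eq R (c \<odot>\<^bsub>F\<^esub> f) (c \<odot>\<^bsub>F\<^esub> f')"
proof -
  have "c \<odot>\<^bsub>F\<^esub> f \<ominus>\<^bsub>F\<^esub> c \<odot>\<^bsub>F\<^esub> f' = c \<odot>\<^bsub>F\<^esub> (f \<ominus>\<^bsub>F\<^esub> f')"
    using assms by (simp add: sym_eq_F F.smult_diff)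
  then show ?thesis
    using assms ideal_smult by (simp add: sym_eq_F)
qed

lemma sym_eq_neg:
  assumes "sym_eq R f f'"
  shows "sym_eq R (\<ominus>\<^bsub>F\<^esub> f) (\<ominus>\<^bsub>F\<^esub> f')"
proof -
  have "sym_eq R ((\<ominus>\<^bsub>R\<^esub> \<one>\<^bsub>R\<^esub>) \<odot>\<^bsub>F\<^esub> f) ((\<ominus>\<^bsub>R\<^esub> \<one>\<^bsub>R\<^esub>) \<odot>\<^bsub>F\<^esub> f')"
    by (rule sym_eq_smult[OF assms]) simp
  then show ?thesis
    using assms by (simp add: sym_eq_F F.smult_l_minus)
qed

lemma sym_eq_minus:
  "\<lbrakk>sym_eq R f f'; sym_eq R g g'\<rbrakk> \<Longrightarrow> sym_eq R (f \<ominus>\<^bsub>F\<^esub> g) (f' \<ominus>\<^bsub>F\<^esub> g')"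
  unfolding a_minus_def by (intro sym_eq_add sym_eq_neg)

lemma sym_eq_prd:
  assumes "sym_eq R f f'" "sym_eq R g g'"
  shows "sym_eq R (prd F p f g) (prd F p f' g')"
proof -
  have c: "f \<in> carrier F" "f' \<in> carrier F" "g \<in> carrier F" "g' \<in> carrier F"
    using assms by (auto simp: sym_eq_F)
  have "sym_eq R (prd F p f g) (prd F p f' g)"
    using assms ideal(3) c by (simp add: sym_eq_F F.prd_closed flip: F.prd_minus_left)
  moreover have "sym_eq R (prd F p f' g) (prd F p f' g')"
    using assms ideal(2) c by (simp add: sym_eq_F F.prd_closed flip: F.prd_minus_right)
  ultimately show ?thesis by (rule sym_eq_trans)
qed

lemma sym_eq_Dot:
  assumes "f \<in> carrier F" "g \<in> carrier F"
  shows "sym_eq R (prd F Dot f g) (prd F Dot g f)"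
proof -
  have "prd F Dot f g \<ominus>\<^bsub>F\<^esub> prd F Dot g f \<in> symmetry_ideal R"
    unfolding symmetry_ideal_def Let_def F_def[symmetric] using assms by (intro hull_inc) blast
  then show ?thesis
    using assms by (simp add: sym_eq_F F.prd_closed)
qed

text \<open>The sign stands on the left because an exchange of two bracket factors arises in this
  form below. The generator of the ideal is the sum of both orders, so it is multiplied by
  \<open>-1\<close>.\<close>

lemma sym_eq_Bracket:
  assumes "f \<in> carrier F" "g \<in> carrier F"
  shows "sym_eq R (\<ominus>\<^bsub>F\<^esub> prd F Bracket f g) (prd F Bracket g f)"
proof -
  have "prd F Bracket f g \<oplus>\<^bsub>F\<^esub> prd F Bracket g f \<in> symmetry_ideal R"
    unfolding symmetry_ideal_def Let_def F_def[symmetric] using assms by (intro hull_inc) blast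
  then have "(\<ominus>\<^bsub>R\<^esub> \<one>\<^bsub>R\<^esub>) \<odot>\<^bsub>F\<^esub> (prd F Bracket f g \<oplus>\<^bsub>F\<^esub> prd F Bracket g f) \<in> symmetry_ideal R"
    by (intro ideal_smult) simp_all
  then show ?thesis
    using assms
    by (simp add: sym_eq_F F.prd_closed F.smult_l_minus F.M.minus_add a_minus_def)
qed

end


section \<open>The dendriform relations determine a multilinear relation up to symmetry\<close>

primrec pol_op_of :: "pdend_op \<Rightarrow> pol_op" where
  "pol_op_of Star = Dot"
| "pol_op_of Circ = Bracket"

text \<open>The factor \<open>h\<close> at every operation, one half in the application, offsets the
  two terms that a product of first components has in the square algebra.\<close>

primrec repolarize ::
    "('r, 'm) ring_scheme \<Rightarrow> 'r \<Rightarrow> pdend_op monomial \<Rightarrow> ('r, pol_op) relation" where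
  "repolarize R h (Var i) = gen R i"
| "repolarize R h (Op q s t) =
     prd (free_algebra R) (pol_op_of q) (h \<odot>\<^bsub>free_algebra R\<^esub> repolarize R h s) (repolarize R h t)"

text \<open>The operations on the path to the last leaf carry no factor \<open>h\<close>: a monomial of the
  dendriform relation arises there from a single order of the factors, whereas all other products
  are symmetrized.\<close>

primrec repolarize_last ::
    "('r, 'm) ring_scheme \<Rightarrow> 'r \<Rightarrow> pdend_op monomial \<Rightarrow> ('r, pol_op) relation" where
  "repolarize_last R h (Var i) = gen R i"
| "repolarize_last R h (Op q s t) =
     prd (free_algebra R) (pol_op_of q) (repolarize R h s) (repolarize_last R h t)"

section \<open>A left inverse, modulo symmetry, of the dendriform substitution\<close>

context
  fixes R :: "('r, 'm) ring_scheme" and h :: 'r and p :: nat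
    and F :: "('r, ('r, pol_op) relation, pol_op) op_algebra"
    and G :: "('r, ('r, pdend_op) relation, pdend_op) op_algebra"
    and e :: "pol_op monomial \<Rightarrow> ('r, pdend_op) relation \<times> ('r, pdend_op) relation"
    and \<sigma> :: "('r, pdend_op) relation \<Rightarrow> ('r, pol_op) relation"
    and \<tau> :: "('r, pdend_op) relation \<Rightarrow> ('r, pol_op) relation"
  assumes cring: "cring R" and h: "h \<in> carrier R" "h \<oplus>\<^bsub>R\<^esub> h = \<one>\<^bsub>R\<^esub>"
  defines "F \<equiv> free_algebra R" and "G \<equiv> free_algebra R"
    and "e \<equiv> eval_monomial (polarized_square (free_algebra R)) (dend_vars R p)"
    and "\<sigma> \<equiv> lin_ext R (free_algebra R) (repolarize R h)"
    and "\<tau> \<equiv> lin_ext R (free_algebra R) (repolarize_last R h)"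
begin

interpretation F: nonassoc_algebra R F
  unfolding F_def by (rule free_algebra_nonassoc) (rule cring)

interpretation G: nonassoc_algebra R G
  unfolding G_def by (rule free_algebra_nonassoc) (rule cring)

private lemma gen_cl: "gen R i \<in> carrier F"
  unfolding F_def by (rule gen_closed) (rule cring)

private lemma rep_closed: "repolarize R h m \<in> carrier F"
  by (induction m) (auto simp: gen_cl F.prd_closed h simp flip: F_def)

lemma repolarize_last_closed: "repolarize_last R h m \<in> carrier F"
  by (induction m) (auto simp: gen_cl F.prd_closed rep_closed simp flip: F_def)

private lemma lin: "linear_map R G F \<sigma>" "linear_map R G F \<tau>"
  unfolding G_def \<sigma>_def \<tau>_def F_def[symmetric]
  by (rule linear_map_lin_ext[OF F.module_axioms] rep_closed repolarize_last_closed)+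

private lemma lin_mono: "\<sigma> (monom R m) = repolarize R h m" "\<tau> (monom R m) = repolarize_last R h m"
  unfolding \<sigma>_def \<tau>_def F_def[symmetric]
  by (rule lin_ext_mono[OF F.module_axioms] rep_closed repolarize_last_closed)+

text \<open>\<open>\<sigma>\<close> is multiplicative up to \<open>h\<close>, whereas
  \<open>\<tau>\<close> is passed on to the right factor alone, since that factor carries the last
  leaf.\<close>

private lemma lin_prd:
  assumes "f \<in> carrier G" "g \<in> carrier G"
  shows "\<sigma> (prd G q f g) = prd F (pol_op_of q) (h \<odot>\<^bsub>F\<^esub> \<sigma> f) (\<sigma> g)"
    and "\<tau> (prd G q f g) = prd F (pol_op_of q) (\<sigma> f) (\<tau> g)"
proof -
  have h\<sigma>: "linear_map R G F (\<lambda>f. h \<odot>\<^bsub>F\<^esub> \<sigma> f)"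
    using h(1) linear_map_closed[OF lin(1)]
    by (intro linear_mapI)
      (simp_all add: linear_map_add[OF lin(1)] linear_map_smult[OF lin(1)] F.smult_r_distr
        F.R.m_comm flip: F.smult_assoc1)
  show "\<sigma> (prd G q f g) = prd F (pol_op_of q) (h \<odot>\<^bsub>F\<^esub> \<sigma> f) (\<sigma> g)"
    using assms unfolding G_def
    by (rule bilinear_free_eqI[OF cring F.nonassoc_algebra_axioms lin(1)[unfolded G_def]
          h\<sigma>[unfolded G_def] lin(1)[unfolded G_def], rotated])
      (simp add: lin_mono F_def)
  show "\<tau> (prd G q f g) = prd F (pol_op_of q) (\<sigma> f) (\<tau> g)"
    using assms unfolding G_def
    by (rule bilinear_free_eqI[OF cring F.nonassoc_algebra_axioms lin(2)[unfolded G_def]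
          lin(1)[unfolded G_def] lin(2)[unfolded G_def], rotated])
      (simp add: lin_mono F_def)
qed

private lemma e_closed: "fst (e m) \<in> carrier G" "snd (e m) \<in> carrier G"
proof -
  have "e m \<in> carrier (polarized_square G)"
    unfolding e_def G_def
    by (rule nonassoc_algebra.eval_monomial_closed[OF square_free_nonassoc[OF cring]
          dend_vars_closed[OF cring]])
  then show "fst (e m) \<in> carrier G" "snd (e m) \<in> carrier G"
    by auto
qed

private lemma e_Op: "e (Op q s t) = prd (polarized_square G) q (e s) (e t)"
  by (simp add: e_def G_def)

private lemma monom_prd: "monom R (Op q s t) = prd F q (monom R s) (monom R t)"
  by (simp add: F_def prd_mono[OF cring])

private lemma monom_cl: "monom R m \<in> carrier F"
  by (simp add: F_def mono_closed[OF cring])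

lemmas sym_rules = sym_eq_refl[OF cring, folded F_def] sym_eq_trans[OF cring]
  sym_eq_add[OF cring, folded F_def] sym_eq_minus[OF cring, folded F_def]
  sym_eq_smult[OF cring, folded F_def] sym_eq_prd[OF cring, folded F_def]
  sym_eq_Dot[OF cring, folded F_def] sym_eq_Bracket[OF cring, folded F_def]

private lemma halves: "x \<in> carrier F \<Longrightarrow> h \<odot>\<^bsub>F\<^esub> x \<oplus>\<^bsub>F\<^esub> h \<odot>\<^bsub>F\<^esub> x = x"
  using h by (simp flip: F.smult_l_distr)

text \<open>All variables of \<open>m\<close> are replaced by pairs \<open>(x, \<zero>)\<close>, and
  the first component symmetrizes every product. After \<open>\<sigma>\<close> the two terms are
  halves of the same product in both orders, and modulo symmetry these halves add up.\<close>

lemma repolarize_fst: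
  "p \<notin> set (leaves m) \<Longrightarrow> sym_eq R (\<sigma> (fst (e m))) (monom R m)"
proof (induction m)
  case (Var i)
  then have "\<sigma> (fst (e (Var i))) = monom R (Var i)"
    by (auto simp: e_def dend_vars_def gen_eq_mono lin_mono)
  then show ?case
    by (simp add: sym_rules monom_cl)
next
  case (Op q s t)
  let ?s = "monom R s" and ?t = "monom R t"
  have IH: "sym_eq R (\<sigma> (fst (e s))) ?s" "sym_eq R (\<sigma> (fst (e t))) ?t"
    using Op by auto
  have *: "sym_eq R (prd F q (h \<odot>\<^bsub>F\<^esub> \<sigma> (fst (e s))) (\<sigma> (fst (e t)))) (h \<odot>\<^bsub>F\<^esub> prd F q ?s ?t)"
    "sym_eq R (prd F q (h \<odot>\<^bsub>F\<^esub> \<sigma> (fst (e t))) (\<sigma> (fst (e s)))) (h \<odot>\<^bsub>F\<^esub> prd F q ?t ?s)" for q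
    using IH h(1) by (auto simp flip: F.prd_smult_left[OF h(1) monom_cl monom_cl] intro!: sym_rules(5,6))
  show ?case
  proof (cases q)
    case Dot
    have 1: "\<sigma> (fst (e (Op q s t))) = prd F Dot (h \<odot>\<^bsub>F\<^esub> \<sigma> (fst (e s))) (\<sigma> (fst (e t)))
        \<oplus>\<^bsub>F\<^esub> prd F Dot (h \<odot>\<^bsub>F\<^esub> \<sigma> (fst (e t))) (\<sigma> (fst (e s)))"
      by (simp add: Dot e_Op linear_map_add[OF lin(1)] G.prd_closed e_closed lin_prd)
    have 2: "sym_eq R (\<sigma> (fst (e (Op q s t)))) (h \<odot>\<^bsub>F\<^esub> prd F Dot ?s ?t \<oplus>\<^bsub>F\<^esub> h \<odot>\<^bsub>F\<^esub> prd F Dot ?t ?s)"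
      unfolding 1
      by (intro sym_rules(3) *)
    have 3: "sym_eq R (h \<odot>\<^bsub>F\<^esub> prd F Dot ?s ?t \<oplus>\<^bsub>F\<^esub> h \<odot>\<^bsub>F\<^esub> prd F Dot ?t ?s)
        (h \<odot>\<^bsub>F\<^esub> prd F Dot ?s ?t \<oplus>\<^bsub>F\<^esub> h \<odot>\<^bsub>F\<^esub> prd F Dot ?s ?t)"
      by (intro sym_rules(3,5) sym_rules(1) sym_rules(7))
        (simp_all add: h F.prd_closed monom_cl)
    have 4: "h \<odot>\<^bsub>F\<^esub> prd F Dot ?s ?t \<oplus>\<^bsub>F\<^esub> h \<odot>\<^bsub>F\<^esub> prd F Dot ?s ?t = monom R (Op q s t)"
      by (simp add: Dot monom_prd halves F.prd_closed monom_cl)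
    show ?thesis using sym_rules(2)[OF 2 3] unfolding 4 .
  next
    case Bracket
    have 1: "\<sigma> (fst (e (Op q s t))) = prd F Bracket (h \<odot>\<^bsub>F\<^esub> \<sigma> (fst (e s))) (\<sigma> (fst (e t)))
        \<ominus>\<^bsub>F\<^esub> prd F Bracket (h \<odot>\<^bsub>F\<^esub> \<sigma> (fst (e t))) (\<sigma> (fst (e s)))"
      by (simp add: Bracket e_Op linear_map_minus[OF G.module_axioms F.module_axioms lin(1)]
          G.prd_closed e_closed lin_prd)
    have 2: "sym_eq R (\<sigma> (fst (e (Op q s t)))) (h \<odot>\<^bsub>F\<^esub> prd F Bracket ?s ?t \<ominus>\<^bsub>F\<^esub> h \<odot>\<^bsub>F\<^esub> prd F Bracket ?t ?s)"
      unfolding 1 by (intro sym_rules(4) *)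
    \<comment> \<open>Rewriting the difference as a sum lets anticommutativity act on the second
      half.\<close>
    have 5: "h \<odot>\<^bsub>F\<^esub> prd F Bracket ?s ?t \<ominus>\<^bsub>F\<^esub> h \<odot>\<^bsub>F\<^esub> prd F Bracket ?t ?s
        = h \<odot>\<^bsub>F\<^esub> prd F Bracket ?s ?t \<oplus>\<^bsub>F\<^esub> h \<odot>\<^bsub>F\<^esub> (\<ominus>\<^bsub>F\<^esub> prd F Bracket ?t ?s)"
      using h by (simp add: a_minus_def F.smult_r_minus F.prd_closed monom_cl)
    have 3: "sym_eq R (h \<odot>\<^bsub>F\<^esub> prd F Bracket ?s ?t \<oplus>\<^bsub>F\<^esub> h \<odot>\<^bsub>F\<^esub> (\<ominus>\<^bsub>F\<^esub> prd F Bracket ?t ?s))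
        (h \<odot>\<^bsub>F\<^esub> prd F Bracket ?s ?t \<oplus>\<^bsub>F\<^esub> h \<odot>\<^bsub>F\<^esub> prd F Bracket ?s ?t)"
      by (intro sym_rules(3,5) sym_rules(1) sym_rules(8))
        (simp_all add: h F.prd_closed monom_cl)
    have 4: "h \<odot>\<^bsub>F\<^esub> prd F Bracket ?s ?t \<oplus>\<^bsub>F\<^esub> h \<odot>\<^bsub>F\<^esub> prd F Bracket ?s ?t = monom R (Op q s t)"
      by (simp add: Bracket monom_prd halves F.prd_closed monom_cl)
    show ?thesis using sym_rules(2)[OF 2[unfolded 5] 3] unfolding 4 .
  qed
qed

text \<open>When \<open>p\<close> occurs in just one factor of a product, this leaves a single term
  in the second component, the one with that factor on the right.\<close>

private lemma e_zero:
  "p \<in> set (leaves m) \<Longrightarrow> fst (e m) = \<zero>\<^bsub>G\<^esub>"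
  "p \<notin> set (leaves m) \<Longrightarrow> snd (e m) = \<zero>\<^bsub>G\<^esub>"
proof -
  assume "p \<in> set (leaves m)"
  moreover have "fst (dend_vars R p p) = \<zero>\<^bsub>free_algebra R\<^esub>"
    by (simp add: dend_vars_def)
  ultimately show "fst (e m) = \<zero>\<^bsub>G\<^esub>"
    unfolding e_def G_def
    by (rule eval_square_fst_zero[OF free_algebra_nonassoc[OF cring] dend_vars_closed[OF cring]])
next
  assume "p \<notin> set (leaves m)"
  then show "snd (e m) = \<zero>\<^bsub>G\<^esub>"
    unfolding e_def G_def
    by (intro eval_square_snd_zero[OF free_algebra_nonassoc[OF cring] dend_vars_closed[OF cring]])
      (auto simp: dend_vars_def)
qed

text \<open>With distinct leaves, \<open>p\<close> lies in exactly one factor at each operation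
  above it, so the second component has a single term there and nothing is halved along the path to
  \<open>p\<close>. The factors off this path are covered by \<open>repolarize_fst\<close>.\<close>

lemma repolarize_snd:
  "\<lbrakk>distinct (leaves m); p \<in> set (leaves m)\<rbrakk> \<Longrightarrow> sym_eq R (\<tau> (snd (e m))) (monom R m)"
proof (induction m)
  case (Var i)
  then have "\<tau> (snd (e (Var i))) = monom R (Var i)"
    by (auto simp: e_def dend_vars_def gen_eq_mono lin_mono)
  then show ?case
    by (simp add: sym_rules monom_cl)
next
  case (Op q s t)
  let ?s = "monom R s" and ?t = "monom R t"
  note simps = e_Op G.prd_closed e_closed lin_prd G.prd_zero_left G.prd_zero_right monom_prd
    linear_map_closed[OF lin(1)] linear_map_closed[OF lin(2)] F.prd_closed
    linear_map_neg[OF G.module_axioms F.module_axioms lin(2)] G.M.minus_zero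
  consider "p \<in> set (leaves t)" "p \<notin> set (leaves s)" | "p \<in> set (leaves s)" "p \<notin> set (leaves t)"
    using Op.prems by auto
  then show ?case
  proof cases
    case 1
    then have z: "fst (e t) = \<zero>\<^bsub>G\<^esub>" "snd (e s) = \<zero>\<^bsub>G\<^esub>"
      by (simp_all add: e_zero)
    have eq: "\<tau> (snd (e (Op q s t))) = prd F q (\<sigma> (fst (e s))) (\<tau> (snd (e t)))"
      by (cases q) (simp_all add: simps z a_minus_def)
    show ?thesis
      unfolding eq monom_prd using Op 1 by (intro sym_rules(6) repolarize_fst) auto
  next
    \<comment> \<open>Here the surviving term has the factors exchanged, with a minus sign for the
      bracket; symmetry restores the order.\<close>
    case 2
    then have z: "fst (e s) = \<zero>\<^bsub>G\<^esub>" "snd (e t) = \<zero>\<^bsub>G\<^esub>"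
      by (simp_all add: e_zero)
    have IH: "sym_eq R (prd F q (\<sigma> (fst (e t))) (\<tau> (snd (e s)))) (prd F q ?t ?s)"
      using Op 2 by (intro sym_rules(6) repolarize_fst) auto
    show ?thesis
    proof (cases q)
      case Dot
      have eq: "\<tau> (snd (e (Op q s t))) = prd F q (\<sigma> (fst (e t))) (\<tau> (snd (e s)))"
        by (simp add: Dot simps z)
      have comm: "sym_eq R (prd F q ?t ?s) (monom R (Op q s t))"
        unfolding monom_prd Dot by (rule sym_rules(7)[OF monom_cl monom_cl])
      show ?thesis unfolding eq by (rule sym_rules(2)[OF IH comm])
    next
      case Bracket
      have eq: "\<tau> (snd (e (Op q s t))) = \<ominus>\<^bsub>F\<^esub> prd F q (\<sigma> (fst (e t))) (\<tau> (snd (e s)))"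
        by (simp add: Bracket simps z a_minus_def)
      have neg: "sym_eq R (\<tau> (snd (e (Op q s t)))) (\<ominus>\<^bsub>F\<^esub> prd F q ?t ?s)"
        unfolding eq
        using IH by (rule sym_eq_neg[OF cring, folded F_def])
      have comm: "sym_eq R (\<ominus>\<^bsub>F\<^esub> prd F q ?t ?s) (monom R (Op q s t))"
        unfolding monom_prd Bracket by (rule sym_rules(8)[OF monom_cl monom_cl])
      show ?thesis by (rule sym_rules(2)[OF neg comm])
    qed
  qed
qed

lemma repolarize_dend_relation:
  assumes "multilinear R n f" "p \<in> {1..n}" "f \<in> carrier F"
  shows "sym_eq R (\<tau> (dend_relation R p f)) f"
proof -
  have lin': "linear_map R F F (\<lambda>f. \<tau> (dend_relation R p f))"
    using linear_map_comp[OF linear_map_dend_relation[OF cring] lin(2)[unfolded G_def]]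
    unfolding F_def .
  have "\<forall>m. f m \<noteq> \<zero>\<^bsub>R\<^esub> \<longrightarrow> distinct (leaves m) \<and> p \<in> set (leaves m)"
    using assms(1,2) by (simp add: multilinear_def)
  with cring assms(3)[unfolded F_def] show ?thesis
  proof (induction rule: free_algebra_supp_induct)
    case zero
    show ?case
      using linear_map_zero[OF F.module_axioms F.module_axioms lin'] sym_rules(1)[OF F.M.zero_closed]
      by (simp add: F_def)
  next
    case (mono m)
    then show ?case
      using repolarize_snd[of m] by (simp add: dend_relation_mono[OF cring] e_def)
  next
    case (add f g)
    then show ?case
      using linear_map_add[OF lin', of f g] sym_rules(3) by (simp flip: F_def)
  next
    case (smult c f)
    then show ?case
      using linear_map_smult[OF lin', of c f] sym_rules(5) by (simp flip: F_def)
  qed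
qed

end

text \<open>Invertibility of 2 supplies the factor \<open>h\<close> of the left inverse, and this
  shows that \<open>f\<close> is congruent to the image of zero. The dendriform relation for a
  single \<open>p\<close> already determines \<open>f\<close> modulo symmetry.\<close>

lemma dend_relation_eq_zeroD:
  fixes R :: "('r, 'm) ring_scheme"
  assumes "cring R" "\<one>\<^bsub>R\<^esub> \<oplus>\<^bsub>R\<^esub> \<one>\<^bsub>R\<^esub> \<in> Units R"
    and "multilinear R n f" "p \<in> {1..n}" "f \<in> carrier (free_algebra R)"
    and "dend_relation R p f = \<zero>\<^bsub>free_algebra R\<^esub>"
  shows "f \<in> symmetry_ideal R"
proof -
  interpret R: cring R by fact
  let ?F = "free_algebra R :: ('r, ('r, pol_op) relation, pol_op) op_algebra"
  interpret F: module R ?F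
    by (rule free_algebra_module) fact
  obtain h where h: "h \<in> carrier R" "h \<otimes>\<^bsub>R\<^esub> (\<one>\<^bsub>R\<^esub> \<oplus>\<^bsub>R\<^esub> \<one>\<^bsub>R\<^esub>) = \<one>\<^bsub>R\<^esub>"
    using assms(2) unfolding Units_def by blast
  then have hh: "h \<oplus>\<^bsub>R\<^esub> h = \<one>\<^bsub>R\<^esub>"
    by (simp add: R.r_distr)
  have "sym_eq R (lin_ext R ?F (repolarize_last R h) (dend_relation R p f)) f"
    by (rule repolarize_dend_relation[OF assms(1) h(1) hh assms(3-5)])
  moreover have "lin_ext R ?F (repolarize_last R h) (dend_relation R p f) = \<zero>\<^bsub>?F\<^esub>"
    unfolding assms(6)
    by (rule linear_map_zero[OF free_algebra_module[OF assms(1)] F.module_axioms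
          linear_map_lin_ext[OF F.module_axioms]])
      (rule repolarize_last_closed[OF assms(1) h(1) hh])
  ultimately have "sym_eq R \<zero>\<^bsub>?F\<^esub> f" by simp
  then have "\<ominus>\<^bsub>?F\<^esub> f \<in> symmetry_ideal R"
    using assms(5) by (simp add: sym_eq_def a_minus_def)
  then have "\<ominus>\<^bsub>?F\<^esub> (\<ominus>\<^bsub>?F\<^esub> f) \<in> symmetry_ideal R"
    using symmetry_ideal_two_sided[OF assms(1)] F.submoduleE(3)
    unfolding two_sided_ideal_def by blast
  then show ?thesis
    using assms(5) by simp
qed

section \<open>Satisfaction of relations\<close>

lemma (in nonassoc_algebra) submodule_satisfies:
  fixes S :: "('r, 'p) relation set"
  defines "S \<equiv> {f \<in> carrier (free_algebra R). satisfies R A f}"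
  shows "submodule S R (free_algebra R)"
proof -
  interpret F: module R "free_algebra R :: ('r, ('r, 'p) relation, 'p) op_algebra"
    by (rule free_algebra_module) (rule R.is_cring)
  have S: "f \<in> S \<longleftrightarrow> f \<in> carrier (free_algebra R) \<and>
      (\<forall>v. (\<forall>i. v i \<in> carrier A) \<longrightarrow> eval_relation R A v f = \<zero>\<^bsub>A\<^esub>)" for f
    by (auto simp: S_def satisfies_def Pi_iff)
  show ?thesis
    unfolding F.submodule_iff
  proof (intro conjI ballI)
    show "\<zero>\<^bsub>free_algebra R\<^esub> \<in> S"
      using linear_map_zero[OF F.module_axioms module_axioms linear_map_eval] by (auto simp: S)
  next
    fix f g assume "f \<in> S" "g \<in> S"
    then show "f \<oplus>\<^bsub>free_algebra R\<^esub> g \<in> S"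
      by (auto simp: S linear_map_add[OF linear_map_eval])
  next
    fix c f assume "c \<in> carrier R" "f \<in> S"
    then show "c \<odot>\<^bsub>free_algebra R\<^esub> f \<in> S"
      by (auto simp: S linear_map_smult[OF linear_map_eval])
  qed (auto simp: S_def)
qed

lemma (in nonassoc_algebra) satisfies_zero: "satisfies R A \<zero>\<^bsub>free_algebra R\<^esub>"
  and satisfies_add: "\<lbrakk>f \<in> carrier (free_algebra R); g \<in> carrier (free_algebra R);
      satisfies R A f; satisfies R A g\<rbrakk> \<Longrightarrow> satisfies R A (f \<oplus>\<^bsub>free_algebra R\<^esub> g)"
proof -
  interpret F: module R "free_algebra R :: ('r, ('r, 'p) relation, 'p) op_algebra"
    by (rule free_algebra_module) (rule R.is_cring)
  have S: "submodule {f \<in> carrier (free_algebra R). satisfies R A f} R (free_algebra R)"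
    by (rule submodule_satisfies)
  show "satisfies R A \<zero>\<^bsub>free_algebra R\<^esub>"
    and "\<lbrakk>f \<in> carrier (free_algebra R); g \<in> carrier (free_algebra R);
      satisfies R A f; satisfies R A g\<rbrakk> \<Longrightarrow> satisfies R A (f \<oplus>\<^bsub>free_algebra R\<^esub> g)" for f g
    using S unfolding F.submodule_iff by blast+
qed

text \<open>Only finitely many values of \<open>\<kappa>\<close> occur on the support, and the
  relation is the sum of the corresponding parts. The applications take the number of leaves, or
  this number with the last leaf, since an element of a relation space mixes arities and
  distinguished variables.\<close>

lemma (in nonassoc_algebra) satisfies_partition:
  assumes f: "f \<in> carrier (free_algebra R)"
    and parts: "\<And>k. satisfies R A (restr R (\<lambda>m. \<kappa> m = k) f)"
  shows "satisfies R A f"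
proof -
  have *: "satisfies R A (restr R (\<lambda>m. \<kappa> m \<in> K) f)" if "finite K" for K
    using that
  proof (induction K)
    case empty
    have "restr R (\<lambda>m. \<kappa> m \<in> {}) f = \<zero>\<^bsub>free_algebra R\<^esub>"
      by (simp add: restr_def free_algebra_simps)
    then show ?case by (simp add: satisfies_zero)
  next
    case (insert k K)
    have "restr R (\<lambda>m. \<kappa> m \<in> insert k K) f =
        restr R (\<lambda>m. \<kappa> m = k) f \<oplus>\<^bsub>free_algebra R\<^esub> restr R (\<lambda>m. \<kappa> m \<in> K) f"
      using f insert.hyps(2) by (auto simp: restr_def free_algebra_simps fun_eq_iff)
    then show ?case
      using insert.IH parts restr_closed[OF R.is_cring f] by (simp add: satisfies_add)
  qed
  have "finite (\<kappa> ` {m. f m \<noteq> \<zero>\<^bsub>R\<^esub>})"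
    using f by (simp add: free_algebra_simps)
  from *[OF this] show ?thesis
  proof (rule back_subst[of "satisfies R A"])
    show "restr R (\<lambda>m. \<kappa> m \<in> \<kappa> ` {m. f m \<noteq> \<zero>\<^bsub>R\<^esub>}) f = f"
      by (auto simp: restr_def fun_eq_iff)
  qed
qed

section \<open>Evaluation of multilinear relations on generating sets\<close>

lemma eval_monomial_cong:
  "(\<And>i. i \<in> set (leaves m) \<Longrightarrow> v i = w i) \<Longrightarrow> eval_monomial A v m = eval_monomial A w m"
  by (induction m) auto

text \<open>The variable \<open>q\<close> occurs exactly once, so at each product one factor is
  constant in \<open>x\<close> and linearity of the product in the other factor applies.\<close>

lemma (in nonassoc_algebra) linear_map_eval_monomial:
  assumes "distinct (leaves m)" "q \<in> set (leaves m)" and v: "\<And>i. v i \<in> carrier A"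
  shows "linear_map R A A (\<lambda>x. eval_monomial A (v(q := x)) m)"
  using assms(1,2)
proof (induction m)
  case (Var i)
  then show ?case by (simp add: linear_map_def)
next
  case (Op p s t)
  have const: "(\<lambda>x. eval_monomial A (v(q := x)) m) = (\<lambda>x. eval_monomial A v m)"
    if "q \<notin> set (leaves m)" for m
    using that by (intro ext eval_monomial_cong) auto
  note closed = eval_monomial_closed[OF v]
  consider "q \<in> set (leaves s)" "q \<notin> set (leaves t)" | "q \<in> set (leaves t)" "q \<notin> set (leaves s)"
    using Op.prems by auto
  then show ?case
  proof cases
    case 1
    then have "linear_map R A A (\<lambda>x. eval_monomial A (v(q := x)) s)"
      using Op.prems by (intro Op.IH) auto
    from linear_map_comp[OF this linear_map_prd_left[OF closed]] show ?thesis
      by (simp only: eval_monomial.simps fun_cong[OF const[OF 1(2)]])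
  next
    case 2
    then have "linear_map R A A (\<lambda>x. eval_monomial A (v(q := x)) t)"
      using Op.prems by (intro Op.IH) auto
    from linear_map_comp[OF this linear_map_prd_right[OF closed]] show ?thesis
      by (simp only: eval_monomial.simps fun_cong[OF const[OF 2(2)]])
  qed
qed

lemma (in module) linear_map_smult_const: "c \<in> carrier R \<Longrightarrow> linear_map R M M (\<lambda>x. c \<odot>\<^bsub>M\<^esub> x)"
  by (rule linear_mapI) (simp_all add: smult_r_distr R.m_comm flip: smult_assoc1)

lemma (in nonassoc_algebra) eval_relation_add:
  assumes "multilinear R n f" "f \<in> carrier (free_algebra R)" "q \<in> {1..n}"
    and v: "\<And>i. v i \<in> carrier A" and xy: "x \<in> carrier A" "y \<in> carrier A"
  shows "eval_relation R A (v(q := x \<oplus>\<^bsub>A\<^esub> y)) f =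
    eval_relation R A (v(q := x)) f \<oplus>\<^bsub>A\<^esub> eval_relation R A (v(q := y)) f"
proof -
  have "linear_map R A A (\<lambda>x. eval_relation R A (v(q := x)) f)"
    unfolding eval_relation_def
  proof (rule linear_map_finsum[OF module_axioms])
    fix m assume "m \<in> {m. f m \<noteq> \<zero>}"
    then have m: "distinct (leaves m)" "q \<in> set (leaves m)"
      using assms(1,3) by (auto simp: multilinear_def)
    have "f m \<in> carrier R" using assms(2) by (simp add: free_algebra_simps)
    then show "linear_map R A A (\<lambda>x. f m \<odot>\<^bsub>A\<^esub> eval_monomial A (v(q := x)) m)"
      by (rule linear_map_comp[OF linear_map_eval_monomial[OF m v] linear_map_smult_const])
  qed (use assms(2) in \<open>simp add: free_algebra_simps\<close>)
  then show ?thesis using xy by (rule linear_map_add)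
qed

lemma (in nonassoc_algebra) eval_relation_cong:
  assumes "f \<in> carrier (free_algebra R)" "\<And>i. w i \<in> carrier A"
    and "\<And>m. f m \<noteq> \<zero>\<^bsub>R\<^esub> \<Longrightarrow> eval_monomial A v m = eval_monomial A w m"
  shows "eval_relation R A v f = eval_relation R A w f"
  unfolding eval_relation_def
  by (rule M.finsum_cong')
    (use assms eval_monomial_closed[OF assms(2)] in \<open>auto simp: free_algebra_simps\<close>)

text \<open>Additivity in each variable allows the arguments to be replaced by generators one at a
  time. \<open>G\<close> is required to generate by addition alone, as do the pairs with a zero
  component in a square algebra and the homogeneous elements of \<open>gr A\<close>.\<close>

lemma (in nonassoc_algebra) eval_multilinear_spanning:
  assumes f: "f \<in> carrier (free_algebra R)" "multilinear R n f"
    and G: "G \<subseteq> carrier A" "G \<noteq> {}"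
    and span: "\<And>H. \<lbrakk>G \<subseteq> H; \<And>x y. \<lbrakk>x \<in> H; y \<in> H\<rbrakk> \<Longrightarrow> x \<oplus>\<^bsub>A\<^esub> y \<in> H\<rbrakk> \<Longrightarrow> carrier A \<subseteq> H"
    and N: "\<And>x y. \<lbrakk>x \<in> N; y \<in> N\<rbrakk> \<Longrightarrow> x \<oplus>\<^bsub>A\<^esub> y \<in> N"
    and eval: "\<And>v. (\<And>i. v i \<in> G) \<Longrightarrow> eval_relation R A v f \<in> N"
    and v: "\<And>i. v i \<in> carrier A"
  shows "eval_relation R A v f \<in> N"
proof -
  \<comment> \<open>Variables up to \<open>k\<close> range over all of \<open>A\<close>, those from
    \<open>k + 1\<close> to \<open>n\<close> over \<open>G\<close>; the induction step frees
    variable \<open>k + 1\<close>.\<close>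
  have "eval_relation R A v f \<in> N"
    if "k \<le> n" "\<And>i. v i \<in> carrier A" "\<And>i. i \<in> {k<..n} \<Longrightarrow> v i \<in> G" for k v
    using that
  proof (induction k arbitrary: v)
    case 0
    obtain g where "g \<in> G" using G(2) by blast
    \<comment> \<open>Variables outside \<open>{1..n}\<close> do not occur in \<open>f\<close>, but
      \<open>eval\<close> asks for values in \<open>G\<close> everywhere, whence the arbitrary
      generator \<open>g\<close>.\<close>
    define w where "w i = (if i \<in> {1..n} then v i else g)" for i
    have w: "w i \<in> G" for i
      using 0 \<open>g \<in> G\<close> by (auto simp: w_def)
    have "eval_relation R A v f = eval_relation R A w f"
    proof (rule eval_relation_cong[OF f(1)])
      show "w i \<in> carrier A" for i using w G by blast
      show "eval_monomial A v m = eval_monomial A w m" if "f m \<noteq> \<zero>" for m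
        using f(2) that by (intro eval_monomial_cong) (auto simp: w_def multilinear_def)
    qed
    then show ?case using eval[OF w] by simp
  next
    case (Suc k)
    let ?H = "{x \<in> carrier A. eval_relation R A (v(Suc k := x)) f \<in> N}"
    have "carrier A \<subseteq> ?H"
    proof (rule span)
      show "G \<subseteq> ?H"
      proof
        fix x assume x: "x \<in> G"
        then have "eval_relation R A (v(Suc k := x)) f \<in> N"
          using Suc.prems G by (intro Suc.IH) auto
        then show "x \<in> ?H" using x G by auto
      qed
      show "x \<oplus>\<^bsub>A\<^esub> y \<in> ?H" if "x \<in> ?H" "y \<in> ?H" for x y
        using that Suc.prems(1) N eval_relation_add[OF f(2,1), of "Suc k" v x y] Suc.prems(2)
        by simp
    qed
    then have "v (Suc k) \<in> ?H" using Suc.prems(2) by blast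
    then show ?case by simp
  qed
  from this[of n v] v show ?thesis by simp
qed


section \<open>Satisfaction in the square algebra\<close>

text \<open>Pairs with vanishing first component form an ideal in which all products vanish. Two
  variables from it annihilate the monomial, at the latest at the operation where their subtrees
  meet.\<close>

lemma eval_square_snd_zero_two:
  assumes "nonassoc_algebra R B" "\<And>i. w i \<in> carrier (polarized_square B)"
    and "p \<noteq> q" "fst (w p) = \<zero>\<^bsub>B\<^esub>" "fst (w q) = \<zero>\<^bsub>B\<^esub>"
    and "p \<in> set (leaves m)" "q \<in> set (leaves m)"
  shows "snd (eval_monomial (polarized_square B) w m) = \<zero>\<^bsub>B\<^esub>"
  using assms(6,7)
proof (induction m)
  case (Op r s t)
  interpret B: nonassoc_algebra R B by fact
  let ?e = "eval_monomial (polarized_square B) w"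
  have "?e m \<in> carrier (polarized_square B)" for m
    by (rule nonassoc_algebra.eval_monomial_closed[OF polarized_square_nonassoc[OF assms(1)] assms(2)])
  then have cl: "fst (?e m) \<in> carrier B" "snd (?e m) \<in> carrier B" for m
    by (metis mem_Times_iff polarized_square_simps(1))+
  have fz: "fst (?e m) = \<zero>\<^bsub>B\<^esub>" if "p \<in> set (leaves m) \<or> q \<in> set (leaves m)" for m
    using that
  proof
    assume "p \<in> set (leaves m)"
    then show ?thesis by (rule eval_square_fst_zero[OF assms(1,2)]) (rule assms(4))
  next
    assume "q \<in> set (leaves m)"
    then show ?thesis by (rule eval_square_fst_zero[OF assms(1,2)]) (rule assms(5))
  qed
  have *: "snd (?e (Op r s t)) = \<zero>\<^bsub>B\<^esub>"
    if "fst (?e s) = \<zero>\<^bsub>B\<^esub> \<or> snd (?e t) = \<zero>\<^bsub>B\<^esub>" "fst (?e t) = \<zero>\<^bsub>B\<^esub> \<or> snd (?e s) = \<zero>\<^bsub>B\<^esub>"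
    using that
    by (cases r) (auto simp: cl B.prd_zero_left B.prd_zero_right a_minus_def B.M.add.inv_one)
  show ?case
    using Op fz by (intro *) auto
qed (use assms(3) in auto)

text \<open>This is why it suffices to show that the second components vanish.\<close>

lemma eval_square_diagonal:
  "eval_monomial (polarized_square B) (\<lambda>i. (a i, a i)) m =
    (fst (eval_monomial (polarized_square B) (\<lambda>i. (a i, x i)) m),
     fst (eval_monomial (polarized_square B) (\<lambda>i. (a i, x i)) m))"
proof (induction m)
  case (Op p s t)
  then show ?case by (cases p) simp_all
qed simp

lemma satisfies_dend_relation:
  assumes "nonassoc_algebra R B" "f \<in> carrier (free_algebra R)" "satisfies R (polarized_square B) f"
  shows "satisfies R B (dend_relation R p f)"
  unfolding satisfies_def
proof
  interpret B: nonassoc_algebra R B by fact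
  fix v assume v: "v \<in> (UNIV :: nat set) \<rightarrow> carrier B"
  then have "(\<lambda>q. if q = p then (\<zero>\<^bsub>B\<^esub>, v q) else (v q, \<zero>\<^bsub>B\<^esub>)) \<in> UNIV \<rightarrow> carrier (polarized_square B)"
    by (auto simp: Pi_iff)
  moreover have "eval_relation R B v (dend_relation R p f) = snd (eval_relation R (polarized_square B)
      (\<lambda>q. if q = p then (\<zero>\<^bsub>B\<^esub>, v q) else (v q, \<zero>\<^bsub>B\<^esub>)) f)"
    using v by (intro eval_dend_relation[OF assms(1) _ assms(2)]) (auto simp: Pi_iff)
  ultimately show "eval_relation R B v (dend_relation R p f) = \<zero>\<^bsub>B\<^esub>"
    using assms(3) by (simp add: satisfies_def)
qed

text \<open>By multilinearity each variable may be taken from \<open>B \<times> 0\<close> or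
  \<open>0 \<times> B\<close>. With none or at least two from \<open>0 \<times> B\<close> the second
  component vanishes anyway; with exactly one it is the value of a dendriform relation. The first
  component is recovered by evaluating on the diagonal.\<close>

lemma satisfies_square:
  assumes "nonassoc_algebra R B" and f: "f \<in> carrier (free_algebra R)" "multilinear R n f"
    and dend: "\<And>p. p \<in> {1..n} \<Longrightarrow> satisfies R B (dend_relation R p f)"
  shows "satisfies R (polarized_square B) f"
proof -
  interpret B: nonassoc_algebra R B by fact
  let ?S = "polarized_square B"
  interpret S: nonassoc_algebra R ?S by (rule polarized_square_nonassoc) fact
  let ?G = "{(a, x). a \<in> carrier B \<and> x = \<zero>\<^bsub>B\<^esub> \<or> a = \<zero>\<^bsub>B\<^esub> \<and> x \<in> carrier B}"
  have snd0: "snd (eval_relation R ?S v f) = \<zero>\<^bsub>B\<^esub>"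
    if zero: "\<And>m. f m \<noteq> \<zero>\<^bsub>R\<^esub> \<Longrightarrow> snd (eval_monomial ?S v m) = \<zero>\<^bsub>B\<^esub>"
      and v: "\<And>i. v i \<in> carrier ?S" for v
  proof -
    have lin: "linear_map R (free_algebra R) B (\<lambda>f. snd (eval_relation R ?S v f))"
      by (rule linear_map_comp[OF S.linear_map_eval[OF v] linear_map_snd])
    note free = free_algebra_module[OF B.R.is_cring]
    have "\<forall>m. f m \<noteq> \<zero>\<^bsub>R\<^esub> \<longrightarrow> snd (eval_monomial ?S v m) = \<zero>\<^bsub>B\<^esub>" using zero by blast
    with B.R.is_cring f(1) show ?thesis
    proof (induction rule: free_algebra_supp_induct)
      case zero
      show ?case by (rule linear_map_zero[OF free B.module_axioms lin])
    next
      case (mono m)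
      then show ?case by (simp only: S.eval_relation_mono[OF v])
    next
      case (add f g)
      then show ?case by (simp add: linear_map_add[OF lin])
    next
      case (smult c f)
      then show ?case by (simp add: linear_map_smult[OF lin])
    qed
  qed
  have G: "eval_relation R ?S v f \<in> {y. snd y = \<zero>\<^bsub>B\<^esub>}" if v: "\<And>i. v i \<in> ?G" for v
  proof -
    have v': "v i \<in> carrier ?S" for i using v[of i] by auto
    let ?J = "{p \<in> {1..n}. snd (v p) \<noteq> \<zero>\<^bsub>B\<^esub>}"
    have fst0: "fst (v p) = \<zero>\<^bsub>B\<^esub>" if "p \<in> ?J" for p using v[of p] that by auto
    consider "?J = {}" | p where "?J = {p}" | p q where "p \<in> ?J" "q \<in> ?J" "p \<noteq> q" by blast
    then have "snd (eval_relation R ?S v f) = \<zero>\<^bsub>B\<^esub>"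
    proof cases
      case 1
      then show ?thesis
        using f(2) by (intro snd0 v' eval_square_snd_zero[OF assms(1) v']) (auto simp: multilinear_def)
    next
      case (2 p)
      define a where "a q = (if q = p then snd (v q) else fst (v q))" for q
      have a: "a i \<in> carrier B" for i using v'[of i] by (auto simp: a_def)
      have "eval_relation R ?S v f =
          eval_relation R ?S (\<lambda>q. if q = p then (\<zero>\<^bsub>B\<^esub>, a q) else (a q, \<zero>\<^bsub>B\<^esub>)) f"
      proof (rule S.eval_relation_cong[OF f(1)])
        show "(if q = p then (\<zero>\<^bsub>B\<^esub>, a q) else (a q, \<zero>\<^bsub>B\<^esub>)) \<in> carrier ?S" for q
          using a by auto
        show "eval_monomial ?S v m =
            eval_monomial ?S (\<lambda>q. if q = p then (\<zero>\<^bsub>B\<^esub>, a q) else (a q, \<zero>\<^bsub>B\<^esub>)) m" if "f m \<noteq> \<zero>\<^bsub>R\<^esub>" for m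
        proof (rule eval_monomial_cong)
          fix i assume "i \<in> set (leaves m)"
          then have "i \<in> {1..n}" using f(2) that by (auto simp: multilinear_def)
          then have "snd (v i) = \<zero>\<^bsub>B\<^esub>" if "i \<noteq> p" using 2 that by blast
          then show "v i = (if i = p then (\<zero>\<^bsub>B\<^esub>, a i) else (a i, \<zero>\<^bsub>B\<^esub>))"
            using fst0[of p] 2 by (auto simp: a_def prod_eq_iff)
        qed
      qed
      then have "snd (eval_relation R ?S v f) = eval_relation R B a (dend_relation R p f)"
        using eval_dend_relation[OF assms(1) a f(1), where p = p] by simp
      moreover have "p \<in> {1..n}" using 2 by blast
      from dend[OF this] have "eval_relation R B a (dend_relation R p f) = \<zero>\<^bsub>B\<^esub>"
        unfolding satisfies_def by (rule bspec) (use a in auto)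
      ultimately show ?thesis by simp
    next
      case (3 p q)
      then show ?thesis
        using f(2) fst0
        by (intro snd0 v' eval_square_snd_zero_two[OF assms(1) v' 3(3)]) (auto simp: multilinear_def)
    qed
    then show ?thesis by simp
  qed
  have snd: "snd (eval_relation R ?S v f) = \<zero>\<^bsub>B\<^esub>" if v: "\<And>i. v i \<in> carrier ?S" for v
  proof -
    have "eval_relation R ?S v f \<in> {y. snd y = \<zero>\<^bsub>B\<^esub>}"
    proof (rule S.eval_multilinear_spanning[OF f _ _ _ _ G v])
      show "?G \<subseteq> carrier ?S" "?G \<noteq> {}" by auto
      fix H assume H: "?G \<subseteq> H" and add: "\<And>x y. \<lbrakk>x \<in> H; y \<in> H\<rbrakk> \<Longrightarrow> x \<oplus>\<^bsub>?S\<^esub> y \<in> H"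
      show "carrier ?S \<subseteq> H"
      proof
        fix y assume y: "y \<in> carrier ?S"
        then have "(fst y, \<zero>\<^bsub>B\<^esub>) \<in> ?G" "(\<zero>\<^bsub>B\<^esub>, snd y) \<in> ?G"
          by (simp_all add: mem_Times_iff)
        then have "(fst y, \<zero>\<^bsub>B\<^esub>) \<oplus>\<^bsub>?S\<^esub> (\<zero>\<^bsub>B\<^esub>, snd y) \<in> H"
          using H by (intro add) blast+
        then show "y \<in> H" using y by (simp add: mem_Times_iff)
      qed
    qed auto
    then show ?thesis by simp
  qed
  show ?thesis
    unfolding satisfies_def
  proof
    fix v assume "v \<in> (UNIV :: nat set) \<rightarrow> carrier ?S"
    then have v: "v i \<in> carrier ?S" for i by auto
    define a where "a i = fst (v i)" for i
    define w where "w i = (a i, a i)" for i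
    have w: "w i \<in> carrier ?S" for i using v[of i] by (auto simp: w_def a_def)
    have ww: "(\<lambda>i. (a i, a i)) = w" by (simp add: w_def[abs_def])
    have av: "(\<lambda>i. (a i, snd (v i))) = v" by (simp add: a_def)
    have "fst (eval_relation R ?S v f) = snd (eval_relation R ?S w f)"
    proof (rule linear_map_eqI[OF B.R.is_cring B.module_axioms _ _ _ f(1)])
      show "linear_map R (free_algebra R) B (\<lambda>f. fst (eval_relation R ?S v f))"
        "linear_map R (free_algebra R) B (\<lambda>f. snd (eval_relation R ?S w f))"
        by (rule linear_map_comp[OF S.linear_map_eval linear_map_fst, OF v]
            linear_map_comp[OF S.linear_map_eval linear_map_snd, OF w])+
      show "fst (eval_relation R ?S v (monom R m)) = snd (eval_relation R ?S w (monom R m))" for m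
        using eval_square_diagonal[of B a m "\<lambda>i. snd (v i)"]
        by (simp add: S.eval_relation_mono[OF v] S.eval_relation_mono[OF w] av ww)
    qed
    then show "eval_relation R ?S v f = \<zero>\<^bsub>?S\<^esub>"
      using snd[OF v] snd[OF w] by (simp add: prod_eq_iff)
  qed
qed

section \<open>Renaming of variables and spaces of relations\<close>

primrec relabel :: "(nat \<Rightarrow> nat) \<Rightarrow> 'p monomial \<Rightarrow> 'p monomial" where
  "relabel \<pi> (Var i) = Var (\<pi> i)"
| "relabel \<pi> (Op p s t) = Op p (relabel \<pi> s) (relabel \<pi> t)"

lemma leaves_relabel: "leaves (relabel \<pi> m) = map \<pi> (leaves m)"
  by (induction m) auto

lemma eval_monomial_free:
  "cring R \<Longrightarrow> eval_monomial (free_algebra R) (\<lambda>i. gen R (\<pi> i)) m = monom R (relabel \<pi> m)"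
  by (induction m) (simp_all add: gen_eq_mono prd_mono)

lemma linear_map_rename_vars:
  "cring R \<Longrightarrow> linear_map R (free_algebra R) (free_algebra R) (rename_vars R \<pi>)"
  unfolding rename_vars_def[abs_def]
  by (rule nonassoc_algebra.linear_map_eval[OF free_algebra_nonassoc gen_closed])

lemma rename_vars_monom: "cring R \<Longrightarrow> rename_vars R \<pi> (monom R m) = monom R (relabel \<pi> m)"
  unfolding rename_vars_def
  using nonassoc_algebra.eval_relation_mono[OF free_algebra_nonassoc gen_closed]
    eval_monomial_free by metis

lemma multilinear_linear_map:
  assumes "cring R" "linear_map R (free_algebra R) (free_algebra R) \<phi>"
    and "\<And>m m'. \<phi> (monom R m) m' \<noteq> \<zero>\<^bsub>R\<^esub> \<Longrightarrow>
      multilinear_monomial n m = multilinear_monomial n m'"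
    and "f \<in> carrier (free_algebra R)" "multilinear R n f"
  shows "multilinear R n (\<phi> f)"
proof -
  have "\<phi> (restr R (multilinear_monomial n) f) = restr R (multilinear_monomial n) (\<phi> f)"
    using assms(3) by (rule linear_map_restr_commute[OF assms(1,2) _ assms(4)])
  then show ?thesis
    using assms(5) by (simp only: multilinear_iff_restr)
qed

lemma rename_vars_multilinear:
  assumes "cring R" "f \<in> carrier (free_algebra R)" "multilinear R n f" "\<pi> permutes {1..n}"
  shows "multilinear R n (rename_vars R \<pi> f)"
proof (rule multilinear_linear_map[OF assms(1) linear_map_rename_vars[OF assms(1)] _ assms(2,3)])
  fix m m' assume "rename_vars R \<pi> (monom R m) m' \<noteq> \<zero>\<^bsub>R\<^esub>"
  then have m': "m' = relabel \<pi> m"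
    unfolding rename_vars_monom[OF assms(1)] by (simp add: monom_def split: if_splits)
  have inj: "inj \<pi>" using assms(4) by (rule permutes_inj)
  have "\<pi> ` set (leaves m) = {1..n} \<longleftrightarrow> set (leaves m) = {1..n}"
    using permutes_image[OF assms(4)] inj_image_eq_iff[OF inj] by metis
  then show "multilinear_monomial n m = multilinear_monomial n m'"
    using inj by (simp add: m' leaves_relabel distinct_map inj_on_subset[OF inj])
qed

lemma dend_relation_multilinear:
  assumes "cring R" "f \<in> carrier (free_algebra R)" "multilinear R n f"
  shows "multilinear R n (dend_relation R p f)"
proof -
  have "dend_relation R p (restr R (multilinear_monomial n) f) =
      restr R (multilinear_monomial n) (dend_relation R p f)"
    by (rule dend_relation_restr[OF assms(1,2)]) (metis mset_eq_imp_distinct_iff mset_eq_setD)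
  then show ?thesis
    using assms(3) by (simp only: multilinear_iff_restr)
qed

lemma satisfies_rename_vars:
  assumes "nonassoc_algebra R A" "f \<in> carrier (free_algebra R)" "satisfies R A f"
  shows "satisfies R A (rename_vars R \<pi> f)"
  unfolding satisfies_def
proof
  interpret A: nonassoc_algebra R A by fact
  note R = A.R.is_cring
  fix v assume "v \<in> (UNIV :: nat set) \<rightarrow> carrier A"
  then have v: "v i \<in> carrier A" for i by auto
  have "eval_relation R A v (rename_vars R \<pi> f) =
      eval_relation R A (\<lambda>i. eval_relation R A v (gen R (\<pi> i))) f"
    unfolding rename_vars_def
    by (rule algebra_hom_eval_relation[OF free_algebra_nonassoc[OF R] assms(1)
          A.algebra_hom_eval[OF v] gen_closed[OF R] assms(2)])
  also have "\<dots> = \<zero>\<^bsub>A\<^esub>"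
    using assms(3) v by (simp add: satisfies_def A.eval_relation_gen[OF v] Pi_iff)
  finally show "eval_relation R A v (rename_vars R \<pi> f) = \<zero>\<^bsub>A\<^esub>" .
qed

text \<open>Renaming moves the distinguished variable from \<open>p\<close> to
  \<open>\<pi> p\<close>, and injectivity ensures that no other variable is sent there.\<close>

lemma dend_relation_rename_vars:
  fixes R :: "('r, 'm) ring_scheme"
  assumes "cring R" "f \<in> carrier (free_algebra R)" "inj \<pi>"
  shows "dend_relation R (\<pi> p) (rename_vars R \<pi> f) = rename_vars R \<pi> (dend_relation R p f)"
proof -
  let ?F = "free_algebra R :: ('r, ('r, pol_op) relation, pol_op) op_algebra"
  let ?G = "free_algebra R :: ('r, ('r, pdend_op) relation, pdend_op) op_algebra"
  interpret F: nonassoc_algebra R ?F by (rule free_algebra_nonassoc) fact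
  interpret G: nonassoc_algebra R ?G by (rule free_algebra_nonassoc) fact
  interpret S: nonassoc_algebra R "polarized_square ?G"
    by (rule square_free_nonassoc) fact
  note dv = dend_vars_closed[OF assms(1)]
  have "eval_relation R (polarized_square ?G) (dend_vars R (\<pi> p)) (rename_vars R \<pi> f) =
      eval_relation R (polarized_square ?G)
        (\<lambda>i. eval_relation R (polarized_square ?G) (dend_vars R (\<pi> p)) (gen R (\<pi> i))) f"
    unfolding rename_vars_def
    by (rule algebra_hom_eval_relation[OF F.nonassoc_algebra_axioms S.nonassoc_algebra_axioms
          S.algebra_hom_eval[OF dv] gen_closed[OF assms(1)] assms(2)])
  also have "(\<lambda>i. eval_relation R (polarized_square ?G) (dend_vars R (\<pi> p)) (gen R (\<pi> i))) =
      (\<lambda>i. if i = p then (\<zero>\<^bsub>?G\<^esub>, gen R (\<pi> i)) else (gen R (\<pi> i), \<zero>\<^bsub>?G\<^esub>))"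
    using assms(3) by (auto simp: S.eval_relation_gen[OF dv] dend_vars_def inj_eq)
  finally show ?thesis
    unfolding dend_relation_eq[of R "\<pi> p"]
    using eval_dend_relation[OF G.nonassoc_algebra_axioms gen_closed[OF assms(1)] assms(2)]
    by (simp add: rename_vars_def)
qed

section \<open>Spaces of relations and their arity components\<close>

lemma relation_space_base:
  "\<lbrakk>r \<in> S; multilinear R n r; \<pi> permutes {1..n}\<rbrakk> \<Longrightarrow> rename_vars R \<pi> r \<in> relation_space R S"
  unfolding relation_space_def by (rule hull_inc) blast

lemma relation_space_least:
  assumes "submodule H R (free_algebra R)"
    and "\<And>\<pi> r n. \<lbrakk>r \<in> S; multilinear R n r; \<pi> permutes {1..n}\<rbrakk> \<Longrightarrow> rename_vars R \<pi> r \<in> H"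
  shows "relation_space R S \<subseteq> H"
  unfolding relation_space_def using assms by (intro hull_minimal) auto

context
  fixes R :: "('r, 'm) ring_scheme" and F :: "('r, ('r, 'p) relation, 'p) op_algebra"
  assumes cring: "cring R"
  defines "F \<equiv> free_algebra R"
begin

interpretation F: nonassoc_algebra R F
  unfolding F_def by (rule free_algebra_nonassoc) (rule cring)

lemma rename_vars_closed: "r \<in> carrier F \<Longrightarrow> rename_vars R \<pi> r \<in> carrier F"
  unfolding F_def by (rule linear_map_closed[OF linear_map_rename_vars[OF cring]])

lemma submodule_multilinear: "submodule {f \<in> carrier F. multilinear R n f} R F"
proof -
  have lin: "linear_map R F F (restr R (multilinear_monomial n))"
    unfolding F_def by (rule linear_map_restr) (rule cring)
  show ?thesis
    unfolding F.submodule_iff multilinear_iff_restr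
    using linear_map_zero[OF F.module_axioms F.module_axioms lin] linear_map_add[OF lin]
      linear_map_smult[OF lin]
    by (auto simp del: One_nat_def)
qed

text \<open>An \<open>n\<close>-linear monomial has exactly \<open>n\<close> leaves, so the number
  of leaves separates the arities.\<close>

lemma restr_length_multilinear:
  assumes "multilinear R k f"
  shows "restr R (\<lambda>m. length (leaves m) = n) f = (if k = n then f else \<zero>\<^bsub>F\<^esub>)"
proof (cases "k = n")
  case True
  then show ?thesis
    using multilinear_length[OF assms] by (force simp: restr_def)
next
  case False
  then show ?thesis
    using multilinear_length[OF assms] by (force simp: restr_def F_def free_algebra_simps)
qed

lemma linear_map_restr_length: "linear_map R F F (restr R (\<lambda>m. length (leaves m) = n))"
  unfolding F_def by (rule linear_map_restr) (rule cring)

end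

context
  fixes R :: "('r, 'm) ring_scheme" and S :: "('r, 'p) relation set"
    and F :: "('r, ('r, 'p) relation, 'p) op_algebra"
  assumes cring: "cring R" and S: "S \<subseteq> carrier (free_algebra R)"
  defines "F \<equiv> free_algebra R"
begin

interpretation F: nonassoc_algebra R F
  unfolding F_def by (rule free_algebra_nonassoc) (rule cring)

private lemma rename_cl: "r \<in> carrier F \<Longrightarrow> rename_vars R \<pi> r \<in> carrier F"
  unfolding F_def by (rule rename_vars_closed[OF cring])

private lemma multilinear_sub: "submodule {f \<in> carrier F. multilinear R n f} R F"
  unfolding F_def by (rule submodule_multilinear[OF cring])

private lemma restr_length:
  "multilinear R k f \<Longrightarrow>
    restr R (\<lambda>m. length (leaves m) = n) f = (if k = n then f else \<zero>\<^bsub>F\<^esub>)"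
  unfolding F_def by (rule restr_length_multilinear[OF cring])

private lemma restr_length_lin: "linear_map R F F (restr R (\<lambda>m. length (leaves m) = n))"
  unfolding F_def by (rule linear_map_restr_length[OF cring])

lemma submodule_relation_space: "submodule (relation_space R S) R F"
  unfolding relation_space_def F_def[symmetric]
proof (rule F.hull_submodule, rule subsetI)
  fix f assume "f \<in> {rename_vars R \<pi> r |\<pi> r n. r \<in> S \<and> multilinear R n r \<and> \<pi> permutes {1..n}}"
  then obtain \<pi> r where "f = rename_vars R \<pi> r" "r \<in> S" by blast
  moreover from this have "r \<in> carrier F" using S by (auto simp: F_def)
  ultimately show "f \<in> carrier F" by (simp add: rename_cl)
qed

lemma relation_space_closed: "relation_space R S \<subseteq> carrier F"
  using F.submoduleE(1)[OF submodule_relation_space] .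

text \<open>Every generator is multilinear, so the restriction to \<open>n\<close> leaves either
  keeps it or kills it. The component of a given arity thus stays in the space.\<close>

lemma relation_space_restr_length:
  assumes "f \<in> relation_space R S"
  shows "restr R (\<lambda>m. length (leaves m) = n) f \<in> relation_space R S"
    and "multilinear R n (restr R (\<lambda>m. length (leaves m) = n) f)"
proof -
  \<comment> \<open>Intersecting with the \<open>n\<close>-linear relations yields both claims from
    one application of the least submodule property.\<close>
  let ?H = "\<Inter>{relation_space R S, {f \<in> carrier F. multilinear R n f}}"
  have H: "submodule ?H R F"
    using submodule_relation_space multilinear_sub by (intro F.submodule_Inter) auto
  have "relation_space R S \<subseteq> {f \<in> carrier F. restr R (\<lambda>m. length (leaves m) = n) f \<in> ?H}"
  proof (rule relation_space_least)
    show "submodule {f \<in> carrier F. restr R (\<lambda>m. length (leaves m) = n) f \<in> ?H} R (free_algebra R)"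
      unfolding F_def[symmetric]
      by (rule submodule_vimage[OF F.module_axioms F.module_axioms restr_length_lin H])
    fix \<pi> r k assume r: "r \<in> S" "multilinear R k r" "\<pi> permutes {1..k}"
    then have rF: "r \<in> carrier F" using S by (auto simp: F_def)
    have ml: "multilinear R k (rename_vars R \<pi> r)"
      using rename_vars_multilinear[OF cring rF[unfolded F_def] r(2,3)] .
    have "rename_vars R \<pi> r \<in> relation_space R S"
      using r by (rule relation_space_base)
    moreover have "\<zero>\<^bsub>F\<^esub> \<in> ?H" using H by (simp add: F.submodule_iff)
    ultimately have "restr R (\<lambda>m. length (leaves m) = n) (rename_vars R \<pi> r) \<in> ?H"
      using ml rename_cl[OF rF] by (auto simp: restr_length)
    then show "rename_vars R \<pi> r \<in> {f \<in> carrier F. restr R (\<lambda>m. length (leaves m) = n) f \<in> ?H}"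
      using rename_cl[OF rF] by simp
  qed
  with assms have "restr R (\<lambda>m. length (leaves m) = n) f \<in> ?H" by blast
  then show "restr R (\<lambda>m. length (leaves m) = n) f \<in> relation_space R S"
    "multilinear R n (restr R (\<lambda>m. length (leaves m) = n) f)"
    by auto
qed

end

lemma satisfies_relation_space:
  assumes "nonassoc_algebra R A" "S \<subseteq> carrier (free_algebra R)" "\<And>r. r \<in> S \<Longrightarrow> satisfies R A r"
    and "f \<in> relation_space R S"
  shows "satisfies R A f"
proof -
  interpret A: nonassoc_algebra R A by fact
  have "relation_space R S \<subseteq> {f \<in> carrier (free_algebra R). satisfies R A f}"
    using assms(2,3)
    by (intro relation_space_least[OF A.submodule_satisfies])
      (auto intro!: satisfies_rename_vars[OF assms(1)] rename_vars_closed[OF A.R.is_cring])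
  then show ?thesis using assms(4) by blast
qed


section \<open>Polarized relations and their dendriform relations\<close>

lemma linear_map_polarize:
  "cring R \<Longrightarrow> linear_map R (free_algebra R) (free_algebra R) (polarize R)"
  unfolding polarize_def[abs_def] linear_map_depolarize[symmetric]
  by (rule nonassoc_algebra.linear_map_eval[OF depolarize_nonassoc[OF free_algebra_nonassoc]])
    (simp_all add: depolarize_def gen_closed)

text \<open>Evaluation preserves \<open>Dot\<close> and \<open>Bracket\<close>, hence also their
  sum, which is the product of the depolarized algebra.\<close>

lemma eval_polarize:
  assumes "nonassoc_algebra R A" "\<And>i. v i \<in> carrier A" "f \<in> carrier (free_algebra R)"
  shows "eval_relation R A v (polarize R f) = eval_relation R (depolarize A) v f"
proof -
  interpret A: nonassoc_algebra R A by fact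
  note R = A.R.is_cring
  let ?e = "eval_relation R A v"
  have hom: "algebra_hom R (free_algebra R) A ?e"
    by (rule A.algebra_hom_eval) fact
  then have lin: "linear_map R (free_algebra R) A ?e"
    and prd: "\<And>p x y. \<lbrakk>x \<in> carrier (free_algebra R); y \<in> carrier (free_algebra R)\<rbrakk>
      \<Longrightarrow> ?e (prd (free_algebra R) p x y) = prd A p (?e x) (?e y)"
    by (auto simp: algebra_hom_def)
  have "algebra_hom R (depolarize (free_algebra R)) (depolarize A) ?e"
    unfolding algebra_hom_def
  proof (intro conjI allI ballI)
    show "linear_map R (depolarize (free_algebra R)) (depolarize A) ?e"
      using lin by (simp add: linear_map_def depolarize_def)
    fix p x y
    assume "x \<in> carrier (depolarize (free_algebra R))" "y \<in> carrier (depolarize (free_algebra R))"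
    then have xy: "x \<in> carrier (free_algebra R)" "y \<in> carrier (free_algebra R)"
      by (simp_all add: depolarize_def)
    note closed = nonassoc_algebra.prd_closed[OF free_algebra_nonassoc[OF R] xy]
    show "?e (prd (depolarize (free_algebra R)) p x y) = prd (depolarize A) p (?e x) (?e y)"
      by (cases p) (simp add: depolarize_def linear_map_add[OF lin closed closed] prd[OF xy])
  qed
  then have "?e (eval_relation R (depolarize (free_algebra R)) (gen R) f) =
      eval_relation R (depolarize A) (\<lambda>i. ?e (gen R i)) f"
    by (rule algebra_hom_eval_relation[OF depolarize_nonassoc[OF free_algebra_nonassoc[OF R]]
          depolarize_nonassoc[OF assms(1)] _ _ assms(3)])
      (simp add: depolarize_def gen_closed[OF R])
  then show ?thesis
    by (simp add: polarize_def A.eval_relation_gen assms(2))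
qed

text \<open>Below the least weight with a part outside \<open>I\<close> all parts lie in
  \<open>I\<close> and hold by assumption, and above it the premise fails; only the least weight
  carries content. Without \<open>LEAST\<close>, the condition can be checked one component of a
  relation at a time.\<close>

lemma satisfies_lowest_part_iff:
  assumes "\<And>f. f \<in> I \<Longrightarrow> satisfies R A f" "satisfies R A \<zero>\<^bsub>free_algebra R\<^esub>"
  shows "satisfies R A (lowest_part R q I r) \<longleftrightarrow>
    (\<forall>w. (\<forall>v<w. weight_part R q v r \<in> I) \<longrightarrow> satisfies R A (weight_part R q w r))"
    (is "_ \<longleftrightarrow> ?W")
proof (cases "\<exists>w. weight_part R q w r \<notin> I")
  case True
  let ?L = "LEAST w. weight_part R q w r \<notin> I"
  have L: "weight_part R q ?L r \<notin> I" "\<And>v. v < ?L \<Longrightarrow> weight_part R q v r \<in> I"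
    using LeastI_ex[OF True] not_less_Least by blast+
  have "?W \<longleftrightarrow> satisfies R A (weight_part R q ?L r)"
  proof
    assume *: "satisfies R A (weight_part R q ?L r)"
    show ?W
    proof (intro allI impI)
      fix w assume w: "\<forall>v<w. weight_part R q v r \<in> I"
      show "satisfies R A (weight_part R q w r)"
      proof (cases "w = ?L")
        case False
        then have "weight_part R q w r \<in> I"
          using w L by (metis linorder_neqE_nat)
        then show ?thesis by (rule assms(1))
      qed (use * in simp)
    qed
  qed (use L in blast)
  then show ?thesis using True by (simp add: lowest_part_def)
next
  case False
  then show ?thesis using assms by (simp add: lowest_part_def)
qed


section \<open>The relation spaces of the polarized and the polarized dendriform category\<close>

context
  fixes R :: "('r, 'm) ring_scheme" and S :: "('r, one_op) relation set"
    and F :: "('r, ('r, pol_op) relation, pol_op) op_algebra"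
    and G :: "('r, ('r, pdend_op) relation, pdend_op) op_algebra"
  assumes cring: "cring R" and S: "S \<subseteq> carrier (free_algebra R)"
  defines "F \<equiv> free_algebra R" and "G \<equiv> free_algebra R"
begin

interpretation F: nonassoc_algebra R F
  unfolding F_def by (rule free_algebra_nonassoc) (rule cring)

interpretation G: nonassoc_algebra R G
  unfolding G_def by (rule free_algebra_nonassoc) (rule cring)

lemma pol_relations_closed: "pol_relations R S \<subseteq> carrier F"
  unfolding pol_relations_def F_def
  using S linear_map_closed[OF linear_map_polarize[OF cring]] by blast

lemma dend_closed: "f \<in> carrier F \<Longrightarrow> dend_relation R p f \<in> carrier G"
  unfolding F_def G_def by (rule linear_map_closed[OF linear_map_dend_relation[OF cring]])

lemma pol_dend_relations_closed: "pol_dend_relations R S \<subseteq> carrier G"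
  unfolding pol_dend_relations_def using dend_closed pol_relations_closed by blast

text \<open>The dendriform relation at \<open>p\<close> of a renamed relation is the renamed
  dendriform relation at the preimage of \<open>p\<close>. The restriction to \<open>n\<close>
  leaves comes first because \<open>p\<close> has to be one of the variables, and other summands may
  have fewer of them.\<close>

lemma dend_relation_in_relation_space:
  assumes "f \<in> relation_space R (pol_relations R S)" "p \<in> {1..n}"
  shows "dend_relation R p (restr R (\<lambda>m. length (leaves m) = n) f)
    \<in> relation_space R (pol_dend_relations R S)" (is "?\<phi> f \<in> ?H")
proof -
  have H: "submodule ?H R G"
    unfolding G_def using submodule_relation_space[OF cring pol_dend_relations_closed[unfolded G_def]] .
  have lin: "linear_map R F G ?\<phi>"
    unfolding F_def G_def
    by (rule linear_map_comp[OF linear_map_restr[OF cring] linear_map_dend_relation[OF cring]])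
  have "relation_space R (pol_relations R S) \<subseteq> {f \<in> carrier F. ?\<phi> f \<in> ?H}"
  proof (rule relation_space_least)
    show "submodule {f \<in> carrier F. ?\<phi> f \<in> ?H} R (free_algebra R)"
      using submodule_vimage[OF F.module_axioms G.module_axioms lin H] by (simp only: F_def)
    fix \<pi> r k assume r: "r \<in> pol_relations R S" "multilinear R k r" "\<pi> permutes {1..k}"
    then have rF: "r \<in> carrier F" using pol_relations_closed by blast
    have cl: "rename_vars R \<pi> r \<in> carrier F"
      unfolding F_def by (rule rename_vars_closed[OF cring rF[unfolded F_def]])
    have "multilinear R k (rename_vars R \<pi> r)"
      by (rule rename_vars_multilinear[OF cring rF[unfolded F_def] r(2,3)])
    note restr = restr_length_multilinear[OF cring this, of n]
    have "?\<phi> (rename_vars R \<pi> r) \<in> ?H"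
    proof (cases "k = n")
      case True
      obtain q where q: "q \<in> {1..n}" "p = \<pi> q"
        using assms(2) permutes_image[OF r(3)] True by blast
      have "?\<phi> (rename_vars R \<pi> r) = rename_vars R \<pi> (dend_relation R q r)"
        using dend_relation_rename_vars[OF cring rF[unfolded F_def] permutes_inj[OF r(3)]]
        by (simp add: restr True q)
      also have "\<dots> \<in> ?H"
        using r q True dend_relation_multilinear[OF cring rF[unfolded F_def] r(2)]
        by (intro relation_space_base[of _ _ _ n]) (auto simp: pol_dend_relations_def)
      finally show ?thesis .
    next
      case False
      then have "?\<phi> (rename_vars R \<pi> r) = \<zero>\<^bsub>G\<^esub>"
        using linear_map_zero[OF F.module_axioms G.module_axioms lin]
        by (simp add: restr restr_zero F_def)
      then show ?thesis using H by (simp add: G.submodule_iff)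
    qed
    with cl show "rename_vars R \<pi> r \<in> {f \<in> carrier F. ?\<phi> f \<in> ?H}" by simp
  qed
  with assms(1) show ?thesis by blast
qed

lemma restr_last_dend_relation:
  assumes "f \<in> carrier F"
  shows "restr R (\<lambda>m. last (leaves m) = p) (dend_relation R q f) =
    (if p = q then dend_relation R q f else \<zero>\<^bsub>G\<^esub>)"
proof -
  \<comment> \<open>All monomials of \<open>dend_relation R q f\<close> end in \<open>q\<close>, so
    the condition on the last leaf corresponds to the constant condition \<open>p = q\<close> on
    \<open>f\<close>.\<close>
  have "restr R (\<lambda>m. last (leaves m) = p) (dend_relation R q f) =
      dend_relation R q (restr R (\<lambda>m. p = q) f)"
    by (rule dend_relation_restr[OF cring assms[unfolded F_def], symmetric]) auto
  also have "restr R (\<lambda>m. p = q) f = (if p = q then f else \<zero>\<^bsub>F\<^esub>)"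
    by (simp add: restr_def F_def free_algebra_simps)
  finally show ?thesis
    using linear_map_zero[OF F.module_axioms G.module_axioms
        linear_map_dend_relation[OF cring, folded F_def G_def]]
    by (simp split: if_splits)
qed

text \<open>A renamed generator is the dendriform relation of a renamed polarized relation at one
  variable, so it lies entirely in one component. For linear combinations the preimages
  \<open>g\<close> are combined in the same way, because \<open>dend_relation R p\<close> is
  linear.\<close>

lemma relation_space_pol_dend_component:
  assumes "f \<in> relation_space R (pol_dend_relations R S)"
  obtains g where "g \<in> relation_space R (pol_relations R S)" "multilinear R n g"
    "restr R (\<lambda>m. length (leaves m) = n \<and> last (leaves m) = p) f = dend_relation R p g"
proof -
  let ?P = "\<lambda>g. g \<in> relation_space R (pol_relations R S) \<and> multilinear R n g"
  let ?r = "restr R (\<lambda>m. length (leaves m) = n \<and> last (leaves m) = p)"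
  let ?K = "{f \<in> carrier G. \<exists>g. ?P g \<and> ?r f = dend_relation R p g}"
  have Q: "submodule (relation_space R (pol_relations R S)) R F"
    unfolding F_def using submodule_relation_space[OF cring pol_relations_closed[unfolded F_def]] .
  have M: "submodule {f \<in> carrier F. multilinear R n f} R F"
    using submodule_multilinear[OF cring] by (simp only: F_def)
  have Qc: "g \<in> relation_space R (pol_relations R S) \<Longrightarrow> g \<in> carrier F" for g
    using F.submoduleE(1)[OF Q] by blast
  have P: "?P \<zero>\<^bsub>F\<^esub>" "\<And>g h. \<lbrakk>?P g; ?P h\<rbrakk> \<Longrightarrow> ?P (g \<oplus>\<^bsub>F\<^esub> h)"
    "\<And>c g. \<lbrakk>c \<in> carrier R; ?P g\<rbrakk> \<Longrightarrow> ?P (c \<odot>\<^bsub>F\<^esub> g)"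
    using Q M Qc unfolding F.submodule_iff by auto
  have D: "linear_map R F G (dend_relation R p)"
    unfolding F_def G_def by (rule linear_map_dend_relation[OF cring])
  have r: "linear_map R G G ?r"
    unfolding G_def by (rule linear_map_restr[OF cring])
  have ren: "linear_map R G G (rename_vars R \<pi>)" for \<pi>
    unfolding G_def by (rule linear_map_rename_vars[OF cring])
  note zero = linear_map_zero[OF F.module_axioms G.module_axioms D]
    linear_map_zero[OF G.module_axioms G.module_axioms r]
  have "relation_space R (pol_dend_relations R S) \<subseteq> ?K"
  proof (rule relation_space_least)
    have "submodule ?K R G"
      unfolding G.submodule_iff
    proof (intro conjI ballI)
      show "\<zero>\<^bsub>G\<^esub> \<in> ?K" using P(1) zero by (auto intro: exI[of _ "\<zero>\<^bsub>F\<^esub>"])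
    next
      fix x y assume "x \<in> ?K" "y \<in> ?K"
      then obtain g h where "x \<in> carrier G" "y \<in> carrier G" "?P g" "?P h"
        "?r x = dend_relation R p g" "?r y = dend_relation R p h" by blast
      moreover from this have "?r (x \<oplus>\<^bsub>G\<^esub> y) = dend_relation R p (g \<oplus>\<^bsub>F\<^esub> h)"
        using Qc by (simp add: linear_map_add[OF D] linear_map_add[OF r])
      ultimately show "x \<oplus>\<^bsub>G\<^esub> y \<in> ?K" using P(2)[of g h] by auto
    next
      fix c x assume c: "c \<in> carrier R" and "x \<in> ?K"
      then obtain g where "x \<in> carrier G" "?P g" "?r x = dend_relation R p g" by blast
      moreover from this c have "?r (c \<odot>\<^bsub>G\<^esub> x) = dend_relation R p (c \<odot>\<^bsub>F\<^esub> g)"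
        using Qc by (simp add: linear_map_smult[OF D] linear_map_smult[OF r])
      ultimately show "c \<odot>\<^bsub>G\<^esub> x \<in> ?K" using P(3)[of c g] c by auto
    qed auto
    then show "submodule ?K R (free_algebra R)" by (simp only: G_def)
  next
    fix \<pi> d j assume d: "d \<in> pol_dend_relations R S" "multilinear R j d" "\<pi> permutes {1..j}"
    then obtain q s k where s: "d = dend_relation R q s" "s \<in> pol_relations R S" "multilinear R k s"
      "q \<in> {1..k}"
      unfolding pol_dend_relations_def by blast
    have sF: "s \<in> carrier F" using s(2) pol_relations_closed by blast
    have dk: "multilinear R k d"
      unfolding s(1) by (rule dend_relation_multilinear[OF cring sF[unfolded F_def] s(3)])
    have cl: "rename_vars R \<pi> d \<in> carrier G"
      unfolding G_def s(1)
      by (rule rename_vars_closed[OF cring dend_closed[OF sF, unfolded G_def]])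
    have "\<exists>g. ?P g \<and> ?r (rename_vars R \<pi> d) = dend_relation R p g"
    proof (cases "k = j")
      \<comment> \<open>Only the zero relation is multilinear in two different degrees.\<close>
      case False
      then have "d = \<zero>\<^bsub>G\<^esub>"
        using multilinear_length[OF d(2)] multilinear_length[OF dk]
        by (auto simp: G_def free_algebra_simps fun_eq_iff)
      then have "rename_vars R \<pi> d = \<zero>\<^bsub>G\<^esub>"
        using linear_map_zero[OF G.module_axioms G.module_axioms ren] by simp
      then have "?r (rename_vars R \<pi> d) = dend_relation R p \<zero>\<^bsub>F\<^esub>"
        by (simp only: zero)
      then show ?thesis using P(1) by (intro exI[of _ "\<zero>\<^bsub>F\<^esub>"] conjI) simp_all
    next
      case True
      let ?s = "rename_vars R \<pi> s"
      have perm: "\<pi> permutes {1..k}" using d(3) True by simp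
      have sP: "?s \<in> relation_space R (pol_relations R S)" "multilinear R k ?s"
        using relation_space_base[OF s(2,3) perm]
          rename_vars_multilinear[OF cring sF[unfolded F_def] s(3) perm] by auto
      have eq: "rename_vars R \<pi> d = dend_relation R (\<pi> q) ?s"
        unfolding s(1)
        by (rule dend_relation_rename_vars[OF cring sF[unfolded F_def] permutes_inj[OF perm], symmetric])
      have ml: "multilinear R k (rename_vars R \<pi> d)"
        unfolding eq by (rule dend_relation_multilinear[OF cring Qc[OF sP(1), unfolded F_def] sP(2)])
      have "?r (rename_vars R \<pi> d) = restr R (\<lambda>m. last (leaves m) = p)
          (restr R (\<lambda>m. length (leaves m) = n) (rename_vars R \<pi> d))"
        by (simp add: restr_restr conj_commute)
      also have "\<dots> = (if k = n \<and> p = \<pi> q then dend_relation R p ?s else \<zero>\<^bsub>G\<^esub>)"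
        using restr_last_dend_relation[OF Qc[OF sP(1)]]
        by (auto simp: restr_length_multilinear[OF cring ml[unfolded eq]] eq restr_zero G_def)
      finally have "?r (rename_vars R \<pi> d) =
          (if k = n \<and> p = \<pi> q then dend_relation R p ?s else \<zero>\<^bsub>G\<^esub>)" .
      then show ?thesis
        using sP P(1) zero(1) by (cases "k = n \<and> p = \<pi> q") auto
    qed
    with cl show "rename_vars R \<pi> d \<in> ?K" by simp
  qed
  with assms show ?thesis using that by blast
qed

lemma weight_part_dend_relation:
  assumes "f \<in> carrier F"
  shows "weight_part R Circ w (dend_relation R p f) = dend_relation R p (weight_part R Bracket w f)"
  unfolding weight_part_eq_restr
  by (rule dend_relation_restr[OF cring assms[unfolded F_def], symmetric]) simp

lemma weight_part_restr: "weight_part R q w (restr R P f) = restr R P (weight_part R q w f)"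
  by (simp add: weight_part_eq_restr restr_restr conj_commute)

lemma weight_part_closed: "f \<in> carrier (free_algebra R) \<Longrightarrow> weight_part R q w f \<in> carrier (free_algebra R)"
  unfolding weight_part_eq_restr by (rule restr_closed[OF cring])

lemma weight_part_multilinear: "multilinear R n f \<Longrightarrow> multilinear R n (weight_part R q w f)"
  by (auto simp: multilinear_def weight_part_def)

text \<open>Both categories are rewritten as conditions on all weights and compared one component at
  a time. For the polarized conditions, triviality of the low weights is carried to the dendriform
  side because the symmetry ideal is killed there; for the dendriform conditions it is carried back
  because the vanishing of a dendriform relation forces membership in that ideal.\<close>

theorem lowest_pol_dend_category_eq:
  assumes two: "\<one>\<^bsub>R\<^esub> \<oplus>\<^bsub>R\<^esub> \<one>\<^bsub>R\<^esub> \<in> Units R"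
  shows "lowest_pol_dend_category R S = polarized_dendriform R (lowest_pol_category R S)"
proof -
  note rel = relation_space_closed[OF cring pol_relations_closed[unfolded F_def]]
  note dendrel = relation_space_closed[OF cring pol_dend_relations_closed[unfolded G_def]]
  \<comment> \<open>The square of the free algebra is polarized, so the symmetry ideal evaluates to
    zero in it.\<close>
  have dend0: "dend_relation R p f = \<zero>\<^bsub>G\<^esub>" if "f \<in> symmetry_ideal R" for p f
    using eval_symmetry_ideal[OF polarized_square_polarized[OF free_algebra_nonassoc[OF cring]]
        dend_vars_closed[OF cring] that]
    by (simp add: dend_relation_eq G_def)
  have "(\<forall>r\<in>relation_space R (pol_dend_relations R S).
      satisfies R B (lowest_part R Circ {\<zero>\<^bsub>free_algebra R\<^esub>} r)) \<longleftrightarrow>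
    (\<forall>r\<in>relation_space R (pol_relations R S).
      satisfies R (polarized_square B) (lowest_part R Bracket (symmetry_ideal R) r))" (is "?L \<longleftrightarrow> ?R")
    if B: "nonassoc_algebra R B" for B :: "('r, 'a, pdend_op) op_algebra"
  proof -
    interpret B: nonassoc_algebra R B by fact
    let ?S = "polarized_square B"
    interpret S: nonassoc_algebra R ?S by (rule polarized_square_nonassoc) fact
    have "satisfies R B (lowest_part R Circ {\<zero>\<^bsub>free_algebra R\<^esub>} r) \<longleftrightarrow>
        (\<forall>w. (\<forall>v<w. weight_part R Circ v r = \<zero>\<^bsub>G\<^esub>) \<longrightarrow> satisfies R B (weight_part R Circ w r))" for r
      using satisfies_lowest_part_iff[of "{\<zero>\<^bsub>free_algebra R\<^esub>}" R B Circ r] B.satisfies_zero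
      by (simp add: G_def)
    then have L: "?L \<longleftrightarrow> (\<forall>r\<in>relation_space R (pol_dend_relations R S).
        \<forall>w. (\<forall>v<w. weight_part R Circ v r = \<zero>\<^bsub>G\<^esub>) \<longrightarrow> satisfies R B (weight_part R Circ w r))"
      by simp
    have "satisfies R ?S f" if "f \<in> symmetry_ideal R" for f
      using eval_symmetry_ideal[OF polarized_square_polarized[OF B] _ that]
      by (auto simp: satisfies_def Pi_iff)
    then have R: "?R \<longleftrightarrow> (\<forall>r\<in>relation_space R (pol_relations R S).
        \<forall>w. (\<forall>v<w. weight_part R Bracket v r \<in> symmetry_ideal R) \<longrightarrow>
          satisfies R ?S (weight_part R Bracket w r))"
      using satisfies_lowest_part_iff[of "symmetry_ideal R" R ?S Bracket] S.satisfies_zero by simp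
    show ?thesis
      unfolding L R
    proof (intro iffI ballI allI impI)
      fix r w
      assume L: "\<forall>r\<in>relation_space R (pol_dend_relations R S).
          \<forall>w. (\<forall>v<w. weight_part R Circ v r = \<zero>\<^bsub>G\<^esub>) \<longrightarrow> satisfies R B (weight_part R Circ w r)"
        and r: "r \<in> relation_space R (pol_relations R S)"
        and w: "\<forall>v<w. weight_part R Bracket v r \<in> symmetry_ideal R"
      have rc: "r \<in> carrier (free_algebra R)" using r rel by blast
      show "satisfies R ?S (weight_part R Bracket w r)"
      proof (rule S.satisfies_partition[OF weight_part_closed[OF rc]])
        fix n
        let ?r = "restr R (\<lambda>m. length (leaves m) = n)"
        have rr: "?r r \<in> carrier (free_algebra R)" "multilinear R n (?r r)"
          using relation_space_restr_length[OF cring pol_relations_closed[unfolded F_def] r, of n] rel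
          by auto
        have "satisfies R ?S (weight_part R Bracket w (?r r))"
        proof (rule satisfies_square[OF B weight_part_closed[OF rr(1)] weight_part_multilinear[OF rr(2)]])
          fix p assume p: "p \<in> {1..n}"
          have wp: "weight_part R Circ v (dend_relation R p (?r r)) =
              ?r (dend_relation R p (weight_part R Bracket v r))" for v
          proof -
            have "weight_part R Circ v (dend_relation R p (?r r)) =
                dend_relation R p (?r (weight_part R Bracket v r))"
              by (simp only: weight_part_dend_relation[unfolded F_def, OF rr(1)] weight_part_restr)
            also have "\<dots> = ?r (dend_relation R p (weight_part R Bracket v r))"
              by (rule dend_relation_restr[OF cring weight_part_closed[OF rc]]) (metis size_mset)
            finally show ?thesis .
          qed
          have "weight_part R Circ v (dend_relation R p (?r r)) = \<zero>\<^bsub>G\<^esub>" if "v < w" for v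
            using w that by (simp add: wp dend0 G_def restr_zero)
          then have "satisfies R B (weight_part R Circ w (dend_relation R p (?r r)))"
            using L dend_relation_in_relation_space[OF r p] by blast
          then show "satisfies R B (dend_relation R p (weight_part R Bracket w (?r r)))"
            by (simp only: weight_part_dend_relation[unfolded F_def, OF rr(1)])
        qed
        then show "satisfies R ?S (?r (weight_part R Bracket w r))"
          by (simp only: weight_part_restr)
      qed
    next
      fix r w
      assume R: "\<forall>r\<in>relation_space R (pol_relations R S).
          \<forall>w. (\<forall>v<w. weight_part R Bracket v r \<in> symmetry_ideal R) \<longrightarrow>
            satisfies R ?S (weight_part R Bracket w r)"
        and r: "r \<in> relation_space R (pol_dend_relations R S)"
        and w: "\<forall>v<w. weight_part R Circ v r = \<zero>\<^bsub>G\<^esub>"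
      have rc: "r \<in> carrier (free_algebra R)" using r dendrel by blast
      show "satisfies R B (weight_part R Circ w r)"
      \<comment> \<open>Both the arity and the last leaf are split off, since each such component is
        the dendriform relation of a single polarized relation.\<close>
      proof (rule B.satisfies_partition[OF weight_part_closed[OF rc],
            where \<kappa> = "\<lambda>m. (length (leaves m), last (leaves m))"])
        fix k :: "nat \<times> nat"
        obtain n p where k: "k = (n, p)" by force
        let ?r = "restr R (\<lambda>m. length (leaves m) = n \<and> last (leaves m) = p)"
        obtain g where g: "g \<in> relation_space R (pol_relations R S)" "multilinear R n g"
          "?r r = dend_relation R p g"
          using relation_space_pol_dend_component[OF r, of n p] by blast
        have gc: "g \<in> carrier (free_algebra R)" using g(1) rel by blast
        have wp: "?r (weight_part R Circ v r) = dend_relation R p (weight_part R Bracket v g)" for v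
          by (simp only: weight_part_dend_relation[unfolded F_def, OF gc, symmetric]
              weight_part_restr[symmetric] g(3))
        have "satisfies R B (dend_relation R p (weight_part R Bracket w g))"
        proof (cases "p \<in> {1..n}")
          case True
          have "weight_part R Bracket v g \<in> symmetry_ideal R" if "v < w" for v
          proof (rule dend_relation_eq_zeroD[OF cring two weight_part_multilinear[OF g(2)] True
                weight_part_closed[OF gc]])
            show "dend_relation R p (weight_part R Bracket v g) = \<zero>\<^bsub>free_algebra R\<^esub>"
              using w that by (simp add: wp[symmetric] G_def restr_zero)
          qed
          then have "satisfies R ?S (weight_part R Bracket w g)"
            using R g(1) by blast
          then show ?thesis
            by (rule satisfies_dend_relation[OF B weight_part_closed[OF gc]])
        next
          \<comment> \<open>For \<open>p\<close> outside \<open>{1..n}\<close> the component is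
            zero: its monomials would end in \<open>p\<close> and yet have leaves
            \<open>{1..n}\<close>.\<close>
          case False
          have "multilinear R n (dend_relation R p (weight_part R Bracket w g))"
            by (rule dend_relation_multilinear[OF cring weight_part_closed[OF gc]
                  weight_part_multilinear[OF g(2)]])
          note ml = this
          have "?r (weight_part R Circ w r) m = \<zero>\<^bsub>R\<^esub>" for m
          proof (rule ccontr)
            assume ne: "?r (weight_part R Circ w r) m \<noteq> \<zero>\<^bsub>R\<^esub>"
            then have "last (leaves m) = p"
              unfolding restr_def by presburger
            then have "p \<in> set (leaves m)"
              using last_in_set[OF leaves_nonempty] by blast
            moreover have "set (leaves m) = {1..n}"
              using ml ne unfolding wp multilinear_def by blast
            ultimately show False using False by blast
          qed
          then have "?r (weight_part R Circ w r) = \<zero>\<^bsub>G\<^esub>"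
            by (simp only: G_def free_algebra_simps fun_eq_iff) simp
          then show ?thesis
            using B.satisfies_zero by (simp add: wp G_def)
        qed
        then show "satisfies R B (restr R (\<lambda>m. (length (leaves m), last (leaves m)) = k)
            (weight_part R Circ w r))"
          by (simp add: k wp[symmetric])
      qed
    qed
  qed
  then show ?thesis
    unfolding lowest_pol_dend_category_def polarized_dendriform_def lowest_pol_category_def
    using polarized_square_polarized by blast
qed

end

section \<open>Graded products on direct sums\<close>

lemma direct_sum_simps [simp]:
  "carrier (direct_sum Q) =
    {f. (\<forall>i. f i \<in> carrier (Q i)) \<and> finite {i. f i \<noteq> \<zero>\<^bsub>Q i\<^esub>}}"
  "\<zero>\<^bsub>direct_sum Q\<^esub> = (\<lambda>i. \<zero>\<^bsub>Q i\<^esub>)"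
  "f \<oplus>\<^bsub>direct_sum Q\<^esub> g = (\<lambda>i. f i \<oplus>\<^bsub>Q i\<^esub> g i)"
  "c \<odot>\<^bsub>direct_sum Q\<^esub> f = (\<lambda>i. c \<odot>\<^bsub>Q i\<^esub> f i)"
  by (simp_all add: direct_sum_def)

context
  fixes R :: "('r, 'm) ring_scheme" and Q :: "nat \<Rightarrow> ('r, 'b) module"
  assumes Q: "\<And>i. module R (Q i)"
begin

interpretation Q: module R "Q i" for i
  by (rule Q)

lemma direct_sum_module: "module R (direct_sum Q)"
proof (intro moduleI abelian_groupI)
  fix f g assume f: "f \<in> carrier (direct_sum Q)" and g: "g \<in> carrier (direct_sum Q)"
  have "finite {i. f i \<oplus>\<^bsub>Q i\<^esub> g i \<noteq> \<zero>\<^bsub>Q i\<^esub>}"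
    by (rule finite_subset[of _ "{i. f i \<noteq> \<zero>\<^bsub>Q i\<^esub>} \<union> {i. g i \<noteq> \<zero>\<^bsub>Q i\<^esub>}"]) (use f g in auto)
  then show "f \<oplus>\<^bsub>direct_sum Q\<^esub> g \<in> carrier (direct_sum Q)"
    using f g by simp
next
  fix f assume f: "f \<in> carrier (direct_sum Q)"
  have "finite {i. \<ominus>\<^bsub>Q i\<^esub> f i \<noteq> \<zero>\<^bsub>Q i\<^esub>}"
    by (rule finite_subset[of _ "{i. f i \<noteq> \<zero>\<^bsub>Q i\<^esub>}"]) (use f in \<open>auto simp: Q.M.minus_zero\<close>)
  then show "\<exists>g\<in>carrier (direct_sum Q). g \<oplus>\<^bsub>direct_sum Q\<^esub> f = \<zero>\<^bsub>direct_sum Q\<^esub>"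
    using f by (intro bexI[of _ "\<lambda>i. \<ominus>\<^bsub>Q i\<^esub> f i"]) (auto simp: Q.M.l_neg)
next
  fix c f assume c: "c \<in> carrier R" and f: "f \<in> carrier (direct_sum Q)"
  have "finite {i. c \<odot>\<^bsub>Q i\<^esub> f i \<noteq> \<zero>\<^bsub>Q i\<^esub>}"
    by (rule finite_subset[of _ "{i. f i \<noteq> \<zero>\<^bsub>Q i\<^esub>}"]) (use c f in auto)
  then show "c \<odot>\<^bsub>direct_sum Q\<^esub> f \<in> carrier (direct_sum Q)"
    using c f by simp
qed (auto simp: Q.R.is_cring Q.M.a_ac Q.smult_l_distr Q.smult_r_distr Q.smult_assoc1)

section \<open>Bilinear products on a direct sum that lower the degree by \<open>d\<close>\<close>

context
  fixes d :: nat and h :: "nat \<Rightarrow> nat \<Rightarrow> 'b \<Rightarrow> 'b \<Rightarrow> 'b"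
  assumes h_left: "\<And>i j k y. \<lbrakk>i + j = k + d; y \<in> carrier (Q j)\<rbrakk>
      \<Longrightarrow> linear_map R (Q i) (Q k) (\<lambda>x. h i j x y)"
    and h_right: "\<And>i j k x. \<lbrakk>i + j = k + d; x \<in> carrier (Q i)\<rbrakk>
      \<Longrightarrow> linear_map R (Q j) (Q k) (h i j x)"
begin

private lemma h_closed:
  "\<lbrakk>i + j = k + d; x \<in> carrier (Q i); y \<in> carrier (Q j)\<rbrakk> \<Longrightarrow> h i j x y \<in> carrier (Q k)"
  by (rule linear_map_closed[OF h_right])

private lemma h_zero_left:
  "\<lbrakk>i + j = k + d; y \<in> carrier (Q j)\<rbrakk> \<Longrightarrow> h i j \<zero>\<^bsub>Q i\<^esub> y = \<zero>\<^bsub>Q k\<^esub>"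
  by (rule linear_map_zero[OF Q Q h_left])

private lemma h_zero_right:
  "\<lbrakk>i + j = k + d; x \<in> carrier (Q i)\<rbrakk> \<Longrightarrow> h i j x \<zero>\<^bsub>Q j\<^esub> = \<zero>\<^bsub>Q k\<^esub>"
  by (rule linear_map_zero[OF Q Q h_right])

private lemma term_closed:
  "\<lbrakk>f \<in> carrier (direct_sum Q); g \<in> carrier (direct_sum Q); i \<in> {..k + d}\<rbrakk>
    \<Longrightarrow> h i (k + d - i) (f i) (g (k + d - i)) \<in> carrier (Q k)"
  by (intro h_closed) auto

text \<open>If the supports are bounded by \<open>M\<close> and \<open>N\<close>, every term in
  degree \<open>k > M + N\<close> has a zero factor, because its indices add up to
  \<open>k + d\<close>.\<close>

lemma graded_product_closed:
  assumes f: "f \<in> carrier (direct_sum Q)" and g: "g \<in> carrier (direct_sum Q)"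
  shows "graded_product Q d h f g \<in> carrier (direct_sum Q)"
proof -
  obtain M where M: "\<And>i. f i \<noteq> \<zero>\<^bsub>Q i\<^esub> \<Longrightarrow> i \<le> M"
    using f finite_nat_set_iff_bounded_le[of "{i. f i \<noteq> \<zero>\<^bsub>Q i\<^esub>}"] by auto
  obtain N where N: "\<And>i. g i \<noteq> \<zero>\<^bsub>Q i\<^esub> \<Longrightarrow> i \<le> N"
    using g finite_nat_set_iff_bounded_le[of "{i. g i \<noteq> \<zero>\<^bsub>Q i\<^esub>}"] by auto
  have "graded_product Q d h f g k = \<zero>\<^bsub>Q k\<^esub>" if k: "k > M + N" for k
    unfolding graded_product_def
  proof (rule Q.M.add.finprod_one_eqI)
    fix i assume i: "i \<in> {..k + d}"
    consider "f i = \<zero>\<^bsub>Q i\<^esub>" | "g (k + d - i) = \<zero>\<^bsub>Q (k + d - i)\<^esub>"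
      using M[of i] N[of "k + d - i"] k by force
    then show "h i (k + d - i) (f i) (g (k + d - i)) = \<zero>\<^bsub>Q k\<^esub>"
      by cases (use i f g in \<open>auto simp: h_zero_left h_zero_right\<close>)
  qed
  then have "{k. graded_product Q d h f g k \<noteq> \<zero>\<^bsub>Q k\<^esub>} \<subseteq> {..M + N}"
    by (metis (mono_tags, lifting) atMost_iff mem_Collect_eq not_le subsetI)
  then have "finite {k. graded_product Q d h f g k \<noteq> \<zero>\<^bsub>Q k\<^esub>}"
    by (rule finite_subset) simp
  moreover have "graded_product Q d h f g k \<in> carrier (Q k)" for k
    unfolding graded_product_def using term_closed[OF f g] by (intro Q.M.finsum_closed) auto
  ultimately show ?thesis by simp
qed

private lemma linear_map_direct_sumI:
  assumes "\<And>f. f \<in> carrier (direct_sum Q) \<Longrightarrow> \<phi> f \<in> carrier (direct_sum Q)"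
    and "\<And>k. linear_map R (direct_sum Q) (Q k) (\<lambda>f. \<phi> f k)"
  shows "linear_map R (direct_sum Q) (direct_sum Q) \<phi>"
proof (rule linear_mapI)
  fix f g assume "f \<in> carrier (direct_sum Q)" "g \<in> carrier (direct_sum Q)"
  then show "\<phi> (f \<oplus>\<^bsub>direct_sum Q\<^esub> g) = \<phi> f \<oplus>\<^bsub>direct_sum Q\<^esub> \<phi> g"
    using linear_map_add[OF assms(2)] by (auto simp: fun_eq_iff)
next
  fix c f assume "c \<in> carrier R" "f \<in> carrier (direct_sum Q)"
  then show "\<phi> (c \<odot>\<^bsub>direct_sum Q\<^esub> f) = c \<odot>\<^bsub>direct_sum Q\<^esub> \<phi> f"
    using linear_map_smult[OF assms(2)] by (auto simp: fun_eq_iff)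
qed (rule assms(1))

private lemma linear_map_component: "linear_map R (direct_sum Q) (Q i) (\<lambda>f. f i)"
  by (rule linear_mapI) auto

lemma graded_product_linear_left:
  assumes g: "g \<in> carrier (direct_sum Q)"
  shows "linear_map R (direct_sum Q) (direct_sum Q) (\<lambda>f. graded_product Q d h f g)"
proof (rule linear_map_direct_sumI)
  fix k
  show "linear_map R (direct_sum Q) (Q k) (\<lambda>f. graded_product Q d h f g k)"
    unfolding graded_product_def
    by (intro linear_map_finsum Q linear_map_comp[OF linear_map_component h_left]) (use g in auto)
qed (rule graded_product_closed[OF _ g])

lemma graded_product_linear_right:
  assumes f: "f \<in> carrier (direct_sum Q)"
  shows "linear_map R (direct_sum Q) (direct_sum Q) (graded_product Q d h f)"
proof (rule linear_map_direct_sumI)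
  fix k
  show "linear_map R (direct_sum Q) (Q k) (\<lambda>g. graded_product Q d h f g k)"
    unfolding graded_product_def
    by (intro linear_map_finsum Q linear_map_comp[OF linear_map_component h_right]) (use f in auto)
qed (rule graded_product_closed[OF f])

text \<open>Of the terms in degree \<open>k\<close> only \<open>l = i\<close> can have both factors
  nonzero, and then only if the complementary index \<open>k + d - i\<close> is
  \<open>j\<close>.\<close>

lemma graded_product_single:
  assumes x: "x \<in> carrier (Q i)" and y: "y \<in> carrier (Q j)"
  shows "graded_product Q d h (\<lambda>l. if l = i then x else \<zero>\<^bsub>Q l\<^esub>) (\<lambda>l. if l = j then y else \<zero>\<^bsub>Q l\<^esub>) k =
    (if k + d = i + j then h i j x y else \<zero>\<^bsub>Q k\<^esub>)"
    (is "graded_product Q d h ?f ?g k = _")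
proof -
  define t where "t l = h l (k + d - l) (?f l) (?g (k + d - l))" for l
  have fg: "?f l \<in> carrier (Q l)" "?g l \<in> carrier (Q l)" for l
    using x y by auto
  have "t l \<in> carrier (Q k)" if "l \<in> {..k + d}" for l
    unfolding t_def using that fg by (intro h_closed) auto
  then have cl: "t \<in> {..k + d} \<rightarrow> carrier (Q k)" by blast
  have z: "t l = \<zero>\<^bsub>Q k\<^esub>" if "l \<in> {..k + d}" "l \<noteq> i \<or> k + d - l \<noteq> j" for l
    unfolding t_def using that x y fg h_zero_left[of l "k + d - l" k] h_zero_right[of l "k + d - l" k] by auto
  show ?thesis
  proof (cases "k + d = i + j")
    case True
    have "graded_product Q d h ?f ?g k = (\<Oplus>\<^bsub>Q k\<^esub>l\<in>{..k + d}. if i = l then t l else \<zero>\<^bsub>Q k\<^esub>)"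
      unfolding graded_product_def t_def[symmetric]
    proof (rule Q.M.finsum_cong')
      show "t l = (if i = l then t l else \<zero>\<^bsub>Q k\<^esub>)" if "l \<in> {..k + d}" for l
        using z[OF that] by (cases "i = l") simp_all
    qed (use cl in auto)
    also have "\<dots> = t i"
      using True cl by (intro Q.M.finsum_singleton) auto
    also have "\<dots> = h i j x y" using True by (simp add: t_def)
    finally show ?thesis using True by simp
  next
    case False
    have "graded_product Q d h ?f ?g k = \<zero>\<^bsub>Q k\<^esub>"
      unfolding graded_product_def t_def[symmetric]
      by (rule Q.M.add.finprod_one_eqI, rule z) (use False in auto)
    then show ?thesis using False by simp
  qed
qed

end

end

section \<open>The associated graded algebra\<close>

text \<open>Operations on cosets are defined as unions over representatives. Independence of the
  representatives turns such a union into a single coset, once the empty union is excluded.\<close>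

lemma UN_const_eq: "X \<noteq> {} \<Longrightarrow> (\<And>x. x \<in> X \<Longrightarrow> f x = C) \<Longrightarrow> (\<Union>x\<in>X. f x) = C"
  by auto

context filtered_algebra
begin

lemma filt_subset: "filt A F k \<subseteq> carrier A"
  using submoduleE(1)[OF filt_submodule] by (auto simp: filt_def)

lemma filt_sub: "submodule (filt A F k) R A"
  by (simp add: filt_def filt_submodule submodule_zero)

lemma filt_carrier: "a \<in> filt A F k \<Longrightarrow> a \<in> carrier A"
  using filt_subset by blast

lemma filt_zero: "\<zero>\<^bsub>A\<^esub> \<in> filt A F k"
  and filt_add: "\<lbrakk>a \<in> filt A F k; b \<in> filt A F k\<rbrakk> \<Longrightarrow> a \<oplus>\<^bsub>A\<^esub> b \<in> filt A F k"
  and filt_smult: "\<lbrakk>c \<in> carrier R; a \<in> filt A F k\<rbrakk> \<Longrightarrow> c \<odot>\<^bsub>A\<^esub> a \<in> filt A F k"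
  using filt_sub[of k] unfolding submodule_iff by auto

lemma filt_neg: "a \<in> filt A F k \<Longrightarrow> \<ominus>\<^bsub>A\<^esub> a \<in> filt A F k"
  using submoduleE(3)[OF filt_sub] .

lemma filt_nat: "filt A F (int i) = F i"
  by (simp add: filt_def)

lemma filt_neg_index: "k < 0 \<Longrightarrow> filt A F k = {\<zero>\<^bsub>A\<^esub>}"
  by (simp add: filt_def)

lemma filt_mono:
  assumes "j \<le> k"
  shows "filt A F j \<subseteq> filt A F k"
proof (cases "j < 0")
  case True
  then show ?thesis using filt_zero by (simp add: filt_neg_index)
next
  case False
  have "F (nat j) \<subseteq> F (nat k)"
    by (rule lift_Suc_mono_le[of F]) (use filt_increasing assms in auto)
  then show ?thesis using False assms by (simp add: filt_def)
qed

lemma filt_prod: "\<lbrakk>a \<in> filt A F i; b \<in> filt A F j\<rbrakk> \<Longrightarrow> prd A p a b \<in> filt A F (i + j)"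
proof -
  assume a: "a \<in> filt A F i" and b: "b \<in> filt A F j"
  show ?thesis
  proof (cases "i < 0 \<or> j < 0")
    case True
    then have "prd A p a b = \<zero>\<^bsub>A\<^esub>"
      using a b filt_carrier by (auto simp: filt_neg_index prd_zero_left prd_zero_right)
    then show ?thesis by (simp add: filt_zero)
  next
    case False
    then show ?thesis
      using a b filt_prd[of a "nat i" b "nat j" p] by (simp add: filt_def nat_add_distrib)
  qed
qed

text \<open>The class of \<open>a\<close> in degree \<open>k\<close>, thus a coset of the submodule
  of index \<open>k - 1\<close>. The degree is an integer, since lowering products reach negative
  degrees, where the submodule is zero.\<close>

abbreviation gcoset :: "int \<Rightarrow> 'a \<Rightarrow> 'a set" where
  "gcoset k a \<equiv> filt A F (k - 1) +>\<^bsub>A\<^esub> a"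

lemma filt_additive: "abelian_subgroup (filt A F k) A"
  by (rule abelian_subgroupI3)
    (simp_all add: additive_subgroup_def submodule.axioms(1)[OF filt_sub] M.abelian_group_axioms)

lemma gcoset_eq_iff:
  assumes "a \<in> carrier A" "b \<in> carrier A"
  shows "gcoset k a = gcoset k b \<longleftrightarrow> a \<ominus>\<^bsub>A\<^esub> b \<in> filt A F (k - 1)"
proof -
  interpret N: abelian_subgroup "filt A F (k - 1)" A by (rule filt_additive)
  show ?thesis
  proof
    assume "gcoset k a = gcoset k b"
    then have "a \<in> gcoset k b"
      using N.a_rcos_self[OF assms(1)] by simp
    then obtain n where n: "n \<in> filt A F (k - 1)" "a = n \<oplus>\<^bsub>A\<^esub> b"
      unfolding a_r_coset_def' by blast
    have "(n \<oplus>\<^bsub>A\<^esub> b) \<ominus>\<^bsub>A\<^esub> b = n"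
      using assms(2) filt_carrier[OF n(1)] by (simp add: a_minus_def M.a_assoc M.r_neg)
    then show "a \<ominus>\<^bsub>A\<^esub> b \<in> filt A F (k - 1)"
      using n by simp
  next
    assume n: "a \<ominus>\<^bsub>A\<^esub> b \<in> filt A F (k - 1)"
    have eq: "(a \<ominus>\<^bsub>A\<^esub> b) \<oplus>\<^bsub>A\<^esub> b = a"
      using assms by (simp add: a_minus_def M.a_assoc M.l_neg)
    have "(a \<ominus>\<^bsub>A\<^esub> b) \<oplus>\<^bsub>A\<^esub> b \<in> gcoset k b"
      using n unfolding a_r_coset_def' by blast
    then have "a \<in> gcoset k b" by (simp only: eq)
    then show "gcoset k a = gcoset k b"
      by (rule N.a_repr_independence'[OF _ assms(2), symmetric])
  qed
qed

lemma gcoset_add: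
  "\<lbrakk>a \<in> carrier A; b \<in> carrier A\<rbrakk> \<Longrightarrow> gcoset k a <+>\<^bsub>A\<^esub> gcoset k b = gcoset k (a \<oplus>\<^bsub>A\<^esub> b)"
  using abelian_subgroup.a_rcos_sum[OF filt_additive] .

lemma gcoset_zero: "gcoset k \<zero>\<^bsub>A\<^esub> = filt A F (k - 1)"
  using a_coset_add_zero filt_subset .

lemma gcoset_elem: "a \<in> carrier A \<Longrightarrow> x \<in> gcoset k a \<Longrightarrow> \<exists>n\<in>filt A F (k - 1). x = n \<oplus>\<^bsub>A\<^esub> a"
  by (auto simp: a_r_coset_def')

lemma gcoset_self: "a \<in> carrier A \<Longrightarrow> a \<in> gcoset k a"
  using abelian_subgroup.a_rcos_self[OF filt_additive] .

lemma gr_piece_simps: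
  "carrier (gr_piece A F i) = gcoset (int i) ` F i"
  "\<zero>\<^bsub>gr_piece A F i\<^esub> = filt A F (int i - 1)"
  "X \<oplus>\<^bsub>gr_piece A F i\<^esub> Y = X <+>\<^bsub>A\<^esub> Y"
  "c \<odot>\<^bsub>gr_piece A F i\<^esub> X = (\<Union>x\<in>X. gcoset (int i) (c \<odot>\<^bsub>A\<^esub> x))"
  by (simp_all add: gr_piece_def Let_def)

lemma gr_piece_coset:
  assumes "a \<in> carrier A"
  shows "\<zero>\<^bsub>gr_piece A F i\<^esub> = gcoset (int i) \<zero>\<^bsub>A\<^esub>"
    and "b \<in> carrier A \<Longrightarrow>
      gcoset (int i) a \<oplus>\<^bsub>gr_piece A F i\<^esub> gcoset (int i) b = gcoset (int i) (a \<oplus>\<^bsub>A\<^esub> b)"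
    and "c \<in> carrier R \<Longrightarrow> c \<odot>\<^bsub>gr_piece A F i\<^esub> gcoset (int i) a = gcoset (int i) (c \<odot>\<^bsub>A\<^esub> a)"
proof -
  show "\<zero>\<^bsub>gr_piece A F i\<^esub> = gcoset (int i) \<zero>\<^bsub>A\<^esub>"
    by (simp only: gr_piece_simps gcoset_zero)
  show "gcoset (int i) a \<oplus>\<^bsub>gr_piece A F i\<^esub> gcoset (int i) b = gcoset (int i) (a \<oplus>\<^bsub>A\<^esub> b)"
    if "b \<in> carrier A"
    using gcoset_add[OF assms that] by (simp only: gr_piece_simps)
  show "c \<odot>\<^bsub>gr_piece A F i\<^esub> gcoset (int i) a = gcoset (int i) (c \<odot>\<^bsub>A\<^esub> a)" if c: "c \<in> carrier R"
    unfolding gr_piece_simps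
  proof (rule UN_const_eq)
    show "gcoset (int i) a \<noteq> {}" using gcoset_self[OF assms] by blast
    fix x assume "x \<in> gcoset (int i) a"
    then obtain n where n: "n \<in> filt A F (int i - 1)" "x = n \<oplus>\<^bsub>A\<^esub> a"
      using gcoset_elem[OF assms] by blast
    have nc: "n \<in> carrier A" using n(1) by (rule filt_carrier)
    have "c \<odot>\<^bsub>A\<^esub> x \<ominus>\<^bsub>A\<^esub> c \<odot>\<^bsub>A\<^esub> a = c \<odot>\<^bsub>A\<^esub> n"
      using c nc assms by (simp add: n(2) smult_r_distr a_minus_def M.a_assoc M.r_neg)
    then show "gcoset (int i) (c \<odot>\<^bsub>A\<^esub> x) = gcoset (int i) (c \<odot>\<^bsub>A\<^esub> a)"
      using c nc assms n by (subst gcoset_eq_iff) (auto intro: filt_smult)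
  qed
qed

lemma gr_piece_carrierE:
  assumes "X \<in> carrier (gr_piece A F i)"
  obtains a where "a \<in> F i" "a \<in> carrier A" "X = gcoset (int i) a"
  using assms filt_carrier[of _ "int i"] by (auto simp: gr_piece_simps filt_nat)

lemma gr_piece_carrierI: "a \<in> F i \<Longrightarrow> gcoset (int i) a \<in> carrier (gr_piece A F i)"
  by (auto simp: gr_piece_simps)

lemma gr_piece_module: "module R (gr_piece A F i)"
proof -
  have cl: "a \<in> F i \<Longrightarrow> a \<in> carrier A" for a
    using filt_carrier[of _ "int i"] by (simp add: filt_nat)
  note closed = filt_add[of _ "int i", unfolded filt_nat] filt_smult[of _ _ "int i", unfolded filt_nat]
    filt_neg[of _ "int i", unfolded filt_nat] filt_zero[of "int i", unfolded filt_nat]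
  show ?thesis
  proof (intro moduleI abelian_groupI)
    fix X assume "X \<in> carrier (gr_piece A F i)"
    then obtain a where a: "a \<in> F i" "a \<in> carrier A" "X = gcoset (int i) a"
      by (rule gr_piece_carrierE)
    show "\<exists>Y\<in>carrier (gr_piece A F i). Y \<oplus>\<^bsub>gr_piece A F i\<^esub> X = \<zero>\<^bsub>gr_piece A F i\<^esub>"
      using a by (intro bexI[of _ "gcoset (int i) (\<ominus>\<^bsub>A\<^esub> a)"])
        (simp_all add: gr_piece_coset M.l_neg gr_piece_carrierI closed)
  qed (auto elim!: gr_piece_carrierE
      simp: R.is_cring gr_piece_coset[OF M.zero_closed] gr_piece_coset gr_piece_carrierI closed cl
        M.a_ac smult_l_distr smult_r_distr smult_assoc1)
qed

text \<open>One notion for both products of \<open>gr A\<close>: the dendriform products have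
  \<open>d = 0\<close>, the difference of \<open>a \<succ> b\<close> and \<open>b \<prec> a\<close>
  has \<open>d = 1\<close>.\<close>

definition lowering :: "nat \<Rightarrow> ('a \<Rightarrow> 'a \<Rightarrow> 'a) \<Rightarrow> bool" where
  "lowering d \<mu> \<longleftrightarrow>
     (\<forall>b\<in>carrier A. linear_map R A A (\<lambda>a. \<mu> a b)) \<and> (\<forall>a\<in>carrier A. linear_map R A A (\<mu> a)) \<and>
     (\<forall>i j. \<forall>a\<in>filt A F i. \<forall>b\<in>filt A F j. \<mu> a b \<in> filt A F (i + j - int d))"

definition coset_prd :: "nat \<Rightarrow> ('a \<Rightarrow> 'a \<Rightarrow> 'a) \<Rightarrow> nat \<Rightarrow> nat \<Rightarrow> 'a set \<Rightarrow> 'a set \<Rightarrow> 'a set" where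
  "coset_prd d \<mu> i j X Y = (\<Union>a\<in>X. \<Union>b\<in>Y. gcoset (int i + int j - int d) (\<mu> a b))"

text \<open>For negative \<open>k\<close> no index matches and the result is the zero of
  \<open>gr A\<close>. This spares case distinctions when a product drops below degree 0.\<close>

definition homog :: "int \<Rightarrow> 'a \<Rightarrow> nat \<Rightarrow> 'a set" where
  "homog k a = (\<lambda>l. if int l = k then gcoset k a else filt A F (int l - 1))"

abbreviation gr :: "('r, nat \<Rightarrow> 'a set) module" where
  "gr \<equiv> direct_sum (gr_piece A F)"

lemma gr_module: "module R gr"
  by (rule direct_sum_module) (rule gr_piece_module)

lemma gr_zero: "\<zero>\<^bsub>gr\<^esub> = (\<lambda>l. filt A F (int l - 1))"
  by (simp add: gr_piece_simps)

lemma homog_closed: "a \<in> filt A F k \<Longrightarrow> homog k a \<in> carrier gr"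
proof -
  assume a: "a \<in> filt A F k"
  interpret Q: module R "gr_piece A F i" for i by (rule gr_piece_module)
  have "homog k a l \<in> carrier (gr_piece A F l)" for l
    using a gr_piece_carrierI[of a l] Q.M.zero_closed[of l]
    by (auto simp: homog_def gr_piece_simps(2) filt_nat)
  moreover have "{l. homog k a l \<noteq> \<zero>\<^bsub>gr_piece A F l\<^esub>} \<subseteq> {nat k}"
    by (auto simp: homog_def gr_piece_simps(2) split: if_splits)
  then have "finite {l. homog k a l \<noteq> \<zero>\<^bsub>gr_piece A F l\<^esub>}"
    by (rule finite_subset) simp
  ultimately show ?thesis by simp
qed

lemma homog_add:
  "\<lbrakk>a \<in> filt A F k; b \<in> filt A F k\<rbrakk> \<Longrightarrow> homog k a \<oplus>\<^bsub>gr\<^esub> homog k b = homog k (a \<oplus>\<^bsub>A\<^esub> b)"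
proof
  assume ab: "a \<in> filt A F k" "b \<in> filt A F k"
  fix l
  interpret Q: module R "gr_piece A F l" by (rule gr_piece_module)
  show "(homog k a \<oplus>\<^bsub>gr\<^esub> homog k b) l = homog k (a \<oplus>\<^bsub>A\<^esub> b) l"
  proof (cases "int l = k")
    case True
    then show ?thesis
      using gr_piece_coset(2)[of a b l] ab filt_carrier by (auto simp: homog_def)
  next
    case False
    then show ?thesis
      using Q.M.l_zero[OF Q.M.zero_closed] by (simp add: homog_def gr_piece_simps(2))
  qed
qed

lemma homog_smult:
  assumes "c \<in> carrier R" "a \<in> filt A F k"
  shows "c \<odot>\<^bsub>gr\<^esub> homog k a = homog k (c \<odot>\<^bsub>A\<^esub> a)"
proof
  fix l
  interpret Q: module R "gr_piece A F l" by (rule gr_piece_module)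
  show "(c \<odot>\<^bsub>gr\<^esub> homog k a) l = homog k (c \<odot>\<^bsub>A\<^esub> a) l"
    using assms gr_piece_coset(3)[of a c l] Q.smult_r_null[of c] filt_carrier
    by (auto simp: homog_def gr_piece_simps(2))
qed

lemma homog_eq:
  "\<lbrakk>a \<in> filt A F k; b \<in> filt A F k; a \<ominus>\<^bsub>A\<^esub> b \<in> filt A F (k - 1)\<rbrakk> \<Longrightarrow> homog k a = homog k b"
proof -
  assume "a \<in> filt A F k" "b \<in> filt A F k" "a \<ominus>\<^bsub>A\<^esub> b \<in> filt A F (k - 1)"
  then have "gcoset k a = gcoset k b"
    using filt_carrier by (simp add: gcoset_eq_iff)
  then show ?thesis by (simp only: homog_def)
qed

lemma homog_zero:
  assumes "a \<in> filt A F (k - 1)"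
  shows "homog k a = \<zero>\<^bsub>gr\<^esub>"
proof -
  have "gcoset k a = gcoset k \<zero>\<^bsub>A\<^esub>"
    using assms filt_carrier by (simp add: gcoset_eq_iff a_minus_def M.minus_zero)
  then have eq: "gcoset k a = filt A F (k - 1)"
    by (simp only: gcoset_zero)
  show ?thesis
    unfolding gr_zero homog_def eq by (intro ext) (simp split: if_split)
qed

text \<open>Splitting off one graded component at a time reduces the support. Scalars do not appear,
  since a multiple of a homogeneous element is again homogeneous.\<close>

lemma gr_spanned:
  assumes "\<And>k a. a \<in> filt A F k \<Longrightarrow> homog k a \<in> H"
    and add: "\<And>x y. \<lbrakk>x \<in> H; y \<in> H\<rbrakk> \<Longrightarrow> x \<oplus>\<^bsub>gr\<^esub> y \<in> H"
  shows "carrier gr \<subseteq> H"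
proof
  interpret Q: module R "gr_piece A F i" for i by (rule gr_piece_module)
  have "f \<in> H" if "finite K" "f \<in> carrier gr" "{l. f l \<noteq> \<zero>\<^bsub>gr_piece A F l\<^esub>} \<subseteq> K" for K f
    using that
  proof (induction K arbitrary: f)
    case empty
    \<comment> \<open>Zero has to be produced as a homogeneous element, as \<open>H\<close> is only
      closed under addition.\<close>
    then have "f = homog 0 \<zero>\<^bsub>A\<^esub>"
      using homog_zero[OF filt_zero, of 0] by (auto simp: fun_eq_iff)
    then show ?case using assms(1)[OF filt_zero] by simp
  next
    case (insert k K)
    have "f k \<in> carrier (gr_piece A F k)" using insert.prems(1) by simp
    then obtain a where a: "a \<in> F k" "f k = gcoset (int k) a"
      by (rule gr_piece_carrierE)
    define g where "g l = (if l = k then \<zero>\<^bsub>gr_piece A F l\<^esub> else f l)" for l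
    have "{l. g l \<noteq> \<zero>\<^bsub>gr_piece A F l\<^esub>} \<subseteq> {l. f l \<noteq> \<zero>\<^bsub>gr_piece A F l\<^esub>}"
      by (auto simp: g_def)
    then have fin: "finite {l. g l \<noteq> \<zero>\<^bsub>gr_piece A F l\<^esub>}"
      using insert.prems(1) by (auto intro: finite_subset)
    have gc: "g l \<in> carrier (gr_piece A F l)" for l
      using insert.prems(1) Q.M.zero_closed[of l] by (simp add: g_def)
    have "g \<in> H"
      using insert.prems fin gc by (intro insert.IH) (auto simp: g_def)
    moreover have "homog (int k) a \<in> H"
      using a by (intro assms(1)) (simp add: filt_nat)
    ultimately have "homog (int k) a \<oplus>\<^bsub>gr\<^esub> g \<in> H" by (intro add)
    moreover have "homog (int k) a \<oplus>\<^bsub>gr\<^esub> g = f"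
    proof
      fix l
      show "(homog (int k) a \<oplus>\<^bsub>gr\<^esub> g) l = f l"
      proof (cases "l = k")
        case True
        have "f k \<in> carrier (gr_piece A F k)" using insert.prems(1) by simp
        then show ?thesis
          using Q.M.r_zero[of "f k" k] a(2) True by (simp add: homog_def g_def)
      next
        case False
        have "f l \<in> carrier (gr_piece A F l)" using insert.prems(1) by simp
        then show ?thesis
          using Q.M.l_zero[of "f l" l] False by (simp add: homog_def g_def gr_piece_simps(2))
      qed
    qed
    ultimately show ?case by simp
  qed
  then show "f \<in> H" if "f \<in> carrier gr" for f
    using that by (auto intro: that)
qed

context
  fixes d :: nat and \<mu> :: "'a \<Rightarrow> 'a \<Rightarrow> 'a"
  assumes \<mu>: "lowering d \<mu>"
begin

private lemma \<mu>_lin: "b \<in> carrier A \<Longrightarrow> linear_map R A A (\<lambda>a. \<mu> a b)"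
    "a \<in> carrier A \<Longrightarrow> linear_map R A A (\<mu> a)"
  and \<mu>_filt: "\<lbrakk>a \<in> filt A F i; b \<in> filt A F j\<rbrakk> \<Longrightarrow> \<mu> a b \<in> filt A F (i + j - int d)"
  using \<mu> unfolding lowering_def by auto

private lemma \<mu>_closed: "\<lbrakk>a \<in> carrier A; b \<in> carrier A\<rbrakk> \<Longrightarrow> \<mu> a b \<in> carrier A"
  using linear_map_closed[OF \<mu>_lin(2)] .

text \<open>Replacing \<open>a\<close> and \<open>b\<close> by \<open>m + a\<close> and
  \<open>y = n + b\<close> changes the product by \<open>\<mu> m y + \<mu> a n\<close>. Both terms
  lie one filtration step lower, since \<open>m\<close> and \<open>n\<close> do.\<close>

lemma coset_prd_cos:
  assumes a: "a \<in> F i" and b: "b \<in> F j"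
  shows "coset_prd d \<mu> i j (gcoset (int i) a) (gcoset (int j) b) = gcoset (int i + int j - int d) (\<mu> a b)"
  unfolding coset_prd_def
proof (intro UN_const_eq)
  have c: "a \<in> carrier A" "b \<in> carrier A"
    using a b filt_carrier[of _ "int i"] filt_carrier[of _ "int j"] by (simp_all add: filt_nat)
  show "gcoset (int i) a \<noteq> {}" "gcoset (int j) b \<noteq> {}" using gcoset_self c by blast+
  fix x y assume "x \<in> gcoset (int i) a" "y \<in> gcoset (int j) b"
  then obtain m n where mn: "m \<in> filt A F (int i - 1)" "n \<in> filt A F (int j - 1)"
    and xy: "x = m \<oplus>\<^bsub>A\<^esub> a" "y = n \<oplus>\<^bsub>A\<^esub> b"
    using gcoset_elem c by blast
  have mnc: "m \<in> carrier A" "n \<in> carrier A" using mn filt_carrier by blast+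
  have "n \<in> filt A F (int j)" "b \<in> filt A F (int j)"
    using mn(2) b filt_mono[of "int j - 1" "int j"] by (auto simp: filt_nat)
  then have y: "y \<in> filt A F (int j)" "y \<in> carrier A"
    unfolding xy using mnc c by (simp_all add: filt_add)
  have "\<mu> x y = \<mu> m y \<oplus>\<^bsub>A\<^esub> \<mu> a y"
    unfolding xy(1) by (rule linear_map_add[OF \<mu>_lin(1)]) fact+
  moreover have "\<mu> a y = \<mu> a n \<oplus>\<^bsub>A\<^esub> \<mu> a b"
    unfolding xy(2) by (rule linear_map_add[OF \<mu>_lin(2)]) fact+
  ultimately have "\<mu> x y \<ominus>\<^bsub>A\<^esub> \<mu> a b = \<mu> m y \<oplus>\<^bsub>A\<^esub> \<mu> a n"
    using mnc c y by (simp add: a_minus_def M.a_assoc M.r_neg \<mu>_closed)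
  moreover have "\<mu> m y \<in> filt A F (int i + int j - int d - 1)"
    using \<mu>_filt[OF mn(1) y(1)] by (simp add: algebra_simps)
  moreover have "\<mu> a n \<in> filt A F (int i + int j - int d - 1)"
    using \<mu>_filt[of a "int i" n "int j - 1"] a mn(2) by (simp add: algebra_simps filt_nat)
  ultimately show "gcoset (int i + int j - int d) (\<mu> x y) = gcoset (int i + int j - int d) (\<mu> a b)"
    using xy mnc c by (subst gcoset_eq_iff) (auto intro: filt_add \<mu>_closed)
qed

private lemma coset_prd_piece:
  assumes "i + j = k + d" "a \<in> F i" "b \<in> F j"
  shows "coset_prd d \<mu> i j (gcoset (int i) a) (gcoset (int j) b) = gcoset (int k) (\<mu> a b)"
    and "\<mu> a b \<in> F k"
proof -
  have "int i + int j - int d = int k" using assms(1) by linarith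
  then show "coset_prd d \<mu> i j (gcoset (int i) a) (gcoset (int j) b) = gcoset (int k) (\<mu> a b)"
    "\<mu> a b \<in> F k"
    using coset_prd_cos[OF assms(2,3)] \<mu>_filt[of a "int i" b "int j"] assms(2,3)
    by (simp_all add: filt_nat)
qed

lemma coset_prd_linear:
  assumes ijk: "i + j = k + d"
  shows "y \<in> carrier (gr_piece A F j) \<Longrightarrow>
      linear_map R (gr_piece A F i) (gr_piece A F k) (\<lambda>x. coset_prd d \<mu> i j x y)"
    and "x \<in> carrier (gr_piece A F i) \<Longrightarrow>
      linear_map R (gr_piece A F j) (gr_piece A F k) (coset_prd d \<mu> i j x)"
proof -
  note closed = filt_add[of _ "int l" for l, unfolded filt_nat]
    filt_smult[of _ _ "int l" for l, unfolded filt_nat]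
  note simps = coset_prd_piece[OF ijk] gr_piece_coset closed \<mu>_closed gr_piece_carrierI
    linear_map_add[OF \<mu>_lin(1)] linear_map_add[OF \<mu>_lin(2)]
    linear_map_smult[OF \<mu>_lin(1)] linear_map_smult[OF \<mu>_lin(2)]
  show "y \<in> carrier (gr_piece A F j) \<Longrightarrow>
      linear_map R (gr_piece A F i) (gr_piece A F k) (\<lambda>x. coset_prd d \<mu> i j x y)"
    by (rule linear_mapI; elim gr_piece_carrierE; simp add: simps)
  show "x \<in> carrier (gr_piece A F i) \<Longrightarrow>
      linear_map R (gr_piece A F j) (gr_piece A F k) (coset_prd d \<mu> i j x)"
    by (rule linear_mapI; elim gr_piece_carrierE; simp add: simps)
qed

abbreviation gr_prd :: "(nat \<Rightarrow> 'a set) \<Rightarrow> (nat \<Rightarrow> 'a set) \<Rightarrow> nat \<Rightarrow> 'a set" where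
  "gr_prd \<equiv> graded_product (gr_piece A F) d (coset_prd d \<mu>)"

lemma gr_prd_linear:
  shows "g \<in> carrier gr \<Longrightarrow> linear_map R gr gr (\<lambda>f. gr_prd f g)"
    and "f \<in> carrier gr \<Longrightarrow> linear_map R gr gr (gr_prd f)"
  by (rule graded_product_linear_left graded_product_linear_right;
      (assumption | rule gr_piece_module coset_prd_linear)+)+

text \<open>The only possibly nonzero component is the product of the two cosets. An element of
  negative degree is zero, and then both sides vanish.\<close>

lemma gr_prd_homog:
  assumes a: "a \<in> filt A F i" and b: "b \<in> filt A F j"
  shows "gr_prd (homog i a) (homog j b) =
    homog (i + j - int d) (\<mu> a b)"
proof (cases "i < 0 \<or> j < 0")
  case True
  note c = filt_carrier[OF a] filt_carrier[OF b]
  have z: "gr_prd \<zero>\<^bsub>gr\<^esub> (homog j b) = \<zero>\<^bsub>gr\<^esub>" "gr_prd (homog i a) \<zero>\<^bsub>gr\<^esub> = \<zero>\<^bsub>gr\<^esub>"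
    by (rule linear_map_zero[OF gr_module gr_module gr_prd_linear(1)[OF homog_closed[OF b]]]
        linear_map_zero[OF gr_module gr_module gr_prd_linear(2)[OF homog_closed[OF a]]])+
  have "homog i a = \<zero>\<^bsub>gr\<^esub> \<or> homog j b = \<zero>\<^bsub>gr\<^esub>"
    using True
  proof
    assume "i < 0"
    then have "a \<in> filt A F (i - 1)" using a by (simp add: filt_neg_index)
    then show ?thesis by (intro disjI1 homog_zero)
  next
    assume "j < 0"
    then have "b \<in> filt A F (j - 1)" using b by (simp add: filt_neg_index)
    then show ?thesis by (intro disjI2 homog_zero)
  qed
  moreover have "\<mu> a b = \<zero>\<^bsub>A\<^esub>"
    using True a b c linear_map_zero[OF module_axioms module_axioms \<mu>_lin(1)]
      linear_map_zero[OF module_axioms module_axioms \<mu>_lin(2)]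
    by (auto simp: filt_neg_index)
  moreover have "homog (i + j - int d) \<zero>\<^bsub>A\<^esub> = \<zero>\<^bsub>gr\<^esub>"
    by (rule homog_zero) (rule filt_zero)
  ultimately show ?thesis
    using z by (elim disjE) (simp_all only:)
next
  case False
  then obtain m n where mn: "i = int m" "j = int n"
    by (metis nonneg_int_cases not_less)
  have hm: "homog (int m) a = (\<lambda>l. if l = m then gcoset (int m) a else \<zero>\<^bsub>gr_piece A F l\<^esub>)" for m a
    unfolding homog_def gr_piece_simps(2) by simp
  have ab: "a \<in> F m" "b \<in> F n" using a b mn by (simp_all add: filt_nat)
  show ?thesis
  proof
    fix k
    have "gr_prd
          (\<lambda>l. if l = m then gcoset (int m) a else \<zero>\<^bsub>gr_piece A F l\<^esub>)
          (\<lambda>l. if l = n then gcoset (int n) b else \<zero>\<^bsub>gr_piece A F l\<^esub>) k =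
        (if k + d = m + n then coset_prd d \<mu> m n (gcoset (int m) a) (gcoset (int n) b)
         else \<zero>\<^bsub>gr_piece A F k\<^esub>)"
      by (rule graded_product_single[where Q = "gr_piece A F" and h = "coset_prd d \<mu>" and d = d])
        (assumption | rule gr_piece_module coset_prd_linear gr_piece_carrierI ab)+
    then show "gr_prd (homog i a) (homog j b) k =
        homog (i + j - int d) (\<mu> a b) k"
      unfolding mn hm by (auto simp: homog_def coset_prd_cos[OF ab] gr_piece_simps(2))
  qed
qed

end

end

section \<open>Polarizing a dendriform algebra\<close>

definition polarize_dend ::
    "'r \<Rightarrow> ('r, 'a, dend_op) op_algebra \<Rightarrow> ('r, 'a, pdend_op) op_algebra" where
  "polarize_dend h A = with_products A (\<lambda>p a b. case p of
       Star \<Rightarrow> h \<odot>\<^bsub>A\<^esub> (prd A Succ a b \<oplus>\<^bsub>A\<^esub> prd A Prec b a)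
     | Circ \<Rightarrow> h \<odot>\<^bsub>A\<^esub> (prd A Succ a b \<ominus>\<^bsub>A\<^esub> prd A Prec b a))"

lemma polarize_dend_simps [simp]:
  "carrier (polarize_dend h A) = carrier A"
  "\<zero>\<^bsub>polarize_dend h A\<^esub> = \<zero>\<^bsub>A\<^esub>"
  "x \<oplus>\<^bsub>polarize_dend h A\<^esub> y = x \<oplus>\<^bsub>A\<^esub> y"
  "x \<ominus>\<^bsub>polarize_dend h A\<^esub> y = x \<ominus>\<^bsub>A\<^esub> y"
  "c \<odot>\<^bsub>polarize_dend h A\<^esub> x = c \<odot>\<^bsub>A\<^esub> x"
  "prd (polarize_dend h A) Star a b = h \<odot>\<^bsub>A\<^esub> (prd A Succ a b \<oplus>\<^bsub>A\<^esub> prd A Prec b a)"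
  "prd (polarize_dend h A) Circ a b = h \<odot>\<^bsub>A\<^esub> (prd A Succ a b \<ominus>\<^bsub>A\<^esub> prd A Prec b a)"
  by (simp_all add: polarize_dend_def)

context
  fixes R :: "('r, 'm) ring_scheme" and h :: 'r and A :: "('r, 'a, dend_op) op_algebra"
  assumes A: "nonassoc_algebra R A" and h: "h \<in> carrier R" "h \<oplus>\<^bsub>R\<^esub> h = \<one>\<^bsub>R\<^esub>"
begin

interpretation A: nonassoc_algebra R A by (rule A)

lemma polarize_dend_nonassoc: "nonassoc_algebra R (polarize_dend h A)"
proof -
  interpret P: module R "polarize_dend h A"
    unfolding polarize_dend_def by (rule with_products_module) (rule A.module_axioms)
  note [simp] = A.prd_closed A.prd_add_left A.prd_add_right A.prd_smult_left A.prd_smult_right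
    A.M.add_add_swap A.M.add_diff_swap h
  have comm: "c \<odot>\<^bsub>A\<^esub> (h \<odot>\<^bsub>A\<^esub> x) = h \<odot>\<^bsub>A\<^esub> (c \<odot>\<^bsub>A\<^esub> x)" if "c \<in> carrier R" "x \<in> carrier A" for c x
    using that by (simp add: A.R.m_comm flip: A.smult_assoc1)
  show ?thesis
  proof (rule nonassoc_algebraI[OF P.module_axioms])
    fix p x assume "x \<in> carrier (polarize_dend h A)"
    then show "linear_map R (polarize_dend h A) (polarize_dend h A) (\<lambda>y. prd (polarize_dend h A) p y x)"
      "linear_map R (polarize_dend h A) (polarize_dend h A) (prd (polarize_dend h A) p x)"
      by (intro linear_mapI; cases p; simp add: comm flip: A.smult_r_distr A.smult_diff)+
  qed
qed

text \<open>Applied to \<open>x = a \<succ> b\<close> and \<open>y = b \<prec> a\<close>, this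
  recovers the dendriform products from the polarized ones.\<close>

lemma half_sum_diff:
  assumes "x \<in> carrier A" "y \<in> carrier A"
  shows "h \<odot>\<^bsub>A\<^esub> (x \<oplus>\<^bsub>A\<^esub> y) \<oplus>\<^bsub>A\<^esub> h \<odot>\<^bsub>A\<^esub> (x \<ominus>\<^bsub>A\<^esub> y) = x"
    and "h \<odot>\<^bsub>A\<^esub> (x \<oplus>\<^bsub>A\<^esub> y) \<ominus>\<^bsub>A\<^esub> h \<odot>\<^bsub>A\<^esub> (x \<ominus>\<^bsub>A\<^esub> y) = y"
proof -
  have two: "h \<odot>\<^bsub>A\<^esub> z \<oplus>\<^bsub>A\<^esub> h \<odot>\<^bsub>A\<^esub> z = z" if "z \<in> carrier A" for z
    using that h by (simp flip: A.smult_l_distr)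
  have "h \<odot>\<^bsub>A\<^esub> (x \<oplus>\<^bsub>A\<^esub> y) \<oplus>\<^bsub>A\<^esub> h \<odot>\<^bsub>A\<^esub> (x \<ominus>\<^bsub>A\<^esub> y) =
      (h \<odot>\<^bsub>A\<^esub> x \<oplus>\<^bsub>A\<^esub> h \<odot>\<^bsub>A\<^esub> x) \<oplus>\<^bsub>A\<^esub> (h \<odot>\<^bsub>A\<^esub> y \<oplus>\<^bsub>A\<^esub> \<ominus>\<^bsub>A\<^esub> (h \<odot>\<^bsub>A\<^esub> y))"
    using assms h
    by (simp add: A.smult_r_distr A.smult_r_minus a_minus_def A.M.add_add_swap)
  then show "h \<odot>\<^bsub>A\<^esub> (x \<oplus>\<^bsub>A\<^esub> y) \<oplus>\<^bsub>A\<^esub> h \<odot>\<^bsub>A\<^esub> (x \<ominus>\<^bsub>A\<^esub> y) = x"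
    using assms h by (simp add: two A.M.r_neg)
  have "h \<odot>\<^bsub>A\<^esub> (x \<oplus>\<^bsub>A\<^esub> y) \<ominus>\<^bsub>A\<^esub> h \<odot>\<^bsub>A\<^esub> (x \<ominus>\<^bsub>A\<^esub> y) =
      (h \<odot>\<^bsub>A\<^esub> x \<oplus>\<^bsub>A\<^esub> \<ominus>\<^bsub>A\<^esub> (h \<odot>\<^bsub>A\<^esub> x)) \<oplus>\<^bsub>A\<^esub> (h \<odot>\<^bsub>A\<^esub> y \<oplus>\<^bsub>A\<^esub> h \<odot>\<^bsub>A\<^esub> y)"
    using assms h
    by (simp add: A.smult_r_distr A.smult_r_minus a_minus_def A.M.add_add_swap A.M.minus_add)
  then show "h \<odot>\<^bsub>A\<^esub> (x \<oplus>\<^bsub>A\<^esub> y) \<ominus>\<^bsub>A\<^esub> h \<odot>\<^bsub>A\<^esub> (x \<ominus>\<^bsub>A\<^esub> y) = y"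
    using assms h by (simp add: two A.M.r_neg)
qed

text \<open>Since \<open>\<succ>\<close> is \<open>Star + Circ\<close> and the opposite of
  \<open>\<prec>\<close> is \<open>Star - Circ\<close>, the sum of both polarized products on pairs
  is the product of the dendriform square. The products are compared on the carrier only, hence the
  identity map appears as a homomorphism.\<close>

lemma depolarize_square_polarize_dend:
  "algebra_hom R (depolarize (polarized_square (polarize_dend h A))) (dendriform_square A) (\<lambda>x. x)"
  unfolding algebra_hom_def
proof (intro conjI allI ballI)
  show "linear_map R (depolarize (polarized_square (polarize_dend h A))) (dendriform_square A) (\<lambda>x. x)"
    by (simp add: linear_map_def depolarize_def dendriform_square_def square_module_def split_beta)
  fix p x y
  assume "x \<in> carrier (depolarize (polarized_square (polarize_dend h A)))"
    "y \<in> carrier (depolarize (polarized_square (polarize_dend h A)))"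
  then obtain a u b v where xy: "x = (a, u)" "y = (b, v)"
    and c: "a \<in> carrier A" "u \<in> carrier A" "b \<in> carrier A" "v \<in> carrier A"
    by (auto simp: depolarize_def)
  let ?P = "prd (polarize_dend h A)"
  have cl: "?P q s t \<in> carrier A" if "s \<in> carrier A" "t \<in> carrier A" for q s t
    using nonassoc_algebra.prd_closed[OF polarize_dend_nonassoc, of s t q] that by simp
  have sum: "?P Star s t \<oplus>\<^bsub>A\<^esub> ?P Circ s t = prd A Succ s t"
    and diff: "?P Star s t \<ominus>\<^bsub>A\<^esub> ?P Circ s t = prd A Prec t s"
    if "s \<in> carrier A" "t \<in> carrier A" for s t
    using half_sum_diff[of "prd A Succ s t" "prd A Prec t s"] that by (simp_all add: A.prd_closed)
  have swap: "(s1 \<oplus>\<^bsub>A\<^esub> s2) \<oplus>\<^bsub>A\<^esub> (t1 \<ominus>\<^bsub>A\<^esub> t2) = (s1 \<oplus>\<^bsub>A\<^esub> t1) \<oplus>\<^bsub>A\<^esub> (s2 \<ominus>\<^bsub>A\<^esub> t2)"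
    if "s1 \<in> carrier A" "s2 \<in> carrier A" "t1 \<in> carrier A" "t2 \<in> carrier A" for s1 s2 t1 t2
    using that unfolding a_minus_def by (intro A.M.add_add_swap) simp_all
  have "(?P Star a b \<oplus>\<^bsub>A\<^esub> ?P Star b a) \<oplus>\<^bsub>A\<^esub> (?P Circ a b \<ominus>\<^bsub>A\<^esub> ?P Circ b a) =
      prd A Prec a b \<oplus>\<^bsub>A\<^esub> prd A Succ a b"
    using c by (simp only: swap cl sum diff) (simp add: A.M.a_comm A.prd_closed)
  moreover have "(?P Star a v \<oplus>\<^bsub>A\<^esub> ?P Star b u) \<oplus>\<^bsub>A\<^esub> (?P Circ a v \<ominus>\<^bsub>A\<^esub> ?P Circ b u) =
      prd A Succ a v \<oplus>\<^bsub>A\<^esub> prd A Prec u b"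
    using c by (simp only: swap cl sum diff)
  ultimately show "prd (depolarize (polarized_square (polarize_dend h A))) p x y =
      prd (dendriform_square A) p x y"
    by (cases p) (simp add: xy depolarize_def dendriform_square_def del: polarize_dend_simps(6,7))
qed

text \<open>The dendriform square satisfies the original relations, so the polarized square
  satisfies their polarizations by \<open>eval_polarize\<close>. The dendriform relations follow by
  substitution, and they generate the space.\<close>

lemma polarize_dend_satisfies:
  fixes S :: "('r, one_op) relation set"
  assumes "dendriform_square A \<in> algebra_category R S" "S \<subseteq> carrier (free_algebra R)"
    and "f \<in> relation_space R (pol_dend_relations R S)"
  shows "satisfies R (polarize_dend h A) f"
proof (rule satisfies_relation_space[OF polarize_dend_nonassoc _ _ assms(3)])
  note cring = A.R.is_cring
  show "pol_dend_relations R S \<subseteq> carrier (free_algebra R)"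
    by (rule pol_dend_relations_closed[OF cring assms(2)])
  fix d assume "d \<in> pol_dend_relations R S"
  then obtain p r where d: "d = dend_relation R p (polarize R r)" and r: "r \<in> S"
    unfolding pol_dend_relations_def pol_relations_def by blast
  have rc: "r \<in> carrier (free_algebra R)" using r assms(2) by blast
  let ?P = "polarized_square (polarize_dend h A)"
  note P = polarized_square_nonassoc[OF polarize_dend_nonassoc]
  have "satisfies R ?P (polarize R r)"
    unfolding satisfies_def
  proof
    fix v assume "v \<in> (UNIV :: nat set) \<rightarrow> carrier ?P"
    then have v: "v i \<in> carrier ?P" for i by auto
    have D: "nonassoc_algebra R (dendriform_square A)" "satisfies R (dendriform_square A) r"
      using assms(1) r by (auto simp: algebra_category_def)
    have "eval_relation R ?P v (polarize R r) = eval_relation R (depolarize ?P) v r"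
      by (rule eval_polarize[OF P v rc])
    also have "\<dots> = eval_relation R (dendriform_square A) v r"
      using v
      by (intro algebra_hom_eval_relation[OF depolarize_nonassoc[OF P] D(1)
            depolarize_square_polarize_dend _ rc]) (simp add: depolarize_def)
    also have "\<dots> = \<zero>\<^bsub>dendriform_square A\<^esub>"
      using D(2) v unfolding satisfies_def
      by (intro bspec[of _ _ v]) (auto simp: dendriform_square_def square_module_def)
    also have "\<dots> = \<zero>\<^bsub>?P\<^esub>"
      by (simp add: dendriform_square_def square_module_def)
    finally show "eval_relation R ?P v (polarize R r) = \<zero>\<^bsub>?P\<^esub>" .
  qed
  then show "satisfies R (polarize_dend h A) d"
    unfolding d
    by (rule satisfies_dend_relation[OF polarize_dend_nonassoc
          linear_map_closed[OF linear_map_polarize[OF cring] rc]])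
qed

end


section \<open>Almost commutative filtered dendriform algebras\<close>

lemma (in filtered_algebra) lowering_prd: "lowering 0 (prd A p)"
  unfolding lowering_def
  by (auto simp: linear_map_prd_left linear_map_prd_right filt_prod)

lemma (in filtered_algebra) prd_gr_algebra:
  "prd (gr_algebra A F) p = graded_product (gr_piece A F) 0 (coset_prd 0 (prd A p))"
  by (simp add: gr_algebra_def coset_prd_def[abs_def])

lemma (in filtered_algebra) prd_gr_algebra_homog:
  "\<lbrakk>a \<in> filt A F i; b \<in> filt A F j\<rbrakk>
    \<Longrightarrow> prd (gr_algebra A F) p (homog i a) (homog j b) = homog (i + j) (prd A p a b)"
  using gr_prd_homog[OF lowering_prd] by (simp add: prd_gr_algebra)

text \<open>For nonnegative \<open>k\<close> the component at \<open>k\<close> is the class itself;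
  for negative \<open>k\<close> both elements are zero. Equalities in \<open>gr A\<close> are
  carried back to the filtration in this way.\<close>

lemma homog_eqD:
  assumes "filtered_algebra R A F" "a \<in> filt A F k" "b \<in> filt A F k"
    and "filtered_algebra.homog A F k a = filtered_algebra.homog A F k b"
  shows "a \<ominus>\<^bsub>A\<^esub> b \<in> filt A F (k - 1)"
proof -
  interpret filtered_algebra R A F by fact
  show ?thesis
  proof (cases "k < 0")
    case True
    then show ?thesis
      using assms(2,3) by (simp add: filt_neg_index a_minus_def M.minus_zero)
  next
    case False
    then have "gcoset k a = gcoset k b"
      using fun_cong[OF assms(4), of "nat k"] by (simp add: homog_def)
    then show ?thesis
      using assms(2,3) filt_carrier by (simp add: gcoset_eq_iff)
  qed
qed

context
  fixes R :: "('r, 'm) ring_scheme" and A :: "('r, 'a, dend_op) op_algebra" and F :: "nat \<Rightarrow> 'a set"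
    and \<beta> :: "'a \<Rightarrow> 'a \<Rightarrow> 'a"
  assumes filtered: "filtered_algebra R A F" and comm: "almost_commutative A F"
  defines "\<beta> \<equiv> \<lambda>a b. prd A Succ a b \<ominus>\<^bsub>A\<^esub> prd A Prec b a"
begin

interpretation filtered_algebra R A F by (rule filtered)

text \<open>Almost commutativity says that \<open>a \<succ> b\<close> and \<open>b \<prec> a\<close>
  have the same class in degree \<open>i + j\<close>, so their difference lies one step
  lower.\<close>

private lemma \<beta>_filt:
  assumes a: "a \<in> filt A F i" and b: "b \<in> filt A F j"
  shows "\<beta> a b \<in> filt A F (i + j - 1)"
proof -
  have "prd (gr_algebra A F) Prec (homog j b) (homog i a) =
      prd (gr_algebra A F) Succ (homog i a) (homog j b)"
    using comm homog_closed[OF a] homog_closed[OF b]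
    unfolding almost_commutative_def gr_algebra_def with_products_simps(1) by blast
  then have "homog (i + j) (prd A Succ a b) = homog (i + j) (prd A Prec b a)"
    using a b by (simp add: prd_gr_algebra_homog add.commute)
  then show ?thesis
    unfolding \<beta>_def using filt_prod[OF a b] filt_prod[OF b a]
    by (intro homog_eqD[OF filtered]) (simp_all add: add.commute)
qed

lemma lowering_bracket: "lowering 1 \<beta>"
proof -
  have "linear_map R A A (\<lambda>a. \<beta> a b)" "linear_map R A A (\<beta> b)" if "b \<in> carrier A" for b
    unfolding \<beta>_def using that
    by (auto intro!: linear_mapI simp: prd_closed prd_add_left prd_add_right prd_smult_left
        prd_smult_right M.add_diff_swap smult_diff)
  then show ?thesis
    unfolding lowering_def using \<beta>_filt by simp
qed

private lemma \<beta>_closed: "\<lbrakk>a \<in> carrier A; b \<in> carrier A\<rbrakk> \<Longrightarrow> \<beta> a b \<in> carrier A"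
  by (simp add: \<beta>_def prd_closed)

lemma gr_pol_dend_simps:
  "carrier (gr_pol_dend A F) = carrier gr"
  "\<zero>\<^bsub>gr_pol_dend A F\<^esub> = \<zero>\<^bsub>gr\<^esub>"
  "x \<oplus>\<^bsub>gr_pol_dend A F\<^esub> y = x \<oplus>\<^bsub>gr\<^esub> y"
  "c \<odot>\<^bsub>gr_pol_dend A F\<^esub> x = c \<odot>\<^bsub>gr\<^esub> x"
  "prd (gr_pol_dend A F) Star = graded_product (gr_piece A F) 0 (coset_prd 0 (prd A Succ))"
  "prd (gr_pol_dend A F) Circ = graded_product (gr_piece A F) 1 (coset_prd 1 \<beta>)"
  by (simp_all only: gr_pol_dend_def with_products_simps pdend_op.case prd_gr_algebra)
    (simp_all add: gr_algebra_def gr_bullet_def coset_prd_def[abs_def] \<beta>_def diff_diff_eq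
      del: direct_sum_simps)

lemma gr_pol_dend_nonassoc: "nonassoc_algebra R (gr_pol_dend A F)"
proof -
  interpret G: module R "gr_pol_dend A F"
    unfolding gr_pol_dend_def gr_algebra_def by (intro with_products_module gr_module)
  have lin: "linear_map R (gr_pol_dend A F) (gr_pol_dend A F) \<phi> \<longleftrightarrow> linear_map R gr gr \<phi>" for \<phi>
    by (simp add: linear_map_def gr_pol_dend_simps del: direct_sum_simps)
  note rules = gr_prd_linear[OF lowering_prd] gr_prd_linear[OF lowering_bracket]
  show ?thesis
  proof (rule nonassoc_algebraI[OF G.module_axioms])
    fix p f assume "f \<in> carrier (gr_pol_dend A F)"
    then show "linear_map R (gr_pol_dend A F) (gr_pol_dend A F) (\<lambda>g. prd (gr_pol_dend A F) p g f)"
      "linear_map R (gr_pol_dend A F) (gr_pol_dend A F) (prd (gr_pol_dend A F) p f)"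
      unfolding lin gr_pol_dend_simps(1) by (cases p; simp only: gr_pol_dend_simps; intro rules)+
  qed
qed

section \<open>Evaluation at homogeneous arguments\<close>

context
  fixes h :: 'r and a :: "nat \<Rightarrow> 'a" and d :: "nat \<Rightarrow> int" and t :: 'r
    and P :: "('r, 'a, pdend_op) op_algebra"
  assumes h: "h \<in> carrier R" "h \<oplus>\<^bsub>R\<^esub> h = \<one>\<^bsub>R\<^esub>" and a: "\<And>i. a i \<in> filt A F (d i)"
  defines "t \<equiv> \<one>\<^bsub>R\<^esub> \<oplus>\<^bsub>R\<^esub> \<one>\<^bsub>R\<^esub>" and "P \<equiv> polarize_dend h A"
begin

interpretation P: nonassoc_algebra R P
  unfolding P_def by (rule polarize_dend_nonassoc[OF nonassoc_algebra_axioms h])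

private lemma ac: "a i \<in> carrier P"
  using filt_carrier[OF a] by (simp add: P_def)

private lemma t: "t \<in> carrier R" "t \<otimes>\<^bsub>R\<^esub> h = \<one>\<^bsub>R\<^esub>"
  using h by (simp_all add: t_def R.l_distr)

private definition deg :: "pdend_op monomial \<Rightarrow> int" where
  "deg m = (\<Sum>i\<leftarrow>leaves m. d i) - int (op_count Circ m)"

text \<open>The bullet product is twice the product \<open>Circ\<close> of the polarization, whence the power
  of \<open>2\<close>.\<close>

lemma eval_homog:
  "eval_monomial P a m \<in> filt A F (deg m) \<and>
   eval_monomial (gr_pol_dend A F) (\<lambda>i. homog (d i) (a i)) m =
     homog (deg m) (t [^]\<^bsub>R\<^esub> op_count Circ m \<odot>\<^bsub>A\<^esub> eval_monomial P a m)"
proof (induction m)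
  case (Var i)
  then show ?case using a[of i] filt_carrier[OF a] by (simp add: deg_def)
next
  case (Op p u v)
  let ?x = "eval_monomial P a u" and ?y = "eval_monomial P a v"
  let ?s = "t [^]\<^bsub>R\<^esub> op_count Circ u" and ?r = "t [^]\<^bsub>R\<^esub> op_count Circ v"
  have x: "?x \<in> filt A F (deg u)" "?s \<odot>\<^bsub>A\<^esub> ?x \<in> filt A F (deg u)"
    and y: "?y \<in> filt A F (deg v)" "?r \<odot>\<^bsub>A\<^esub> ?y \<in> filt A F (deg v)"
    using Op t(1) by (simp_all add: filt_smult)
  have c: "?x \<in> carrier A" "?y \<in> carrier A" "?s \<in> carrier R" "?r \<in> carrier R"
    using x y t(1) filt_carrier by auto
  have IH: "eval_monomial (gr_pol_dend A F) (\<lambda>i. homog (d i) (a i)) u = homog (deg u) (?s \<odot>\<^bsub>A\<^esub> ?x)"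
    "eval_monomial (gr_pol_dend A F) (\<lambda>i. homog (d i) (a i)) v = homog (deg v) (?r \<odot>\<^bsub>A\<^esub> ?y)"
    using Op by simp_all
  have PC: "prd P Circ a' b' = h \<odot>\<^bsub>A\<^esub> \<beta> a' b'" for a' b'
    by (simp add: P_def \<beta>_def)
  \<comment> \<open>Moves the powers of 2 attached to both arguments out of the product.\<close>
  have pull: "prd P q (?s \<odot>\<^bsub>A\<^esub> ?x) (?r \<odot>\<^bsub>A\<^esub> ?y) = (?s \<otimes>\<^bsub>R\<^esub> ?r) \<odot>\<^bsub>A\<^esub> prd P q ?x ?y" for q
  proof -
    have cP: "?x \<in> carrier P" "?y \<in> carrier P"
      using c by (simp_all add: P_def)
    have "prd P q (?s \<odot>\<^bsub>P\<^esub> ?x) (?r \<odot>\<^bsub>P\<^esub> ?y) = ?s \<odot>\<^bsub>P\<^esub> (?r \<odot>\<^bsub>P\<^esub> prd P q ?x ?y)"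
      using P.prd_smult_left[OF c(3) cP(1) P.smult_closed[OF c(4) cP(2)]]
        P.prd_smult_right[OF c(4) cP] by simp
    also have "\<dots> = (?s \<otimes>\<^bsub>R\<^esub> ?r) \<odot>\<^bsub>P\<^esub> prd P q ?x ?y"
      using c(3,4) cP P.prd_closed[of ?x ?y q] by (simp add: P.smult_assoc1)
    finally show ?thesis by (simp add: P_def)
  qed
  have filtP: "prd P Star x' y' \<in> filt A F (deg u + deg v)"
    "prd P Circ x' y' \<in> filt A F (deg u + deg v - 1)"
    if "x' \<in> filt A F (deg u)" "y' \<in> filt A F (deg v)" for x' y'
  proof -
    show "prd P Star x' y' \<in> filt A F (deg u + deg v)"
      using filt_prod[OF that, of Succ] filt_prod[OF that(2,1), of Prec] h(1)
      by (simp add: P_def add.commute filt_add filt_smult)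
    show "prd P Circ x' y' \<in> filt A F (deg u + deg v - 1)"
      using \<beta>_filt[OF that] h(1) by (simp add: PC filt_smult)
  qed
  show ?case
  proof (cases p)
    case Star
    have deg: "deg (Op p u v) = deg u + deg v" by (simp add: Star deg_def)
    let ?x' = "?s \<odot>\<^bsub>A\<^esub> ?x" and ?y' = "?r \<odot>\<^bsub>A\<^esub> ?y"
    have c': "?x' \<in> carrier A" "?y' \<in> carrier A" using c by simp_all
    have "prd A Succ ?x' ?y' = prd P Star ?x' ?y' \<oplus>\<^bsub>A\<^esub> prd P Circ ?x' ?y'"
      using half_sum_diff(1)[OF nonassoc_algebra_axioms h, of "prd A Succ ?x' ?y'" "prd A Prec ?y' ?x'"] c'
      by (simp add: P_def prd_closed)
    \<comment> \<open>\<open>\<succ>\<close> and \<open>Star\<close> differ by \<open>Circ\<close>,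
      which lies one filtration step lower, so they have the same class.\<close>
    then have "prd A Succ ?x' ?y' \<ominus>\<^bsub>A\<^esub> prd P Star ?x' ?y' = prd P Circ ?x' ?y'"
      using filtP[OF x(2) y(2)] filt_carrier
      by (simp add: a_minus_def M.a_ac M.r_neg M.r_neg1)
    then have "homog (deg u + deg v) (prd A Succ ?x' ?y') =
        homog (deg u + deg v) (prd P Star ?x' ?y')"
      using filt_prod[OF x(2) y(2)] filtP[OF x(2) y(2)] by (intro homog_eq) simp_all
    then show ?thesis
      using gr_prd_homog[OF lowering_prd x(2) y(2), of Succ] t(1) filtP(1)[OF x(1) y(1)]
      by (simp only: deg) (simp add: Star IH gr_pol_dend_simps pull R.nat_pow_mult)
  next
    case Circ
    have deg: "deg (Op p u v) = deg u + deg v - 1" by (simp add: Circ deg_def)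
    let ?x' = "?s \<odot>\<^bsub>A\<^esub> ?x" and ?y' = "?r \<odot>\<^bsub>A\<^esub> ?y"
    have c': "?x' \<in> carrier A" "?y' \<in> carrier A" using c by simp_all
    \<comment> \<open>The product \<open>Circ\<close> carries the factor \<open>h\<close>, so
      \<open>\<beta>\<close> is \<open>t\<close> times it; this adds one power of 2.\<close>
    have "\<beta> ?x' ?y' = t \<odot>\<^bsub>A\<^esub> prd P Circ ?x' ?y'"
      using c' t h(1) by (simp add: PC \<beta>_closed flip: smult_assoc1)
    also have "\<dots> = (t \<otimes>\<^bsub>R\<^esub> (?s \<otimes>\<^bsub>R\<^esub> ?r)) \<odot>\<^bsub>A\<^esub> prd P Circ ?x ?y"
      using c t(1) h(1) by (simp add: pull PC \<beta>_closed smult_assoc1)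
    also have "t \<otimes>\<^bsub>R\<^esub> (?s \<otimes>\<^bsub>R\<^esub> ?r) = t [^]\<^bsub>R\<^esub> op_count Circ (Op p u v)"
      using t(1) by (simp add: Circ R.nat_pow_mult R.m_comm)
    finally have "\<beta> ?x' ?y' = t [^]\<^bsub>R\<^esub> op_count Circ (Op p u v) \<odot>\<^bsub>A\<^esub> prd P Circ ?x ?y" .
    then show ?thesis
      using gr_prd_homog[OF lowering_bracket x(2) y(2)] filtP(2)[OF x(1) y(1)]
      by (simp only: deg) (simp add: Circ IH gr_pol_dend_simps)
  qed
qed

private lemma gr_var: "homog (d i) (a i) \<in> carrier (gr_pol_dend A F)"
  unfolding gr_pol_dend_simps using a by (rule homog_closed)

private lemma deg_multilinear:
  "multilinear_monomial n m \<Longrightarrow> deg m = (\<Sum>i\<in>{1..n}. d i) - int (op_count Circ m)"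
  unfolding deg_def by (metis sum.distinct_set_conv_list)

text \<open>A monomial of weight at least \<open>w\<close> has degree at most the sum of the
  \<open>d i\<close> minus \<open>w\<close>. Used with \<open>Suc w\<close> for the part beyond the
  lowest weight.\<close>

lemma eval_relation_filt:
  assumes f: "f \<in> carrier (free_algebra R)"
    and supp: "\<forall>m. f m \<noteq> \<zero>\<^bsub>R\<^esub> \<longrightarrow> multilinear_monomial n m \<and> w \<le> op_count Circ m"
  shows "eval_relation R P a f \<in> filt A F ((\<Sum>i\<in>{1..n}. d i) - int w)"
  using R.is_cring f supp
proof (induction rule: free_algebra_supp_induct)
  case zero
  then show ?case
    using linear_map_zero[OF free_algebra_module[OF R.is_cring] P.module_axioms P.linear_map_eval[OF ac]]
    by (simp add: P_def filt_zero)
next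
  case (mono m)
  have "deg m = (\<Sum>i\<in>{1..n}. d i) - int (op_count Circ m)"
    using mono by (intro deg_multilinear) blast
  then have "filt A F (deg m) \<subseteq> filt A F ((\<Sum>i\<in>{1..n}. d i) - int w)"
    using mono by (intro filt_mono) simp
  then show ?case
    using eval_homog[of m] P.eval_relation_mono[OF ac] by auto
next
  case (add f g)
  then show ?case
    using linear_map_add[OF P.linear_map_eval[OF ac] add(1,2)] by (simp add: P_def filt_add)
next
  case (smult c f)
  then show ?case
    using linear_map_smult[OF P.linear_map_eval[OF ac] smult(1,2)] by (simp add: P_def filt_smult)
qed

text \<open>All monomials of \<open>f\<close> have the same degree and the same power of 2, so their
  classes are added in one graded piece and a common scalar can be taken out.\<close>

lemma eval_relation_homog:
  assumes f: "f \<in> carrier (free_algebra R)"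
    and supp: "\<forall>m. f m \<noteq> \<zero>\<^bsub>R\<^esub> \<longrightarrow> multilinear_monomial n m \<and> op_count Circ m = w"
  defines "k \<equiv> (\<Sum>i\<in>{1..n}. d i) - int w"
  shows "eval_relation R P a f \<in> filt A F k \<and>
    eval_relation R (gr_pol_dend A F) (\<lambda>i. homog (d i) (a i)) f =
      homog k (t [^]\<^bsub>R\<^esub> w \<odot>\<^bsub>A\<^esub> eval_relation R P a f)"
  using R.is_cring f supp
proof (induction rule: free_algebra_supp_induct)
  note free = free_algebra_module[OF R.is_cring]
  interpret G: nonassoc_algebra R "gr_pol_dend A F" by (rule gr_pol_dend_nonassoc)
  have linP: "linear_map R (free_algebra R) P (eval_relation R P a)"
    by (rule P.linear_map_eval[OF ac])
  have linG: "linear_map R (free_algebra R) (gr_pol_dend A F)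
      (eval_relation R (gr_pol_dend A F) (\<lambda>i. homog (d i) (a i)))"
    by (rule G.linear_map_eval[OF gr_var])
  have cl: "f \<in> carrier (free_algebra R) \<Longrightarrow> eval_relation R P a f \<in> carrier A" for f
    using linear_map_closed[OF linP] by (simp add: P_def)
  have tw: "t [^]\<^bsub>R\<^esub> w \<in> carrier R" using t(1) by simp
  note homog_zero' = homog_zero[OF filt_zero] and gr_simps = gr_pol_dend_simps(2-4)
  {
    case zero
    then show ?case
      using linear_map_zero[OF free P.module_axioms linP] linear_map_zero[OF free G.module_axioms linG]
        homog_zero' tw
      by (simp add: P_def filt_zero gr_simps del: direct_sum_simps)
  next
    case (mono m)
    have "deg m = (\<Sum>i\<in>{1..n}. d i) - int (op_count Circ m)"
      using mono by (intro deg_multilinear) blast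
    then have "deg m = k" using mono by (simp add: k_def)
    then show ?case
      using eval_homog[of m] P.eval_relation_mono[OF ac] G.eval_relation_mono[OF gr_var] mono by simp
  next
    case (add f g)
    then show ?case
      using linear_map_add[OF linP add(1,2)] linear_map_add[OF linG add(1,2)] tw
        cl[OF add(1)] cl[OF add(2)]
      by (simp add: P_def filt_add filt_smult gr_simps homog_add smult_r_distr del: direct_sum_simps)
  next
    case (smult c f)
    then show ?case
      using linear_map_smult[OF linP smult(1,2)] linear_map_smult[OF linG smult(1,2)] tw
        cl[OF smult(2)]
      by (simp add: P_def filt_smult gr_simps homog_smult R.m_comm del: direct_sum_simps
          flip: smult_assoc1)
  }
qed

text \<open>In \<open>A\<close> the whole relation evaluates to zero, so its part of weight
  \<open>w\<close> equals minus the part of higher weight. The latter lies one filtration step below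
  the degree belonging to \<open>w\<close>, hence the class in that degree is zero.\<close>

lemma eval_weight_part_homog:
  assumes f: "f \<in> carrier (free_algebra R)" "multilinear R n f"
    and sat: "satisfies R P f"
    and low: "\<And>v. v < w \<Longrightarrow> weight_part R Circ v f = \<zero>\<^bsub>free_algebra R\<^esub>"
  shows "eval_relation R (gr_pol_dend A F) (\<lambda>i. homog (d i) (a i)) (weight_part R Circ w f) = \<zero>\<^bsub>gr\<^esub>"
proof -
  let ?g = "weight_part R Circ w f" and ?r = "restr R (\<lambda>m. w < op_count Circ m) f"
  let ?k = "(\<Sum>i\<in>{1..n}. d i) - int w"
  have ml: "f m \<noteq> \<zero>\<^bsub>R\<^esub> \<Longrightarrow> multilinear_monomial n m" for m
    using f(2) by (simp add: multilinear_def)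
  have gc: "?g \<in> carrier (free_algebra R)" and rc: "?r \<in> carrier (free_algebra R)"
    unfolding weight_part_eq_restr by (rule restr_closed[OF R.is_cring f(1)])+
  have low': "f m = \<zero>\<^bsub>R\<^esub>" if "op_count Circ m < w" for m
    using fun_cong[OF low[OF that], of m] by (simp add: weight_part_def free_algebra_simps)
  have "f = ?g \<oplus>\<^bsub>free_algebra R\<^esub> ?r"
  proof
    fix m
    have "f m \<in> carrier R" using f(1) by (simp add: free_algebra_simps)
    then show "f m = (?g \<oplus>\<^bsub>free_algebra R\<^esub> ?r) m"
      using low'[of m] by (cases "op_count Circ m" w rule: linorder_cases)
        (simp_all add: free_algebra_simps weight_part_def restr_def)
  qed
  then have "eval_relation R P a f = eval_relation R P a ?g \<oplus>\<^bsub>A\<^esub> eval_relation R P a ?r"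
    using linear_map_add[OF P.linear_map_eval[OF ac] gc rc] by (simp add: P_def)
  moreover have "eval_relation R P a f = \<zero>\<^bsub>A\<^esub>"
    using sat ac by (auto simp: satisfies_def Pi_iff P_def)
  moreover have cl: "eval_relation R P a ?g \<in> carrier A" "eval_relation R P a ?r \<in> carrier A"
    using linear_map_closed[OF P.linear_map_eval[OF ac]] gc rc by (simp_all add: P_def)
  ultimately have eq: "eval_relation R P a ?g = \<ominus>\<^bsub>A\<^esub> eval_relation R P a ?r"
    using M.minus_equality[OF _ cl(2,1)] by simp
  have "eval_relation R P a ?r \<in> filt A F ((\<Sum>i\<in>{1..n}. d i) - int (Suc w))"
    by (rule eval_relation_filt[OF rc]) (use ml in \<open>auto simp: restr_def split: if_splits\<close>)
  then have "t [^]\<^bsub>R\<^esub> w \<odot>\<^bsub>A\<^esub> eval_relation R P a ?g \<in> filt A F (?k - 1)"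
    unfolding eq using t(1) by (intro filt_smult filt_neg) (simp_all add: algebra_simps)
  moreover have "eval_relation R (gr_pol_dend A F) (\<lambda>i. homog (d i) (a i)) ?g =
      homog ?k (t [^]\<^bsub>R\<^esub> w \<odot>\<^bsub>A\<^esub> eval_relation R P a ?g)"
    by (rule conjunct2[OF eval_relation_homog[OF gc]])
      (use ml in \<open>auto simp: weight_part_def split: if_splits\<close>)
  ultimately show ?thesis
    by (simp only: homog_zero)
qed

end

text \<open>Homogeneous elements generate \<open>gr A\<close> by addition and the relation is
  multilinear, so evaluation at homogeneous arguments is enough.\<close>

lemma gr_satisfies_weight_part:
  assumes "h \<in> carrier R" "h \<oplus>\<^bsub>R\<^esub> h = \<one>\<^bsub>R\<^esub>"
    and f: "f \<in> carrier (free_algebra R)" "multilinear R n f"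
    and sat: "satisfies R (polarize_dend h A) f"
    and low: "\<And>v. v < w \<Longrightarrow> weight_part R Circ v f = \<zero>\<^bsub>free_algebra R\<^esub>"
  shows "satisfies R (gr_pol_dend A F) (weight_part R Circ w f)"
proof -
  interpret G: nonassoc_algebra R "gr_pol_dend A F" by (rule gr_pol_dend_nonassoc)
  let ?H = "{homog k a | k a. a \<in> filt A F k}"
  have gc: "weight_part R Circ w f \<in> carrier (free_algebra R)"
    unfolding weight_part_eq_restr by (rule restr_closed[OF R.is_cring f(1)])
  have gm: "multilinear R n (weight_part R Circ w f)"
    using f(2) by (auto simp: multilinear_def weight_part_def)
  have "eval_relation R (gr_pol_dend A F) v (weight_part R Circ w f) \<in> {\<zero>\<^bsub>gr\<^esub>}"
    if v: "\<And>i. v i \<in> carrier (gr_pol_dend A F)" for v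
  proof (rule G.eval_multilinear_spanning[OF gc gm _ _ _ _ _ v])
    show "?H \<subseteq> carrier (gr_pol_dend A F)"
      unfolding gr_pol_dend_simps using homog_closed by blast
    show "?H \<noteq> {}" using filt_zero by blast
    show "carrier (gr_pol_dend A F) \<subseteq> H"
      if "?H \<subseteq> H" "\<And>x y. \<lbrakk>x \<in> H; y \<in> H\<rbrakk> \<Longrightarrow> x \<oplus>\<^bsub>gr_pol_dend A F\<^esub> y \<in> H" for H
      unfolding gr_pol_dend_simps using that(1) that(2)[unfolded gr_pol_dend_simps]
      by (intro gr_spanned) blast+
    show "x \<oplus>\<^bsub>gr_pol_dend A F\<^esub> y \<in> {\<zero>\<^bsub>gr\<^esub>}" if "x \<in> {\<zero>\<^bsub>gr\<^esub>}" "y \<in> {\<zero>\<^bsub>gr\<^esub>}" for x y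
      using that G.M.l_zero[OF G.M.zero_closed] by (simp add: gr_pol_dend_simps del: direct_sum_simps)
    fix v :: "nat \<Rightarrow> nat \<Rightarrow> 'a set" assume "\<And>i. v i \<in> ?H"
    then have "\<forall>i. \<exists>ka. v i = homog (fst ka) (snd ka) \<and> snd ka \<in> filt A F (fst ka)"
      by fastforce
    then obtain ka where ka: "\<And>i. v i = homog (fst (ka i)) (snd (ka i))"
      "\<And>i. snd (ka i) \<in> filt A F (fst (ka i))"
      by metis
    have "v = (\<lambda>i. homog (fst (ka i)) (snd (ka i)))" using ka(1) by blast
    then show "eval_relation R (gr_pol_dend A F) v (weight_part R Circ w f) \<in> {\<zero>\<^bsub>gr\<^esub>}"
      using eval_weight_part_homog[OF assms(1,2) ka(2) f sat low] by simp
  qed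
  then show ?thesis
    by (auto simp: satisfies_def Pi_iff gr_pol_dend_simps(2) simp del: direct_sum_simps)
qed

end

text \<open>The type variable \<open>'d\<close> is independent of the type of \<open>A\<close>, so
  the equality of the two categories covers algebras on every carrier type and not only that of
  \<open>gr A\<close>.\<close>

theorem proposition4p21:
  fixes R :: "('r, 'm) ring_scheme"
    and Rs :: "('r, one_op) relation list"
    and A :: "('r, 'a, dend_op) op_algebra"
    and F :: "nat \<Rightarrow> 'a set"
  assumes "cring R"
    and "\<one>\<^bsub>R\<^esub> \<oplus>\<^bsub>R\<^esub> \<one>\<^bsub>R\<^esub> \<in> Units R"
    and "set Rs \<subseteq> carrier (free_algebra R)"
    and "\<forall>r\<in>set Rs. \<exists>n. multilinear R n r"
    and "filtered_algebra R A F"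
    and "A \<in> dendriform R (algebra_category R (set Rs))"
    and "almost_commutative A F"
  shows "gr_pol_dend A F \<in> lowest_pol_dend_category R (set Rs) \<and>
    (lowest_pol_dend_category R (set Rs) :: ('r, 'd, pdend_op) op_algebra set)
      = polarized_dendriform R (lowest_pol_category R (set Rs))"
proof
  interpret R: cring R by fact
  interpret A: filtered_algebra R A F by fact
  note closed = pol_dend_relations_closed[OF assms(1,3)]
  interpret G: nonassoc_algebra R "gr_pol_dend A F"
    by (rule gr_pol_dend_nonassoc[OF assms(5,7)])
  obtain h where h: "h \<in> carrier R" "h \<otimes>\<^bsub>R\<^esub> (\<one>\<^bsub>R\<^esub> \<oplus>\<^bsub>R\<^esub> \<one>\<^bsub>R\<^esub>) = \<one>\<^bsub>R\<^esub>"
    using assms(2) unfolding Units_def by blast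
  then have hh: "h \<oplus>\<^bsub>R\<^esub> h = \<one>\<^bsub>R\<^esub>"
    by (simp add: R.r_distr)
  have "satisfies R (gr_pol_dend A F) (lowest_part R Circ {\<zero>\<^bsub>free_algebra R\<^esub>} f)"
    if f: "f \<in> relation_space R (pol_dend_relations R (set Rs))" for f
  proof -
    have fc: "f \<in> carrier (free_algebra R)"
      using relation_space_closed[OF assms(1) closed] f by blast
    have "satisfies R (gr_pol_dend A F) (weight_part R Circ w f)"
      if low: "\<forall>v<w. weight_part R Circ v f \<in> {\<zero>\<^bsub>free_algebra R\<^esub>}" for w
    \<comment> \<open>Split by arity, since the passage through homogeneous arguments asks for an
      \<open>n\<close>-linear relation; the vanishing of the low weights passes to each
      component.\<close>
    proof (rule G.satisfies_partition[where \<kappa> = "\<lambda>m. length (leaves m)"])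
      show "weight_part R Circ w f \<in> carrier (free_algebra R)"
        unfolding weight_part_eq_restr by (rule restr_closed[OF assms(1) fc])
      fix n
      let ?f = "restr R (\<lambda>m. length (leaves m) = n) f"
      have comm: "weight_part R Circ v ?f =
          restr R (\<lambda>m. length (leaves m) = n) (weight_part R Circ v f)" for v
        by (simp add: weight_part_eq_restr restr_restr conj_commute)
      have "satisfies R (gr_pol_dend A F) (weight_part R Circ w ?f)"
      proof (rule gr_satisfies_weight_part[OF assms(5,7) h(1) hh])
        show "?f \<in> carrier (free_algebra R)"
          by (rule restr_closed[OF assms(1) fc])
        show "multilinear R n ?f"
          by (rule relation_space_restr_length(2)[OF assms(1) closed f])
        show "satisfies R (polarize_dend h A) ?f"
          using assms(6) relation_space_restr_length(1)[OF assms(1) closed f]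
          by (intro polarize_dend_satisfies[OF A.nonassoc_algebra_axioms h(1) hh _ assms(3)])
            (auto simp: dendriform_def)
        show "weight_part R Circ v ?f = \<zero>\<^bsub>free_algebra R\<^esub>" if "v < w" for v
          using low that by (simp add: comm restr_zero)
      qed
      then show "satisfies R (gr_pol_dend A F)
          (restr R (\<lambda>m. length (leaves m) = n) (weight_part R Circ w f))"
        by (simp only: comm)
    qed
    then show ?thesis
      using G.satisfies_zero by (subst satisfies_lowest_part_iff) auto
  qed
  then show "gr_pol_dend A F \<in> lowest_pol_dend_category R (set Rs)"
    using G.nonassoc_algebra_axioms by (simp add: lowest_pol_dend_category_def)
  show "lowest_pol_dend_category R (set Rs) = polarized_dendriform R (lowest_pol_category R (set Rs))"
    by (rule lowest_pol_dend_category_eq[OF assms(1,3,2)])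
qed

end
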